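(* Let $M$ be a closed manifold of dimension $n\ge2$ and let $\sigma$ be a nowhere vanishing closed $2$-form on $M$. Then for every Riemannian metric $g$ on $M$ there exists a $C^2$-neighborhood $\mathcal V$ of the identically zero function such that for every smooth potential $U\in\mathcal V$ one has $\nu_{\mathrm{Ric}}(g,\sigma,U)>e_0$, where $e_0=\max_MU$ and $$\nu_{\mathrm{Ric}}(g,\sigma,U)=\sup\{k>e_0\ :\ \mathrm{Ric}^{g,\sigma,U}_s>0\ \text{on } E_s\ \text{for all } s\in(e_0,k)\}.$$
   Context: "Nowhere vanishing" means $\sigma_p\ne0$ for every $p\in M$. The supremum of the empty set is understood to be $e_0$ (so the conclusion says that there is $k>e_0$ with $\mathrm{Ric}^{g,\sigma,U}_s>0$ for all $s\in(e_0,k)$); the supremum may be $+\infty$. For a smooth function $U$, the energy level is $E_k=\{(p,v)\in TM: \tfrac12 g(v,v)+U(p)=k\}$. The Lorentz endomorphism $Y^{g,\sigma}:TM\to TM$ is defined by $g(Y^{g,\sigma}v,w)=\sigma(v,w)$. Magnetic Ricci curvature: for a metric $g$ let $S^gM$ be its unit tangent bundle, $\nabla^g$ its Levi-Civita connection and $\mathrm{Ric}^g:S^gM\to\mathbb R$, $v\mapsto \mathrm{Ric}^g(v,v)$ its Ricci curvature. For $v\in S^gM$ with base point $p$, consider the endomorphisms of $T_pM$ $$(\nabla Y^{g,\sigma})_v:w\mapsto(\nabla^g_wY^{g,\sigma})v,\qquad (\widetilde Y^{g,\sigma})_v:w\mapsto\tfrac34 g(w,Y^{g,\sigma}v)\,Y^{g,\sigma}v-\tfrac14Y^{g,\sigma}Y^{g,\sigma}w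 .$$ The magnetic Ricci curvature is the function $\mathrm{Ric}^{g,\sigma}:S^gM\to\mathbb R$, $\mathrm{Ric}^{g,\sigma}(v)=\mathrm{Ric}^g(v)-\mathrm{trace}\big((\nabla Y^{g,\sigma}-\widetilde Y^{g,\sigma})_v\big)$. Electromagnetic Ricci curvature: for $k>e_0$ let $g_k=2(k-U)g$, let $P_k:E_k\to S^{g_k}M$, $P_k(v)=v/\sqrt{g_k(v,v)}$, and set $\mathrm{Ric}^{g,\sigma,U}_k:=\mathrm{Ric}^{g_k,\sigma}\circ P_k:E_k\to\mathbb R$. *)

theory Defs
  imports "HOL-Analysis.Analysis"
begin

section \<open>Differentiability classes on open subsets of Euclidean space\<close>

abbreviation dird ::
    "('a::real_normed_vector \<Rightarrow> 'b::real_normed_vector) \<Rightarrow> 'a \<Rightarrow> 'a \<Rightarrow> 'b"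
  where "dird f x u \<equiv> frechet_derivative f (at x) u"

primrec Ck_on ::
    "nat \<Rightarrow> 'a::euclidean_space set \<Rightarrow> ('a \<Rightarrow> 'b::real_normed_vector) \<Rightarrow> bool"
  where
    "Ck_on 0 S f \<longleftrightarrow> continuous_on S f"
  | "Ck_on (Suc k) S f \<longleftrightarrow>
       (\<forall>x\<in>S. f differentiable (at x)) \<and> (\<forall>u. Ck_on k S (\<lambda>x. dird f x u))"

definition smooth_on :: "'a::euclidean_space set \<Rightarrow> ('a \<Rightarrow> 'b::real_normed_vector) \<Rightarrow> bool"
  where "smooth_on S f \<longleftrightarrow> (\<forall>k. Ck_on k S f)"


section \<open>Smooth manifolds\<close>

text \<open>
  A chart is a pair of its domain and its coordinate map; the values of the map outside the
  domain are irrelevant. The underlying set of a manifold is the whole type \<open>'m\<close>, its dimension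
  is \<open>CARD('n)\<close>. Besides the atlas, the structure records a preferred chart around every point.
  It serves only to represent the tangent space at \<open>p\<close> concretely: a tangent vector at \<open>p\<close> is
  given by its components in \<open>chart_at M p\<close>, so each tangent space is the vector space
  \<open>real ^ 'n\<close>, and the tangent bundle is \<open>'m \<times> (real ^ 'n)\<close> as a set.
\<close>

type_synonym ('m, 'n) chart = "'m set \<times> ('m \<Rightarrow> real ^ 'n)"

record ('m, 'n) mfd =
  charts :: "('m, 'n) chart set"
  chart_at :: "'m \<Rightarrow> ('m, 'n) chart"

abbreviation cdom :: "('m, 'n) chart \<Rightarrow> 'm set"
  where "cdom c \<equiv> fst c"

abbreviation cmap :: "('m, 'n) chart \<Rightarrow> 'm \<Rightarrow> real ^ 'n"
  where "cmap c \<equiv> snd c"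

abbreviation cimg :: "('m, 'n) chart \<Rightarrow> (real ^ 'n) set"
  where "cimg c \<equiv> cmap c ` cdom c"

abbreviation cinv :: "('m, 'n) chart \<Rightarrow> real ^ 'n \<Rightarrow> 'm"
  where "cinv c \<equiv> inv_into (cdom c) (cmap c)"

definition smooth_manifold ::
    "('m::{t2_space, second_countable_topology}, 'n::finite) mfd \<Rightarrow> bool"
  where "smooth_manifold M \<longleftrightarrow>
    (\<forall>c\<in>charts M. open (cdom c) \<and> open (cimg c) \<and>
        homeomorphism (cdom c) (cimg c) (cmap c) (cinv c)) \<and>
    (\<forall>c\<in>charts M. \<forall>d\<in>charts M.
        smooth_on (cmap c ` (cdom c \<inter> cdom d)) (cmap d \<circ> cinv c)) \<and>
    (\<forall>p. chart_at M p \<in> charts M \<and> p \<in> cdom (chart_at M p))"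

definition closed_manifold ::
    "('m::{t2_space, second_countable_topology}, 'n::finite) mfd \<Rightarrow> bool"
  where "closed_manifold M \<longleftrightarrow> smooth_manifold M \<and> compact (UNIV :: 'm set)"

definition Ck_function :: "('m, 'n::finite) mfd \<Rightarrow> nat \<Rightarrow> ('m \<Rightarrow> real) \<Rightarrow> bool"
  where "Ck_function M k f \<longleftrightarrow> (\<forall>c\<in>charts M. Ck_on k (cimg c) (f \<circ> cinv c))"

definition smooth_function :: "('m, 'n::finite) mfd \<Rightarrow> ('m \<Rightarrow> real) \<Rightarrow> bool"
  where "smooth_function M f \<longleftrightarrow> (\<forall>c\<in>charts M. smooth_on (cimg c) (f \<circ> cinv c))"


subsection \<open>The $C^2$ topology\<close>

text \<open>
  The usual (compact-open) $C^2$ topology: the values and the first and second partial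
  derivatives in a chart are controlled uniformly over a compact subset of the chart domain.
\<close>

definition C2_ball ::
    "('m::topological_space, 'n::finite) mfd \<Rightarrow> ('m \<Rightarrow> real) \<Rightarrow> ('m, 'n) chart \<Rightarrow> 'm set \<Rightarrow> real
      \<Rightarrow> ('m \<Rightarrow> real) set"
  where "C2_ball M f c K \<epsilon> =
    {h. Ck_function M 2 h \<and>
        (\<forall>x\<in>cmap c ` K. let F = f \<circ> cinv c; H = h \<circ> cinv c in
           \<bar>H x - F x\<bar> < \<epsilon> \<and>
           (\<forall>i. \<bar>dird H x (axis i 1) - dird F x (axis i 1)\<bar> < \<epsilon>) \<and>
           (\<forall>i j. \<bar>dird (\<lambda>y. dird H y (axis i 1)) x (axis j 1)
                   - dird (\<lambda>y. dird F y (axis i 1)) x (axis j 1)\<bar> < \<epsilon>))}"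

definition C2_topology :: "('m::topological_space, 'n::finite) mfd \<Rightarrow> ('m \<Rightarrow> real) topology"
  where "C2_topology M = topology_generated_by
    {C2_ball M f c K \<epsilon> | f c K \<epsilon>.
       Ck_function M 2 f \<and> c \<in> charts M \<and> compact K \<and> K \<subseteq> cdom c \<and> \<epsilon> > 0}"

definition C2_neighborhood ::
    "('m::topological_space, 'n::finite) mfd \<Rightarrow> ('m \<Rightarrow> real) \<Rightarrow> ('m \<Rightarrow> real) set \<Rightarrow> bool"
  where "C2_neighborhood M f V \<longleftrightarrow>
    V \<subseteq> topspace (C2_topology M) \<and> (\<exists>W. openin (C2_topology M) W \<and> f \<in> W \<and> W \<subseteq> V)"


section \<open>Tensor fields\<close>

text \<open>
  \<open>vec_of_coords M c x\<close> sends components with respect to the chart \<open>c\<close> to the tangent vector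
  at \<open>cinv c x\<close> having these components; \<open>coords_of_vec M c p\<close> is the inverse operation.
\<close>

definition vec_of_coords ::
    "('m, 'n::finite) mfd \<Rightarrow> ('m, 'n) chart \<Rightarrow> real ^ 'n \<Rightarrow> real ^ 'n \<Rightarrow> real ^ 'n"
  where "vec_of_coords M c x \<xi> = dird (cmap (chart_at M (cinv c x)) \<circ> cinv c) x \<xi>"

definition coords_of_vec ::
    "('m, 'n::finite) mfd \<Rightarrow> ('m, 'n) chart \<Rightarrow> 'm \<Rightarrow> real ^ 'n \<Rightarrow> real ^ 'n"
  where "coords_of_vec M c p v =
    dird (cmap c \<circ> cinv (chart_at M p)) (cmap (chart_at M p) p) v"

type_synonym ('m, 'n) tensor02 = "'m \<Rightarrow> real ^ 'n \<Rightarrow> real ^ 'n \<Rightarrow> real"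

type_synonym ('m, 'n) endo_field = "'m \<Rightarrow> real ^ 'n \<Rightarrow> real ^ 'n"

definition rep_tensor ::
    "('m, 'n::finite) mfd \<Rightarrow> ('m, 'n) chart \<Rightarrow> ('m, 'n) tensor02
      \<Rightarrow> real ^ 'n \<Rightarrow> real ^ 'n \<Rightarrow> real ^ 'n \<Rightarrow> real"
  where "rep_tensor M c T x \<xi> \<eta> =
    T (cinv c x) (vec_of_coords M c x \<xi>) (vec_of_coords M c x \<eta>)"

definition rep_endo ::
    "('m, 'n::finite) mfd \<Rightarrow> ('m, 'n) chart \<Rightarrow> ('m, 'n) endo_field
      \<Rightarrow> real ^ 'n \<Rightarrow> real ^ 'n \<Rightarrow> real ^ 'n"
  where "rep_endo M c Y x \<xi> =
    coords_of_vec M c (cinv c x) (Y (cinv c x) (vec_of_coords M c x \<xi>))"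

definition smooth_tensor :: "('m, 'n::finite) mfd \<Rightarrow> ('m, 'n) tensor02 \<Rightarrow> bool"
  where "smooth_tensor M T \<longleftrightarrow>
    (\<forall>p. bilinear (T p)) \<and>
    (\<forall>c\<in>charts M. \<forall>\<xi> \<eta>. smooth_on (cimg c) (\<lambda>x. rep_tensor M c T x \<xi> \<eta>))"

definition riemannian_metric :: "('m, 'n::finite) mfd \<Rightarrow> ('m, 'n) tensor02 \<Rightarrow> bool"
  where "riemannian_metric M g \<longleftrightarrow>
    smooth_tensor M g \<and> (\<forall>p v w. g p v w = g p w v) \<and> (\<forall>p v. v \<noteq> 0 \<longrightarrow> g p v v > 0)"

definition two_form :: "('m, 'n::finite) mfd \<Rightarrow> ('m, 'n) tensor02 \<Rightarrow> bool"
  where "two_form M \<sigma> \<longleftrightarrow> smooth_tensor M \<sigma> \<and> (\<forall>p v w. \<sigma> p v w = - \<sigma> p w v)"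

text \<open>
  The exterior derivative in a chart, evaluated on constant coordinate vector fields
  (whose brackets vanish).
\<close>

definition closed_two_form :: "('m, 'n::finite) mfd \<Rightarrow> ('m, 'n) tensor02 \<Rightarrow> bool"
  where "closed_two_form M \<sigma> \<longleftrightarrow> two_form M \<sigma> \<and>
    (\<forall>c\<in>charts M. \<forall>x\<in>cimg c. \<forall>\<xi> \<eta> \<zeta>.
        dird (\<lambda>y. rep_tensor M c \<sigma> y \<eta> \<zeta>) x \<xi>
      + dird (\<lambda>y. rep_tensor M c \<sigma> y \<zeta> \<xi>) x \<eta>
      + dird (\<lambda>y. rep_tensor M c \<sigma> y \<xi> \<eta>) x \<zeta> = 0)"


section \<open>Levi-Civita connection and Ricci curvature\<close>

text \<open>
  Here \<open>G\<close> is the coordinate expression of a metric. \<open>christoffel G x \<xi> \<eta>\<close> is the covariant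
  derivative at \<open>x\<close>, in direction \<open>\<xi>\<close>, of the vector field with constant components \<open>\<eta>\<close>; it is
  determined by the Koszul formula, in which the bracket terms vanish for constant fields.
  The curvature convention is
  $R(\xi,\eta)\zeta = \nabla_\xi\nabla_\eta\zeta - \nabla_\eta\nabla_\xi\zeta
     - \nabla_{[\xi,\eta]}\zeta$,
  so that the Ricci curvature of round spheres is positive.
\<close>

definition christoffel ::
    "(real ^ 'n \<Rightarrow> real ^ 'n \<Rightarrow> real ^ 'n \<Rightarrow> real)
      \<Rightarrow> real ^ 'n \<Rightarrow> real ^ 'n \<Rightarrow> real ^ 'n \<Rightarrow> real ^ 'n::finite"
  where "christoffel G x \<xi> \<eta> = (THE \<gamma>. \<forall>\<zeta>. 2 * G x \<gamma> \<zeta> =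
      dird (\<lambda>y. G y \<eta> \<zeta>) x \<xi> + dird (\<lambda>y. G y \<xi> \<zeta>) x \<eta> - dird (\<lambda>y. G y \<xi> \<eta>) x \<zeta>)"

definition curvature ::
    "(real ^ 'n \<Rightarrow> real ^ 'n \<Rightarrow> real ^ 'n \<Rightarrow> real)
      \<Rightarrow> real ^ 'n \<Rightarrow> real ^ 'n \<Rightarrow> real ^ 'n \<Rightarrow> real ^ 'n \<Rightarrow> real ^ 'n::finite"
  where "curvature G x \<xi> \<eta> \<zeta> = (let \<Gamma> = christoffel G in
      dird (\<lambda>y. \<Gamma> y \<eta> \<zeta>) x \<xi> - dird (\<lambda>y. \<Gamma> y \<xi> \<zeta>) x \<eta>
      + \<Gamma> x \<xi> (\<Gamma> x \<eta> \<zeta>) - \<Gamma> x \<eta> (\<Gamma> x \<xi> \<zeta>))"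

definition cov_deriv_endo ::
    "(real ^ 'n \<Rightarrow> real ^ 'n \<Rightarrow> real ^ 'n \<Rightarrow> real) \<Rightarrow> (real ^ 'n \<Rightarrow> real ^ 'n \<Rightarrow> real ^ 'n)
      \<Rightarrow> real ^ 'n \<Rightarrow> real ^ 'n \<Rightarrow> real ^ 'n \<Rightarrow> real ^ 'n::finite"
  where "cov_deriv_endo G Y x \<xi> \<eta> = (let \<Gamma> = christoffel G in
      dird (\<lambda>y. Y y \<eta>) x \<xi> + \<Gamma> x \<xi> (Y x \<eta>) - Y x (\<Gamma> x \<xi> \<eta>))"

abbreviation endo_trace :: "(real ^ 'n \<Rightarrow> real ^ 'n) \<Rightarrow> real"
  where "endo_trace L \<equiv> trace (matrix L)"

text \<open>
  Ricci curvature and covariant derivatives at \<open>p\<close> are computed in the chart \<open>chart_at M p\<close>,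
  whose components at \<open>p\<close> are the chosen representation of the tangent space.
\<close>

definition Ric :: "('m, 'n::finite) mfd \<Rightarrow> ('m, 'n) tensor02 \<Rightarrow> 'm \<Rightarrow> real ^ 'n \<Rightarrow> real"
  where "Ric M g p v = (let c = chart_at M p in
      endo_trace (\<lambda>w. curvature (rep_tensor M c g) (cmap c p) w v v))"

text \<open>\<open>nabla_endo M g Y p w v\<close> is $(\nabla^g_w Y)v$.\<close>

definition nabla_endo ::
    "('m, 'n::finite) mfd \<Rightarrow> ('m, 'n) tensor02 \<Rightarrow> ('m, 'n) endo_field
      \<Rightarrow> 'm \<Rightarrow> real ^ 'n \<Rightarrow> real ^ 'n \<Rightarrow> real ^ 'n"
  where "nabla_endo M g Y p w v = (let c = chart_at M p in
      cov_deriv_endo (rep_tensor M c g) (rep_endo M c Y) (cmap c p) w v)"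


section \<open>Magnetic and electromagnetic Ricci curvature\<close>

definition lorentz :: "('m, 'n::finite) tensor02 \<Rightarrow> ('m, 'n) tensor02 \<Rightarrow> ('m, 'n) endo_field"
  where "lorentz g \<sigma> p v = (THE u. \<forall>w. g p u w = \<sigma> p v w)"

definition Y_tilde ::
    "('m, 'n::finite) tensor02 \<Rightarrow> ('m, 'n) tensor02
      \<Rightarrow> 'm \<Rightarrow> real ^ 'n \<Rightarrow> real ^ 'n \<Rightarrow> real ^ 'n"
  where "Y_tilde g \<sigma> p v w = (let Y = lorentz g \<sigma> p in
      (3 / 4 * g p w (Y v)) *\<^sub>R Y v - (1 / 4) *\<^sub>R Y (Y w))"

definition magnetic_Ric ::
    "('m, 'n::finite) mfd \<Rightarrow> ('m, 'n) tensor02 \<Rightarrow> ('m, 'n) tensor02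
      \<Rightarrow> 'm \<times> (real ^ 'n) \<Rightarrow> real"
  where "magnetic_Ric M g \<sigma> = (\<lambda>(p, v).
      Ric M g p v
      - endo_trace (\<lambda>w. nabla_endo M g (lorentz g \<sigma>) p w v - Y_tilde g \<sigma> p v w))"

definition energy_level ::
    "('m, 'n::finite) tensor02 \<Rightarrow> ('m \<Rightarrow> real) \<Rightarrow> real \<Rightarrow> ('m \<times> (real ^ 'n)) set"
  where "energy_level g U k = {(p, v). 1 / 2 * g p v v + U p = k}"

definition jacobi_metric ::
    "('m, 'n::finite) tensor02 \<Rightarrow> ('m \<Rightarrow> real) \<Rightarrow> real \<Rightarrow> ('m, 'n) tensor02"
  where "jacobi_metric g U k p v w = 2 * (k - U p) * g p v w"

definition normalize_vec ::
    "('m, 'n::finite) tensor02 \<Rightarrow> 'm \<times> (real ^ 'n) \<Rightarrow> 'm \<times> (real ^ 'n)"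
  where "normalize_vec g = (\<lambda>(p, v). (p, (1 / sqrt (g p v v)) *\<^sub>R v))"

definition em_Ric ::
    "('m, 'n::finite) mfd \<Rightarrow> ('m, 'n) tensor02 \<Rightarrow> ('m, 'n) tensor02 \<Rightarrow> ('m \<Rightarrow> real) \<Rightarrow> real
      \<Rightarrow> 'm \<times> (real ^ 'n) \<Rightarrow> real"
  where "em_Ric M g \<sigma> U k =
      magnetic_Ric M (jacobi_metric g U k) \<sigma> \<circ> normalize_vec (jacobi_metric g U k)"

text \<open>For continuous \<open>U\<close> on a compact space the supremum is attained.\<close>

definition max_value :: "('m \<Rightarrow> real) \<Rightarrow> real"
  where "max_value U = (SUP p. U p)"

definition nu_Ric ::
    "('m, 'n::finite) mfd \<Rightarrow> ('m, 'n) tensor02 \<Rightarrow> ('m, 'n) tensor02 \<Rightarrow> ('m \<Rightarrow> real) \<Rightarrow> ereal"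
  where "nu_Ric M g \<sigma> U =
    (let e0 = max_value U;
         K = {k. k > e0 \<and>
                (\<forall>s. e0 < s \<and> s < k \<longrightarrow> (\<forall>z\<in>energy_level g U s. em_Ric M g \<sigma> U s z > 0))}
     in if K = {} then ereal e0 else (SUP k\<in>K. ereal k))"

end

theory Submission
  imports Defs
begin

text \<open>
  Write $F = 2(s-U)$, so that $g_s = Fg$, and put $a = \sqrt F$, $v = u/a$ with $g(u,u)=1$. In a
  chart, $a^4\,\mathrm{Ric}^{g_s,\sigma}(v)$ is a polynomial in $a$, $p_i = \partial_iF/(2a)$ and
  $m_{ij} = \partial_i\partial_jF/2 - 2p_ip_j$ whose coefficients depend continuously on the point and
  on $u$. At $a = p = m = 0$ only the trace of $\widetilde Y$ survives; it equals
  $\frac34|Yu|^2 - \frac14\mathrm{tr}\,Y^2 > 0$ because $Y \ne 0$ is skew. By compactness positivity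
  persists for small $a$, $p$, $m$. If $U$ is $C^2$-small and $s$ is close to $\max U$, then $F$ and
  its second derivatives are small, and so is $p$: since $F > 0$, the elementary inequality
  $|dF|^2 \le 2F\sup|D^2F|$ bounds $|dF|^2/F$. A finite cover by charts
  gives uniformity; as the preferred charts defining the tangent spaces are arbitrary, this needs the
  invariance of the local expression under coordinate changes.
\<close>


section \<open>Calculus of smooth functions\<close>

text \<open>The obstacle is that g_s degenerates as s decreases to max U: where U is maximal, F
  tends to 0 and the curvature of g_s need not stay bounded, so there is no limiting metric from
  which to argue by continuity. The exponent 4 is dictated by the magnetic term: the Lorentz
  endomorphism of Fg is Y/F, so its square contributes exactly a^-4. The remaining terms are of no
  worse order once the derivatives of log F are measured in units of 1/a. After multiplication by
  a^4, the value a = 0 is an ordinary point of a polynomial expression, although no metric exists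
  there. The numbers a, p, m are treated as independent parameters. Forgetting that they come from
  one function F makes the threshold independent of U and s, and compactness is then needed only for
  points and directions. Smallness of a does not make p and m small, which is why derivatives of U
  have to be controlled. Bounding p at a point uses F in a whole ball around it, so the C^2 control
  is imposed on a larger compact set than the one where positivity is concluded.\<close>

lemma dird_cong_open:
  assumes "open S" "x \<in> S" "\<And>y. y \<in> S \<Longrightarrow> f y = g y"
  shows "dird f x = dird g x"
proof -
  \<comment> \<open>\<open>frechet_derivative\<close> is a choice term: equivalent predicates give
    equal values, so differentiability need not be known.\<close>
  have "(f has_derivative D) (at x) \<longleftrightarrow> (g has_derivative D) (at x)" for D
    using assms by (metis has_derivative_transform_within_open)
  then show ?thesis unfolding frechet_derivative_def by simp
qed

lemma differentiable_cong_open: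
  assumes "open S" "x \<in> S" "\<And>y. y \<in> S \<Longrightarrow> f y = g y"
  shows "f differentiable (at x) \<longleftrightarrow> g differentiable (at x)"
  using assms unfolding differentiable_def by (metis has_derivative_transform_within_open)

lemma dird_eqI: "(f has_derivative D) (at x) \<Longrightarrow> dird f x = D"
  by (metis frechet_derivative_at)

lemma has_derivative_dird: "f differentiable (at x) \<Longrightarrow> (f has_derivative dird f x) (at x)"
  using frechet_derivative_works by blast

lemma linear_dird: "f differentiable (at x) \<Longrightarrow> linear (dird f x)"
  using has_derivative_dird has_derivative_linear by blast

lemma Ck_on_cong:
  assumes "open S" "\<And>x. x \<in> S \<Longrightarrow> f x = g x"
  shows "Ck_on k S f \<longleftrightarrow> Ck_on k S g"
  using assms(2)
proof (induction k arbitrary: f g)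
  case 0
  then show ?case by (auto intro: continuous_on_eq)
next
  case (Suc k)
  have "dird f x = dird g x" if "x \<in> S" for x
    using dird_cong_open[OF assms(1) that] Suc.prems by blast
  then have "Ck_on k S (\<lambda>x. dird f x u) \<longleftrightarrow> Ck_on k S (\<lambda>x. dird g x u)" for u
    by (intro Suc.IH) auto
  moreover have "f differentiable (at x) \<longleftrightarrow> g differentiable (at x)" if "x \<in> S" for x
    using differentiable_cong_open[OF assms(1) that] Suc.prems by blast
  ultimately show ?case by auto
qed

lemma Ck_on_differentiable: "Ck_on (Suc k) S f \<Longrightarrow> x \<in> S \<Longrightarrow> f differentiable (at x)"
  by simp

lemma Ck_on_SucD: "Ck_on (Suc k) S f \<Longrightarrow> Ck_on k S f"
proof (induction k arbitrary: f)
  case 0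
  then show ?case
    by (auto intro!: continuous_at_imp_continuous_on differentiable_imp_continuous_within)
qed auto

lemma Ck_on_subset: "Ck_on k S f \<Longrightarrow> T \<subseteq> S \<Longrightarrow> Ck_on k T f"
  by (induction k arbitrary: f) (auto intro: continuous_on_subset)

lemma Ck_on_const [simp]: "Ck_on k S (\<lambda>_. c)"
  by (induction k arbitrary: c) (auto simp: frechet_derivative_const)

lemma Ck_on_add:
  assumes "open S" "Ck_on k S f" "Ck_on k S g"
  shows "Ck_on k S (\<lambda>x. f x + g x)"
  using assms(2,3)
proof (induction k arbitrary: f g)
  case 0
  then show ?case by (auto intro: continuous_on_add)
next
  case (Suc k)
  have "dird (\<lambda>x. f x + g x) x u = dird f x u + dird g x u" if "x \<in> S" for x u
    using Suc.prems that
    by (subst dird_eqI[OF has_derivative_add[OF has_derivative_dird has_derivative_dird]]) auto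
  then have "Ck_on k S (\<lambda>x. dird (\<lambda>x. f x + g x) x u)" for u
    using Suc by (subst Ck_on_cong[OF assms(1)]) auto
  then show ?case using Suc.prems by auto
qed

lemma Ck_on_scaleR:
  fixes f :: "'a::euclidean_space \<Rightarrow> real"
  assumes "open S" "Ck_on k S f" "Ck_on k S g"
  shows "Ck_on k S (\<lambda>x. f x *\<^sub>R g x)"
  using assms(2,3)
proof (induction k arbitrary: f g)
  case 0
  then show ?case by (auto intro: continuous_on_scaleR)
next
  case (Suc k)
  have "dird (\<lambda>x. f x *\<^sub>R g x) x u = f x *\<^sub>R dird g x u + dird f x u *\<^sub>R g x"
    if "x \<in> S" for x u
    using Suc.prems that
    by (subst dird_eqI[OF has_derivative_scaleR[OF has_derivative_dird has_derivative_dird]]) auto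
  moreover have "Ck_on k S (\<lambda>x. f x *\<^sub>R dird g x u + dird f x u *\<^sub>R g x)" for u
  proof (intro Ck_on_add assms(1))
    show "Ck_on k S (\<lambda>x. f x *\<^sub>R dird g x u)"
      using Suc.IH[OF Ck_on_SucD[OF Suc.prems(1)]] Suc.prems(2) by simp
    show "Ck_on k S (\<lambda>x. dird f x u *\<^sub>R g x)"
      using Suc.IH[OF _ Ck_on_SucD[OF Suc.prems(2)]] Suc.prems(1) by simp
  qed
  ultimately have "Ck_on k S (\<lambda>x. dird (\<lambda>x. f x *\<^sub>R g x) x u)" for u
    by (subst Ck_on_cong[OF assms(1)]) auto
  then show ?case using Suc.prems by auto
qed

lemma Ck_on_bounded_linear:
  assumes "bounded_linear L" "open S" "Ck_on k S f"
  shows "Ck_on k S (\<lambda>x. L (f x))"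
  using assms(3)
proof (induction k arbitrary: f)
  case 0
  then show ?case using assms(1) by (auto intro: bounded_linear.continuous_on)
next
  case (Suc k)
  have D: "((\<lambda>x. L (f x)) has_derivative (\<lambda>u. L (dird f x u))) (at x)" if "x \<in> S" for x
    using Suc.prems that by (auto intro!: bounded_linear.has_derivative[OF assms(1)] has_derivative_dird)
  have "Ck_on k S (\<lambda>x. L (dird f x u))" for u using Suc by auto
  then have "Ck_on k S (\<lambda>x. dird (\<lambda>x. L (f x)) x u)" for u
    by (subst Ck_on_cong[OF assms(2)]) (auto simp: dird_eqI[OF D])
  then show ?case using D by (auto intro: differentiableI)
qed

text \<open>The derivative of 1/f is a product of 1/f, df and 1/f. The induction closes because 1/f
  is needed there only to one order less.\<close>

lemma Ck_on_inverse:
  fixes f :: "'a::euclidean_space \<Rightarrow> real"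
  assumes "open S" "Ck_on k S f" "\<And>x. x \<in> S \<Longrightarrow> f x \<noteq> 0"
  shows "Ck_on k S (\<lambda>x. inverse (f x))"
  using assms(2,3)
proof (induction k arbitrary: f)
  case 0
  then show ?case by (auto intro: continuous_on_inverse)
next
  case (Suc k)
  have D: "((\<lambda>x. inverse (f x)) has_derivative
      (\<lambda>u. - (inverse (f x) * dird f x u * inverse (f x)))) (at x)" if "x \<in> S" for x
    using Suc.prems that by (intro Deriv.has_derivative_inverse has_derivative_dird) auto
  have I: "Ck_on k S (\<lambda>x. inverse (f x))" using Suc Ck_on_SucD by blast
  have "Ck_on k S (\<lambda>x. (-1) *\<^sub>R (inverse (f x) *\<^sub>R (dird f x u *\<^sub>R inverse (f x))))" for u
    using I Suc.prems by (intro Ck_on_scaleR assms(1)) auto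
  then have "Ck_on k S (\<lambda>x. dird (\<lambda>x. inverse (f x)) x u)" for u
    by (subst Ck_on_cong[OF assms(1)]) (auto simp: dird_eqI[OF D] mult_ac)
  then show ?case using D by (auto intro: differentiableI)
qed

lemma smooth_on_cong:
  "open S \<Longrightarrow> (\<And>x. x \<in> S \<Longrightarrow> f x = g x) \<Longrightarrow> smooth_on S f \<longleftrightarrow> smooth_on S g"
  unfolding smooth_on_def using Ck_on_cong by blast

lemma smooth_on_subset: "smooth_on S f \<Longrightarrow> T \<subseteq> S \<Longrightarrow> smooth_on T f"
  unfolding smooth_on_def using Ck_on_subset by blast

lemma smooth_on_differentiable: "smooth_on S f \<Longrightarrow> x \<in> S \<Longrightarrow> f differentiable (at x)"
  unfolding smooth_on_def using Ck_on_differentiable by blast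

lemma smooth_on_continuous_on: "smooth_on S f \<Longrightarrow> continuous_on S f"
  unfolding smooth_on_def by (metis Ck_on.simps(1))

lemma smooth_on_dird: "smooth_on S f \<Longrightarrow> smooth_on S (\<lambda>x. dird f x u)"
  unfolding smooth_on_def by (metis Ck_on.simps(2))

lemma smooth_on_const [simp]: "smooth_on S (\<lambda>_. c)"
  by (simp add: smooth_on_def)

lemma smooth_on_add:
  "open S \<Longrightarrow> smooth_on S f \<Longrightarrow> smooth_on S g \<Longrightarrow> smooth_on S (\<lambda>x. f x + g x)"
  by (simp add: smooth_on_def Ck_on_add)

lemma smooth_on_scaleR:
  "open S \<Longrightarrow> smooth_on S f \<Longrightarrow> smooth_on S g \<Longrightarrow> smooth_on S (\<lambda>x. f x *\<^sub>R g x)"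
  by (simp add: smooth_on_def Ck_on_scaleR)

lemma smooth_on_mult:
  fixes f g :: "'a::euclidean_space \<Rightarrow> real"
  shows "open S \<Longrightarrow> smooth_on S f \<Longrightarrow> smooth_on S g \<Longrightarrow> smooth_on S (\<lambda>x. f x * g x)"
  using smooth_on_scaleR[of S f g] by simp

lemma smooth_on_bounded_linear:
  "bounded_linear L \<Longrightarrow> open S \<Longrightarrow> smooth_on S f \<Longrightarrow> smooth_on S (\<lambda>x. L (f x))"
  by (simp add: smooth_on_def Ck_on_bounded_linear)

lemma smooth_on_minus:
  "open S \<Longrightarrow> smooth_on S f \<Longrightarrow> smooth_on S (\<lambda>x. - f x)"
  by (rule smooth_on_bounded_linear[OF bounded_linear_minus[OF bounded_linear_ident]])

lemma smooth_on_diff: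
  "open S \<Longrightarrow> smooth_on S f \<Longrightarrow> smooth_on S g \<Longrightarrow> smooth_on S (\<lambda>x. f x - g x)"
  using smooth_on_add[OF _ _ smooth_on_minus, of S f g] by simp

lemma smooth_on_divide:
  fixes f g :: "'a::euclidean_space \<Rightarrow> real"
  assumes "open S" "smooth_on S f" "smooth_on S g" "\<And>x. x \<in> S \<Longrightarrow> g x \<noteq> 0"
  shows "smooth_on S (\<lambda>x. f x / g x)"
  unfolding divide_inverse using assms
  by (intro smooth_on_mult) (auto simp: smooth_on_def Ck_on_inverse)

lemma smooth_on_sum:
  "open S \<Longrightarrow> (\<And>i. i \<in> I \<Longrightarrow> smooth_on S (f i)) \<Longrightarrow> smooth_on S (\<lambda>x. \<Sum>i\<in>I. f i x)"
  by (induction I rule: infinite_finite_induct) (auto intro!: smooth_on_add)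

lemma smooth_on_prod:
  fixes f :: "'i \<Rightarrow> 'a::euclidean_space \<Rightarrow> real"
  shows "open S \<Longrightarrow> (\<And>i. i \<in> I \<Longrightarrow> smooth_on S (f i)) \<Longrightarrow> smooth_on S (\<lambda>x. \<Prod>i\<in>I. f i x)"
  by (induction I rule: infinite_finite_induct) (auto intro!: smooth_on_mult)

lemma smooth_on_component: "open S \<Longrightarrow> smooth_on S f \<Longrightarrow> smooth_on S (\<lambda>x. f x $ i)"
  by (rule smooth_on_bounded_linear[OF bounded_linear_vec_nth])

lemma smooth_on_vecI:
  fixes f :: "'a::euclidean_space \<Rightarrow> real ^ 'n::finite"
  assumes "open S" "\<And>i. smooth_on S (\<lambda>x. f x $ i)"
  shows "smooth_on S f"
proof -
  have "smooth_on S (\<lambda>x. \<Sum>i\<in>UNIV. (f x $ i) *\<^sub>R (axis i 1 :: real ^ 'n))"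
    by (intro smooth_on_sum smooth_on_scaleR assms smooth_on_const)
  then show ?thesis by (simp add: basis_expansion flip: scalar_mult_eq_scaleR)
qed

lemma smooth_on_det:
  fixes A :: "'a::euclidean_space \<Rightarrow> real ^ 'n ^ 'n::finite"
  assumes "open S" "\<And>i j. smooth_on S (\<lambda>x. A x $ i $ j)"
  shows "smooth_on S (\<lambda>x. det (A x))"
  unfolding det_def by (intro smooth_on_sum smooth_on_mult smooth_on_prod assms smooth_on_const)


section \<open>Inner products given by bilinear forms\<close>

lemma linear_expand:
  fixes f :: "real ^ 'n::finite \<Rightarrow> 'b::real_vector"
  assumes "linear f"
  shows "f u = (\<Sum>i\<in>UNIV. u $ i *\<^sub>R f (axis i 1))"
proof -
  have "f u = f (\<Sum>i\<in>UNIV. u $ i *\<^sub>R axis i 1)"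
    by (simp add: basis_expansion flip: scalar_mult_eq_scaleR)
  then show ?thesis by (simp add: linear_sum[OF assms] linear_cmul[OF assms])
qed

lemma bilinear_expand:
  fixes B :: "real ^ 'n::finite \<Rightarrow> real ^ 'm::finite \<Rightarrow> 'b::real_vector"
  assumes "bilinear B"
  shows "B u v = (\<Sum>i\<in>UNIV. \<Sum>j\<in>UNIV. (u $ i * v $ j) *\<^sub>R B (axis i 1) (axis j 1))"
proof -
  have 1: "linear (\<lambda>u. B u v)" and 2: "linear (B w)" for w
    using assms by (auto simp: bilinear_def)
  show ?thesis
    by (subst linear_expand[OF 1], subst linear_expand[OF 2]) (simp add: scaleR_sum_right)
qed

definition inner_form :: "('a::real_vector \<Rightarrow> 'a \<Rightarrow> real) \<Rightarrow> bool"
  where "inner_form g \<longleftrightarrow> bilinear g \<and> (\<forall>v w. g v w = g w v) \<and> (\<forall>v. v \<noteq> 0 \<longrightarrow> g v v > 0)"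

text \<open>The musical isomorphism of \<open>g\<close>. Written as a definite description so that
  \<open>lorentz\<close> and, up to a factor 2, \<open>christoffel\<close> are literally instances
  of it.\<close>

definition sharp :: "('a::real_vector \<Rightarrow> 'a \<Rightarrow> real) \<Rightarrow> ('a \<Rightarrow> real) \<Rightarrow> 'a"
  where "sharp g l = (THE u. \<forall>w. g u w = l w)"

lemma inner_form_eq_zero:
  assumes "inner_form g" "g u u = 0"
  shows "u = 0"
  using assms unfolding inner_form_def by (metis less_irrefl)

lemma inner_form_ext:
  assumes "inner_form g" "\<And>w. g u w = g v w"
  shows "u = v"
proof -
  have "bilinear g" using assms(1) by (simp add: inner_form_def)
  then have "g (u - v) (u - v) = 0" by (simp add: bilinear_lsub assms(2))
  then show ?thesis using inner_form_eq_zero[OF assms(1)] by fastforce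
qed

lemma sharp_eqI: "inner_form g \<Longrightarrow> (\<And>w. g u w = l w) \<Longrightarrow> sharp g l = u"
  unfolding sharp_def by (intro the_equality) (auto intro: inner_form_ext)

lemma gram_matrix_vector:
  fixes g :: "real ^ 'n::finite \<Rightarrow> real ^ 'n \<Rightarrow> real"
  assumes "bilinear g"
  shows "(\<chi> i j. g (axis j 1) (axis i 1)) *v u = (\<chi> i. g u (axis i 1))"
proof -
  have 1: "linear (\<lambda>u. g u v)" for v using assms by (auto simp: bilinear_def)
  show ?thesis
    unfolding vec_eq_iff matrix_vector_mult_def
    by (subst (2) linear_expand[OF 1]) (simp add: mult.commute)
qed

text \<open>A vector in the kernel is g-orthogonal to every basis vector, hence to itself.\<close>

lemma gram_matrix_det:
  fixes g :: "real ^ 'n::finite \<Rightarrow> real ^ 'n \<Rightarrow> real"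
  assumes "inner_form g"
  shows "det (\<chi> i j. g (axis j 1) (axis i 1)) \<noteq> 0"
proof -
  have b: "bilinear g" using assms by (simp add: inner_form_def)
  have "u = 0" if "(\<chi> i j. g (axis j 1) (axis i 1)) *v u = 0" for u
  proof (rule inner_form_ext[OF assms])
    fix w
    have "g u (axis i 1) = 0" for i
      using that by (simp add: gram_matrix_vector[OF b] vec_eq_iff)
    then have "g u w = 0"
      using b by (subst linear_expand[of "g u"]) (auto simp: bilinear_def)
    then show "g u w = g 0 w" using b by (simp add: bilinear_lzero)
  qed
  then show ?thesis
    by (simp add: invertible_left_inverse matrix_left_invertible_ker flip: invertible_det_nz)
qed

text \<open>Cramer's rule serves twice: it produces the representing vector, and it displays the
  components as quotients of determinants, which is how smooth dependence on the point is obtained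
  later.\<close>

lemma sharp_component_cramer:
  fixes g :: "real ^ 'n::finite \<Rightarrow> real ^ 'n \<Rightarrow> real"
  assumes "inner_form g" "linear l"
  shows "sharp g l $ k =
    det (\<chi> i j. if j = k then l (axis i 1) else g (axis j 1) (axis i 1)) /
    det (\<chi> i j. g (axis j 1) (axis i 1))" (is ?A)
    and "g (sharp g l) w = l w" (is ?B)
proof -
  have b: "bilinear g" using assms by (simp add: inner_form_def)
  define A where "A = (\<chi> i j. g (axis j 1) (axis i 1))"
  define u where "u = (\<chi> k. det (\<chi> i j. if j = k then (\<chi> i. l (axis i 1)) $ i else A $ i $ j) / det A)"
  have "A *v u = (\<chi> i. l (axis i 1))"
    using cramer[of A u] gram_matrix_det[OF assms(1)] unfolding A_def u_def by blast
  then have "g u (axis i 1) = l (axis i 1)" for i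
    by (simp add: gram_matrix_vector[OF b] vec_eq_iff A_def)
  then have ul: "g u (axis i 1) = l (axis i 1)" for i by blast
  have "linear (g u)" using b by (simp add: bilinear_def)
  then have "g u w = (\<Sum>i\<in>UNIV. w $ i *\<^sub>R g u (axis i 1))" for w by (rule linear_expand)
  then have "g u w = l w" for w
    by (simp only: ul linear_expand[OF assms(2), of w])
  then have "sharp g l = u" by (rule sharp_eqI[OF assms(1)])
  then show ?A ?B using \<open>\<And>w. g u w = l w\<close> by (auto simp: u_def A_def if_distrib cong: if_cong)
qed

lemmas sharp_works = sharp_component_cramer(2)

lemma linear_component: "linear (\<lambda>w::real ^ 'n::finite. w $ i)"
  by (simp add: linear_iff)

text \<open>The vectors \<open>sharp g (\<lambda>w. w $ i)\<close> are the columns of the inverse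
  Gram matrix, so smoothness of \<open>sharp\<close> needs to be checked for these only.\<close>

lemma sharp_expand:
  fixes g :: "real ^ 'n::finite \<Rightarrow> real ^ 'n \<Rightarrow> real"
  assumes "inner_form g" "linear l"
  shows "sharp g l = (\<Sum>i\<in>UNIV. l (axis i 1) *\<^sub>R sharp g (\<lambda>w. w $ i))"
proof (rule sharp_eqI[OF assms(1)])
  fix w
  have 1: "linear (\<lambda>u. g u w)" using assms(1) by (auto simp: bilinear_def inner_form_def)
  have "l w = (\<Sum>i\<in>UNIV. w $ i * l (axis i 1))" using linear_expand[OF assms(2), of w] by simp
  then show "g (\<Sum>i\<in>UNIV. l (axis i 1) *\<^sub>R sharp g (\<lambda>w. w $ i)) w = l w"
    by (simp add: linear_sum[OF 1] linear_cmul[OF 1] sharp_works[OF assms(1) linear_component] mult.commute)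
qed

section \<open>Orthonormal frames and traces\<close>

lemma orthonormal_frame_exists:
  fixes g :: "real ^ 'n::finite \<Rightarrow> real ^ 'n \<Rightarrow> real"
  assumes "inner_form g"
  shows "\<exists>E::'n \<Rightarrow> real ^ 'n. \<forall>i j. g (E i) (E j) = (if i = j then 1 else 0)"
proof -
  have b: "bilinear g" and sym: "g v w = g w v" and pos: "v \<noteq> 0 \<Longrightarrow> g v v > 0" for v w
    using assms by (auto simp: inner_form_def)
  have "\<exists>E::'n \<Rightarrow> real ^ 'n. \<forall>i\<in>I. \<forall>j\<in>I. g (E i) (E j) = (if i = j then 1 else 0)" for I :: "'n set"
    using finite[of I]
  proof (induction I rule: finite_induct)
    case (insert k I)
    then obtain E :: "'n \<Rightarrow> real ^ 'n"
      where E: "\<And>i j. i \<in> I \<Longrightarrow> j \<in> I \<Longrightarrow> g (E i) (E j) = (if i = j then 1 else 0)" by blast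
    \<comment> \<open>Dimension count for the Gram-Schmidt step: since \<open>k\<close> is not in
      \<open>I\<close>, fewer than \<open>CARD('n)\<close> vectors are present, and some
      \<open>v\<close> lies outside their span.\<close>
    have "card (E ` I) \<le> card I" by (simp add: card_image_le)
    also have "\<dots> < CARD('n)" using insert.hyps by (intro psubset_card_mono) auto
    finally have "card (E ` I) < CARD('n)" .
    moreover have "dim (E ` I) \<le> card (E ` I)"
      by (intro dim_le_card span_superset finite_imageI insert.hyps)
    ultimately have "dim (E ` I) < DIM(real ^ 'n)" by simp
    then have "span (E ` I) \<noteq> UNIV"
      unfolding dim_eq_full[symmetric] by (rule less_imp_neq)
    then obtain v where v: "v \<notin> span (E ` I)" by blast
    define w where "w = v - (\<Sum>i\<in>I. g v (E i) *\<^sub>R E i)"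
    have "w \<noteq> 0"
    proof
      assume "w = 0"
      then have "v = (\<Sum>i\<in>I. g v (E i) *\<^sub>R E i)" by (simp add: w_def)
      also have "\<dots> \<in> span (E ` I)" by (intro span_sum span_scale span_base) auto
      finally show False using v by blast
    qed
    define c where "c = sqrt (g w w)"
    have c: "c > 0" "c * c = g w w" using pos[OF \<open>w \<noteq> 0\<close>] by (auto simp: c_def)
    have orth: "g w (E j) = 0" if "j \<in> I" for j :: 'n
    proof -
      have 1: "linear (\<lambda>u. g u (E j))" using b by (auto simp: bilinear_def)
      have "g w (E j) = g v (E j) - (\<Sum>i\<in>I. g v (E i) * g (E i) (E j))"
        by (simp add: w_def linear_diff[OF 1] linear_sum[OF 1] linear_cmul[OF 1])
      also have "(\<Sum>i\<in>I. g v (E i) * g (E i) (E j)) = (\<Sum>i\<in>I. if i = j then g v (E i) else 0)"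
        using that E by (intro sum.cong) auto
      finally show ?thesis using that insert.hyps by simp
    qed
    then have orth': "g (E j) w = 0" if "j \<in> I" for j
      using that by (metis sym)
    let ?E = "E(k := (1 / c) *\<^sub>R w)"
    have "g (?E i) (?E j) = (if i = j then 1 else 0)" if "i \<in> insert k I" "j \<in> insert k I" for i j
      using that c orth orth' E insert.hyps
      by (auto simp: bilinear_lmul[OF b] bilinear_rmul[OF b] field_simps)
    then show ?case by blast
  qed auto
  from this[of UNIV] show ?thesis by simp
qed

text \<open>\<open>Q\<close> has the frame vectors as columns, and \<open>P\<close> takes the
  g-coefficients with respect to the frame. Orthonormality is \<open>P ** Q = mat 1\<close>. In
  finite dimension also \<open>Q ** P = mat 1\<close>, which gives the expansion and, by cyclicity
  of the trace, the trace formula.\<close>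

lemma orthonormal_frame:
  fixes g :: "real ^ 'n::finite \<Rightarrow> real ^ 'n \<Rightarrow> real"
    and E :: "'n \<Rightarrow> real ^ 'n"
  assumes "inner_form g" and E: "\<And>i j. g (E i) (E j) = (if i = j then 1 else 0)"
  shows "v = (\<Sum>i\<in>UNIV. g v (E i) *\<^sub>R E i)" (is ?A)
    and "linear L \<Longrightarrow> endo_trace L = (\<Sum>i\<in>UNIV. g (L (E i)) (E i))" (is "_ \<Longrightarrow> ?B")
proof -
  have lin: "linear (\<lambda>u. g u w)" for w using assms(1) by (auto simp: bilinear_def inner_form_def)
  define Q :: "real ^ 'n ^ 'n" where "Q = (\<chi> a i. E i $ a)"
  define P :: "real ^ 'n ^ 'n" where "P = (\<chi> i a. g (axis a 1) (E i))"
  have PQ: "P ** Q = mat 1"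
  proof -
    have "(P ** Q) $ i $ j = g (E j) (E i)" for i j
      by (subst linear_expand[OF lin, of "E j"]) (simp add: matrix_matrix_mult_def P_def Q_def mult.commute)
    then show ?thesis by (auto simp: vec_eq_iff mat_def E)
  qed
  then have QP: "Q ** P = mat 1" by (simp add: matrix_left_right_inverse)
  have Pv: "P *v u = (\<chi> i. g u (E i))" for u
    unfolding vec_eq_iff
    by (subst linear_expand[OF lin]) (simp add: matrix_vector_mult_def P_def mult.commute)
  have "v = Q *v (P *v v)" by (simp add: matrix_vector_mul_assoc QP)
  also have "\<dots> = (\<Sum>i\<in>UNIV. g v (E i) *\<^sub>R E i)"
    by (simp add: Pv vec_eq_iff) (simp add: matrix_vector_mult_def Q_def mult.commute)
  finally show ?A .
  assume L: "linear L"
  have "endo_trace L = trace (matrix L ** (Q ** P))" by (simp add: QP)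
  also have "\<dots> = trace (P ** (matrix L ** Q))"
    by (metis matrix_mul_assoc trace_mul_sym)
  also have "\<dots> = (\<Sum>i\<in>UNIV. g (L (E i)) (E i))"
    unfolding trace_def
  proof (rule sum.cong)
    fix i
    have "(matrix L ** Q) $ a $ i = L (E i) $ a" for a
      by (simp add: matrix_matrix_mult_def matrix_def Q_def)
        (subst linear_expand[OF L, of "E i"], simp add: mult.commute)
    then have "(P ** (matrix L ** Q)) $ i $ i = (P *v L (E i)) $ i"
      by (simp add: matrix_matrix_mult_def matrix_vector_mult_def)
    then show "(P ** (matrix L ** Q)) $ i $ i = g (L (E i)) (E i)" by (simp add: Pv)
  qed simp
  finally show ?B .
qed

text \<open>In an orthonormal frame tr Y^2 is minus the sum of the squared lengths of the
  \<open>Y (E i)\<close>, and these cannot all vanish.\<close>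

lemma trace_skew_square_neg:
  fixes g :: "real ^ 'n::finite \<Rightarrow> real ^ 'n \<Rightarrow> real"
  assumes g: "inner_form g" and Y: "linear Y" and skew: "\<And>v w. g (Y v) w = - g v (Y w)"
    and "Y v \<noteq> 0"
  shows "endo_trace (\<lambda>w. Y (Y w)) < 0"
proof -
  obtain E :: "'n \<Rightarrow> real ^ 'n" where E: "\<And>i j. g (E i) (E j) = (if i = j then 1 else 0)"
    using orthonormal_frame_exists[OF g] by blast
  have pos: "g w w \<ge> 0" "w \<noteq> 0 \<Longrightarrow> g w w > 0" for w
    using g by (cases "w = 0"; force simp: inner_form_def bilinear_lzero)+
  have "\<exists>i. Y (E i) \<noteq> 0"
  proof (rule ccontr)
    assume "\<not> ?thesis"
    then have "Y v = 0"
      by (subst orthonormal_frame(1)[OF g E, where v = v]) (simp add: linear_sum[OF Y] linear_cmul[OF Y])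
    then show False using assms(4) by blast
  qed
  then have "(\<Sum>i\<in>UNIV. g (Y (E i)) (Y (E i))) > 0"
    using pos by (meson UNIV_I finite sum_pos2)
  moreover have "endo_trace (\<lambda>w. Y (Y w)) = (\<Sum>i\<in>UNIV. g (Y (Y (E i))) (E i))"
    using Y by (intro orthonormal_frame(2)[OF g E]) (simp add: linear_compose[unfolded o_def])
  moreover have "g (Y (Y (E i))) (E i) = - g (Y (E i)) (Y (E i))" for i by (rule skew)
  ultimately show ?thesis by (simp add: sum_negf)
qed

text \<open>A left inverse of \<open>A\<close> is two-sided in finite dimension, so
  \<open>L'\<close> is the conjugate of \<open>L\<close> by \<open>A\<close>. Used to compare traces
  computed in two charts.\<close>

lemma endo_trace_conj:
  fixes L L' A :: "real ^ 'n::finite \<Rightarrow> real ^ 'n"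
  assumes "linear A" "linear B" "\<And>w. B (A w) = w" "linear L" and eq: "\<And>w. A (L' w) = L (A w)"
  shows "endo_trace L' = endo_trace L"
proof -
  have L': "L' = B \<circ> (L \<circ> A)" using eq assms(3) by (auto simp: fun_eq_iff o_def) metis
  have "matrix B ** matrix A = matrix (B \<circ> A)" using assms by (simp add: matrix_compose)
  also have "B \<circ> A = id" using assms(3) by auto
  finally have "matrix B ** matrix A = mat 1" by (simp only: matrix_id_mat_1)
  then have "matrix A ** matrix B = mat 1" by (simp add: matrix_left_right_inverse)
  moreover have "matrix L' = matrix B ** (matrix L ** matrix A)"
    using assms by (simp add: L' matrix_compose linear_compose)
  ultimately show ?thesis
    by (metis matrix_mul_assoc matrix_mul_rid trace_mul_sym)
qed


section \<open>Families of linear and bilinear maps\<close>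

text \<open>Tensors are curried functions, differentiable in the point for each fixed argument.
  Expanding the moving argument in the standard basis reduces the product and chain rule to finitely
  many scalar products.\<close>

lemma has_derivative_linear_family:
  fixes T :: "'a::real_normed_vector \<Rightarrow> real ^ 'n::finite \<Rightarrow> 'b::real_normed_vector"
  assumes "open S" "\<tau> x \<in> S"
    and lin: "\<And>y. y \<in> S \<Longrightarrow> linear (T y)"
    and diff: "\<And>\<eta>. (\<lambda>y. T y \<eta>) differentiable (at (\<tau> x))"
    and \<tau>: "(\<tau> has_derivative \<tau>') (at x)" and V: "(V has_derivative V') (at x)"
  shows "((\<lambda>z. T (\<tau> z) (V z)) has_derivative
    (\<lambda>h. dird (\<lambda>y. T y (V x)) (\<tau> x) (\<tau>' h) + T (\<tau> x) (V' h))) (at x)"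
proof -
  let ?e = "\<lambda>i. axis i (1::real)"
  have D: "((\<lambda>z. T (\<tau> z) \<eta>) has_derivative (\<lambda>h. dird (\<lambda>y. T y \<eta>) (\<tau> x) (\<tau>' h))) (at x)" for \<eta>
    using diff_chain_at[OF \<tau> has_derivative_dird[OF diff[of \<eta>]]] by (simp add: o_def)
  have Vi: "((\<lambda>z. V z $ i) has_derivative (\<lambda>h. V' h $ i)) (at x)" for i
    by (rule bounded_linear.has_derivative[OF bounded_linear_vec_nth V])
  \<comment> \<open>Computes \<open>dird\<close> for a fixed argument as a sum over the basis, so
    that the sum obtained below can be folded back into
    \<open>dird (\<lambda>y. T y (V x))\<close>.\<close>
  have lin_sum: "((\<lambda>y. \<Sum>i\<in>UNIV. c $ i *\<^sub>R T y (?e i)) has_derivative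
      (\<lambda>h. \<Sum>i\<in>UNIV. c $ i *\<^sub>R dird (\<lambda>y. T y (?e i)) (\<tau> x) h)) (at (\<tau> x))" for c :: "real ^ 'n"
    by (intro has_derivative_sum has_derivative_scaleR_right has_derivative_dird diff)
  have "((\<lambda>y. T y c) has_derivative
      (\<lambda>h. \<Sum>i\<in>UNIV. c $ i *\<^sub>R dird (\<lambda>y. T y (?e i)) (\<tau> x) h)) (at (\<tau> x))" for c
    by (rule has_derivative_transform_within_open[OF lin_sum assms(1,2)])
      (rule linear_expand[symmetric, OF lin])
  then have dT: "dird (\<lambda>y. T y c) (\<tau> x) = (\<lambda>h. \<Sum>i\<in>UNIV. c $ i *\<^sub>R dird (\<lambda>y. T y (?e i)) (\<tau> x) h)" for c
    by (rule dird_eqI)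
  have "((\<lambda>z. \<Sum>i\<in>UNIV. V z $ i *\<^sub>R T (\<tau> z) (?e i)) has_derivative
      (\<lambda>h. \<Sum>i\<in>UNIV. V x $ i *\<^sub>R dird (\<lambda>y. T y (?e i)) (\<tau> x) (\<tau>' h) + V' h $ i *\<^sub>R T (\<tau> x) (?e i))) (at x)"
    by (intro has_derivative_sum has_derivative_scaleR D Vi)
  moreover have "(\<Sum>i\<in>UNIV. V x $ i *\<^sub>R dird (\<lambda>y. T y (?e i)) (\<tau> x) (\<tau>' h) + V' h $ i *\<^sub>R T (\<tau> x) (?e i))
     = dird (\<lambda>y. T y (V x)) (\<tau> x) (\<tau>' h) + T (\<tau> x) (V' h)" for h
    using linear_expand[OF lin[OF assms(2)], of "V' h"] by (simp add: dT[of "V x"] sum.distrib)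
  ultimately have main: "((\<lambda>z. \<Sum>i\<in>UNIV. V z $ i *\<^sub>R T (\<tau> z) (?e i)) has_derivative
     (\<lambda>h. dird (\<lambda>y. T y (V x)) (\<tau> x) (\<tau>' h) + T (\<tau> x) (V' h))) (at x)" by simp
  have "(\<tau> \<longlongrightarrow> \<tau> x) (at x)"
    using \<tau> has_derivative_continuous continuous_at by blast
  then have "\<forall>\<^sub>F z in at x. \<tau> z \<in> S" using assms(1,2) by (rule topological_tendstoD)
  then have "\<forall>\<^sub>F z in at x. (\<Sum>i\<in>UNIV. V z $ i *\<^sub>R T (\<tau> z) (?e i)) = T (\<tau> z) (V z)"
    by eventually_elim (rule linear_expand[symmetric, OF lin])
  then show ?thesis
    by (rule has_derivative_transform_eventually[OF main])
      (auto intro: linear_expand[symmetric, OF lin] assms)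
qed

text \<open>Only the first slot is expanded; each term is then the linear case applied to
  \<open>W\<close>.\<close>

lemma has_derivative_bilinear_family:
  fixes T :: "'a::real_normed_vector \<Rightarrow> real ^ 'n::finite \<Rightarrow> real ^ 'm::finite \<Rightarrow> 'b::real_normed_vector"
  assumes "open S" "\<tau> x \<in> S"
    and bil: "\<And>y. y \<in> S \<Longrightarrow> bilinear (T y)"
    and diff: "\<And>\<xi> \<eta>. (\<lambda>y. T y \<xi> \<eta>) differentiable (at (\<tau> x))"
    and \<tau>: "(\<tau> has_derivative \<tau>') (at x)" and V: "(V has_derivative V') (at x)"
    and W: "(W has_derivative W') (at x)"
  shows "((\<lambda>z. T (\<tau> z) (V z) (W z)) has_derivative
    (\<lambda>h. dird (\<lambda>y. T y (V x) (W x)) (\<tau> x) (\<tau>' h) + T (\<tau> x) (V' h) (W x) + T (\<tau> x) (V x) (W' h))) (at x)"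
proof -
  let ?e = "\<lambda>i. axis i (1::real)"
  have lin1: "linear (\<lambda>\<xi>. T y \<xi> \<eta>)" and lin2: "linear (T y \<xi>)" if "y \<in> S" for y \<xi> \<eta>
    using bil[OF that] by (auto simp: bilinear_def)
  have D: "((\<lambda>z. T (\<tau> z) \<xi> (W z)) has_derivative
      (\<lambda>h. dird (\<lambda>y. T y \<xi> (W x)) (\<tau> x) (\<tau>' h) + T (\<tau> x) \<xi> (W' h))) (at x)" for \<xi>
    by (rule has_derivative_linear_family[OF assms(1,2) lin2 diff \<tau> W])
  have Vi: "((\<lambda>z. V z $ i) has_derivative (\<lambda>h. V' h $ i)) (at x)" for i
    by (rule bounded_linear.has_derivative[OF bounded_linear_vec_nth V])
  have "((\<lambda>y. \<Sum>i\<in>UNIV. \<xi> $ i *\<^sub>R T y (?e i) \<eta>) has_derivative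
      (\<lambda>h. \<Sum>i\<in>UNIV. \<xi> $ i *\<^sub>R dird (\<lambda>y. T y (?e i) \<eta>) (\<tau> x) h)) (at (\<tau> x))" for \<xi> \<eta>
    by (intro has_derivative_sum has_derivative_scaleR_right has_derivative_dird diff)
  then have "((\<lambda>y. T y \<xi> \<eta>) has_derivative
      (\<lambda>h. \<Sum>i\<in>UNIV. \<xi> $ i *\<^sub>R dird (\<lambda>y. T y (?e i) \<eta>) (\<tau> x) h)) (at (\<tau> x))" for \<xi> \<eta>
    by (rule has_derivative_transform_within_open[OF _ assms(1,2)])
      (rule linear_expand[symmetric, OF lin1])
  then have dT: "dird (\<lambda>y. T y \<xi> \<eta>) (\<tau> x) = (\<lambda>h. \<Sum>i\<in>UNIV. \<xi> $ i *\<^sub>R dird (\<lambda>y. T y (?e i) \<eta>) (\<tau> x) h)" for \<xi> \<eta>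
    by (rule dird_eqI)
  have "((\<lambda>z. \<Sum>i\<in>UNIV. V z $ i *\<^sub>R T (\<tau> z) (?e i) (W z)) has_derivative
      (\<lambda>h. \<Sum>i\<in>UNIV. V x $ i *\<^sub>R (dird (\<lambda>y. T y (?e i) (W x)) (\<tau> x) (\<tau>' h) + T (\<tau> x) (?e i) (W' h))
          + V' h $ i *\<^sub>R T (\<tau> x) (?e i) (W x))) (at x)"
    by (intro has_derivative_sum has_derivative_scaleR D Vi)
  moreover have "(\<Sum>i\<in>UNIV. V x $ i *\<^sub>R (dird (\<lambda>y. T y (?e i) (W x)) (\<tau> x) (\<tau>' h) + T (\<tau> x) (?e i) (W' h))
          + V' h $ i *\<^sub>R T (\<tau> x) (?e i) (W x))
     = dird (\<lambda>y. T y (V x) (W x)) (\<tau> x) (\<tau>' h) + T (\<tau> x) (V' h) (W x) + T (\<tau> x) (V x) (W' h)" for h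
    using linear_expand[OF lin1[OF assms(2)], of "V' h" "W x"] linear_expand[OF lin1[OF assms(2)], of "V x" "W' h"]
    by (simp add: dT[of "V x"] sum.distrib scaleR_add_right)
  ultimately have main: "((\<lambda>z. \<Sum>i\<in>UNIV. V z $ i *\<^sub>R T (\<tau> z) (?e i) (W z)) has_derivative
     (\<lambda>h. dird (\<lambda>y. T y (V x) (W x)) (\<tau> x) (\<tau>' h) + T (\<tau> x) (V' h) (W x) + T (\<tau> x) (V x) (W' h))) (at x)" by simp
  have "(\<tau> \<longlongrightarrow> \<tau> x) (at x)"
    using \<tau> has_derivative_continuous continuous_at by blast
  then have "\<forall>\<^sub>F z in at x. \<tau> z \<in> S" using assms(1,2) by (rule topological_tendstoD)
  then have "\<forall>\<^sub>F z in at x. (\<Sum>i\<in>UNIV. V z $ i *\<^sub>R T (\<tau> z) (?e i) (W z)) = T (\<tau> z) (V z) (W z)"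
    by eventually_elim (rule linear_expand[symmetric, OF lin1])
  then show ?thesis
    by (rule has_derivative_transform_eventually[OF main])
      (auto intro: linear_expand[symmetric, OF lin1] assms)
qed

text \<open>Linear in the direction by differentiability, and in the parameter because sums and
  multiples can be differentiated termwise on a neighbourhood of \<open>x\<close>.\<close>

lemma bilinear_dird_linear_family:
  fixes T :: "'a::real_normed_vector \<Rightarrow> 'c::real_vector \<Rightarrow> 'b::real_normed_vector"
  assumes "open S" "x \<in> S"
    and lin: "\<And>y. y \<in> S \<Longrightarrow> linear (T y)"
    and diff: "\<And>\<eta>. (\<lambda>y. T y \<eta>) differentiable (at x)"
  shows "bilinear (\<lambda>\<xi> \<eta>. dird (\<lambda>y. T y \<eta>) x \<xi>)"
proof -
  have D: "((\<lambda>y. T y \<eta>) has_derivative dird (\<lambda>y. T y \<eta>) x) (at x)" for \<eta>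
    by (rule has_derivative_dird[OF diff])
  have "dird (\<lambda>y. T y (\<eta> + \<zeta>)) x = (\<lambda>h. dird (\<lambda>y. T y \<eta>) x h + dird (\<lambda>y. T y \<zeta>) x h)" for \<eta> \<zeta>
    by (rule dird_eqI, rule has_derivative_transform_within_open[OF has_derivative_add[OF D D] assms(1,2)])
      (simp add: linear_add[OF lin])
  moreover have "dird (\<lambda>y. T y (c *\<^sub>R \<eta>)) x = (\<lambda>h. c *\<^sub>R dird (\<lambda>y. T y \<eta>) x h)" for c \<eta>
    by (rule dird_eqI, rule has_derivative_transform_within_open[OF has_derivative_scaleR_right[OF D] assms(1,2)])
      (simp add: linear_cmul[OF lin])
  ultimately show ?thesis
    unfolding bilinear_def by (auto intro!: linearI linear_dird diff)
qed

lemma continuous_on_linear_family: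
  fixes T :: "'a::topological_space \<Rightarrow> real ^ 'n::finite \<Rightarrow> 'b::real_normed_vector"
  assumes "\<And>y. y \<in> S \<Longrightarrow> linear (T y)" "\<And>\<eta>. continuous_on S (\<lambda>y. T y \<eta>)"
    and "continuous_on X \<tau>" "\<tau> ` X \<subseteq> S" "continuous_on X V"
  shows "continuous_on X (\<lambda>z. T (\<tau> z) (V z))"
proof -
  have "continuous_on X (\<lambda>z. \<Sum>i\<in>UNIV. V z $ i *\<^sub>R T (\<tau> z) (axis i 1))"
    by (intro continuous_intros assms continuous_on_compose2[OF assms(2,3,4)])
  then show ?thesis
    by (rule continuous_on_eq) (use assms(1,4) in \<open>auto intro!: linear_expand[symmetric]\<close>)
qed

lemma continuous_on_bilinear_family:
  fixes T :: "'a::topological_space \<Rightarrow> real ^ 'n::finite \<Rightarrow> real ^ 'm::finite \<Rightarrow> 'b::real_normed_vector"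
  assumes "\<And>y. y \<in> S \<Longrightarrow> bilinear (T y)" "\<And>\<xi> \<eta>. continuous_on S (\<lambda>y. T y \<xi> \<eta>)"
    and "continuous_on X \<tau>" "\<tau> ` X \<subseteq> S" "continuous_on X V" "continuous_on X W"
  shows "continuous_on X (\<lambda>z. T (\<tau> z) (V z) (W z))"
proof -
  have "continuous_on X (\<lambda>z. \<Sum>i\<in>UNIV. \<Sum>j\<in>UNIV. (V z $ i * W z $ j) *\<^sub>R T (\<tau> z) (axis i 1) (axis j 1))"
    by (intro continuous_intros assms continuous_on_compose2[OF assms(2,3,4)])
  then show ?thesis
    by (rule continuous_on_eq) (use assms(1,4) in \<open>auto intro!: bilinear_expand[symmetric]\<close>)
qed

text \<open>
  The second difference is symmetric in $u$ and $v$, so this limit (obtained from the mean value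
  theorem in direction $u$) makes the iterated derivatives symmetric as well.
\<close>

lemma second_difference_tendsto:
  fixes f :: "'a::real_normed_vector \<Rightarrow> real"
  assumes "open S" "x \<in> S" and d1: "\<And>y. y \<in> S \<Longrightarrow> f differentiable (at y)"
    and d2: "(\<lambda>y. dird f y u) differentiable (at x)"
  shows "((\<lambda>t. (f (x + t *\<^sub>R u + t *\<^sub>R v) - f (x + t *\<^sub>R u) - f (x + t *\<^sub>R v) + f x) / t\<^sup>2)
    \<longlongrightarrow> dird (\<lambda>y. dird f y u) x v) (at_right 0)"
proof (rule tendstoI)
  let ?D = "dird (\<lambda>y. dird f y u) x"
  fix e :: real assume e: "e > 0"
  obtain r where r: "r > 0" "ball x r \<subseteq> S" using assms(1,2) openE by blast
  define N where "N = norm u + norm v + 1"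
  have N: "N > 0" unfolding N_def by (smt (verit) norm_ge_zero)
  \<comment> \<open>Two errors of size \<open>e' * (t * N)\<close> occur below; after division by
    \<open>t\<close> they add up to \<open>e / 2\<close>.\<close>
  define e' where "e' = e / (4 * N)"
  have e': "e' > 0" using e N by (simp add: e'_def)
  obtain d where d: "d > 0"
    "\<And>y. norm (y - x) < d \<Longrightarrow> norm (dird f y u - dird f x u - ?D (y - x)) \<le> e' * norm (y - x)"
    using has_derivative_dird[OF d2] e' unfolding has_derivative_at_alt by blast
  have linD: "linear ?D" by (rule linear_dird[OF d2])
  define T where "T = min r d / N"
  have T: "T > 0" using r d N by (simp add: T_def)
  have "dist ((f (x + t *\<^sub>R u + t *\<^sub>R v) - f (x + t *\<^sub>R u) - f (x + t *\<^sub>R v) + f x) / t\<^sup>2) (?D v) < e"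
    if t: "0 < t" "t < T" for t
  proof -
    have small: "norm (s *\<^sub>R u + c *\<^sub>R v) \<le> t * N" "norm (s *\<^sub>R u + c *\<^sub>R v) < r" "norm (s *\<^sub>R u + c *\<^sub>R v) < d"
      if "0 \<le> s" "s \<le> t" "0 \<le> c" "c \<le> t" for s c
    proof -
      have "norm (s *\<^sub>R u + c *\<^sub>R v) \<le> s * norm u + c * norm v"
        using that by (intro norm_triangle_le) simp
      also have "\<dots> \<le> t * norm u + t * norm v"
        using that by (intro add_mono mult_right_mono) auto
      also have "\<dots> \<le> t * N" using t by (simp add: N_def algebra_simps)
      finally show A: "norm (s *\<^sub>R u + c *\<^sub>R v) \<le> t * N" .
      have "t * N < min r d" using t N by (simp add: T_def field_simps)
      with A show "norm (s *\<^sub>R u + c *\<^sub>R v) < r" "norm (s *\<^sub>R u + c *\<^sub>R v) < d" by auto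
    qed
    \<comment> \<open>The increment in direction \<open>v\<close> as a function of the displacement
      along \<open>u\<close>; the second difference is \<open>g t - g 0\<close>, so one application
      of the mean value theorem suffices.\<close>
    define g where "g s = f (x + s *\<^sub>R u + t *\<^sub>R v) - f (x + s *\<^sub>R u)" for s
    have inS: "x + s *\<^sub>R u + c *\<^sub>R v \<in> S" if "0 \<le> s" "s \<le> t" "0 \<le> c" "c \<le> t" for s c
      using small(2)[OF that] r(2) by (auto simp: dist_norm add.assoc norm_minus_commute subset_iff)
    have D: "((\<lambda>s. f (x + s *\<^sub>R u + c *\<^sub>R v)) has_real_derivative dird f (x + s *\<^sub>R u + c *\<^sub>R v) u) (at s)"
      if "0 \<le> s" "s \<le> t" "0 \<le> c" "c \<le> t" for s c
    proof -
      have 1: "((\<lambda>s. x + s *\<^sub>R u + c *\<^sub>R v) has_derivative (\<lambda>h. h *\<^sub>R u)) (at s)"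
        by (auto intro!: derivative_eq_intros)
      have f: "f differentiable (at (x + s *\<^sub>R u + c *\<^sub>R v))" by (rule d1[OF inS[OF that]])
      have "((\<lambda>s. f (x + s *\<^sub>R u + c *\<^sub>R v)) has_derivative (\<lambda>h. dird f (x + s *\<^sub>R u + c *\<^sub>R v) (h *\<^sub>R u))) (at s)"
        using diff_chain_at[OF 1 has_derivative_dird[OF f]] by (simp add: o_def)
      then show ?thesis
        by (simp add: has_field_derivative_def linear_cmul[OF linear_dird[OF f]] mult.commute[of _ "dird f (x + s *\<^sub>R u + c *\<^sub>R v) u"])
    qed
    have Dg: "(g has_real_derivative (dird f (x + s *\<^sub>R u + t *\<^sub>R v) u - dird f (x + s *\<^sub>R u) u)) (at s)"
      if "0 \<le> s" "s \<le> t" for s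
      unfolding g_def using D[of s t] D[of s 0] that t by (auto intro!: DERIV_diff)
    obtain s where s: "0 < s" "s < t"
      and gs: "g t - g 0 = (t - 0) * (dird f (x + s *\<^sub>R u + t *\<^sub>R v) u - dird f (x + s *\<^sub>R u) u)"
      using MVT2[of 0 t g, OF t(1) Dg] by blast
    define A where "A = dird f (x + s *\<^sub>R u + t *\<^sub>R v) u - dird f (x + s *\<^sub>R u) u"
    \<comment> \<open>The first-order expansion of \<open>dird f y u\<close> at \<open>x\<close> is
      used at two points whose difference is \<open>t\<close> times \<open>v\<close>, so only
      \<open>t * ?D v\<close> survives, whatever the intermediate \<open>s\<close> is.\<close>
    have "norm (dird f (x + s *\<^sub>R u + t *\<^sub>R v) u - dird f x u - ?D (s *\<^sub>R u + t *\<^sub>R v)) \<le> e' * (t * N)"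
      using d(2)[of "x + s *\<^sub>R u + t *\<^sub>R v"] small[of s t] s t e'
      by (smt (verit) add.assoc add_diff_cancel_left' mult_left_mono)
    moreover have "norm (dird f (x + s *\<^sub>R u) u - dird f x u - ?D (s *\<^sub>R u)) \<le> e' * (t * N)"
      using d(2)[of "x + s *\<^sub>R u"] small[of s 0] s t e'
      by (smt (verit) add.right_neutral scaleR_zero_left add_diff_cancel_left' mult_left_mono)
    ultimately have "\<bar>A - t * ?D v\<bar> \<le> 2 * (e' * (t * N))"
      by (simp add: A_def linear_add[OF linD] linear_cmul[OF linD] del: mult_le_cancel_left_pos)
    then have "\<bar>A / t - ?D v\<bar> \<le> 2 * e' * N"
      using t by (simp add: field_simps abs_le_iff)
    also have "\<dots> < e" using e N by (simp add: e'_def)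
    finally have "\<bar>A / t - ?D v\<bar> < e" .
    moreover have "(f (x + t *\<^sub>R u + t *\<^sub>R v) - f (x + t *\<^sub>R u) - f (x + t *\<^sub>R v) + f x) / t\<^sup>2 = A / t"
    proof -
      have "f (x + t *\<^sub>R u + t *\<^sub>R v) - f (x + t *\<^sub>R u) - f (x + t *\<^sub>R v) + f x = t * A"
        using gs by (simp add: g_def A_def)
      then show ?thesis using t by (simp add: power2_eq_square)
    qed
    ultimately show ?thesis by (simp add: dist_real_def)
  qed
  then show "\<forall>\<^sub>F t in at_right 0. dist ((f (x + t *\<^sub>R u + t *\<^sub>R v) - f (x + t *\<^sub>R u) - f (x + t *\<^sub>R v) + f x) / t\<^sup>2) (?D v) < e"
    using T unfolding eventually_at_right_field by blast
qed

lemma dird_dird_commute_real: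
  fixes f :: "'a::real_normed_vector \<Rightarrow> real"
  assumes "open S" "x \<in> S" "\<And>y. y \<in> S \<Longrightarrow> f differentiable (at y)"
    and "\<And>u. (\<lambda>y. dird f y u) differentiable (at x)"
  shows "dird (\<lambda>y. dird f y u) x v = dird (\<lambda>y. dird f y v) x u"
proof -
  have "((\<lambda>t. (f (x + t *\<^sub>R u + t *\<^sub>R v) - f (x + t *\<^sub>R u) - f (x + t *\<^sub>R v) + f x) / t\<^sup>2)
    \<longlongrightarrow> dird (\<lambda>y. dird f y v) x u) (at_right 0)"
    using second_difference_tendsto[OF assms(1-3,4), of v u] by (simp add: algebra_simps)
  then show ?thesis
    using second_difference_tendsto[OF assms(1-3,4), of u v] tendsto_unique trivial_limit_at_right_real by blast
qed

lemma dird_component: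
  fixes f :: "'a::real_normed_vector \<Rightarrow> real ^ 'n::finite"
  assumes "f differentiable (at x)"
  shows "dird (\<lambda>y. f y $ i) x = (\<lambda>h. dird f x h $ i)"
  by (rule dird_eqI[OF bounded_linear.has_derivative[OF bounded_linear_vec_nth has_derivative_dird[OF assms]]])

lemma dird_dird_commute:
  fixes f :: "'a::euclidean_space \<Rightarrow> real ^ 'n::finite"
  assumes "open S" "x \<in> S" "smooth_on S f"
  shows "dird (\<lambda>y. dird f y u) x v = dird (\<lambda>y. dird f y v) x u"
  unfolding vec_eq_iff
proof
  fix i
  have f: "f differentiable (at y)" if "y \<in> S" for y
    using smooth_on_differentiable assms that by blast
  have df: "(\<lambda>y. dird f y w) differentiable (at x)" for w
    using smooth_on_differentiable smooth_on_dird assms by blast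
  have fi: "smooth_on S (\<lambda>y. f y $ i)" by (rule smooth_on_component[OF assms(1,3)])
  have eq: "dird (\<lambda>y. dird f y w) x z $ i = dird (\<lambda>y. dird (\<lambda>y. f y $ i) y w) x z" for w z
    using dird_cong_open[OF assms(1,2), of "\<lambda>y. dird (\<lambda>y. f y $ i) y w" "\<lambda>y. dird f y w $ i"]
    by (simp add: dird_component f df)
  show "dird (\<lambda>y. dird f y u) x v $ i = dird (\<lambda>y. dird f y v) x u $ i"
    unfolding eq
    by (rule dird_dird_commute_real[OF assms(1,2)])
      (use fi assms smooth_on_differentiable smooth_on_dird in blast)+
qed


section \<open>Christoffel symbols and the Lorentz endomorphism in a chart\<close>

definition koszul ::
    "(real ^ 'n \<Rightarrow> real ^ 'n \<Rightarrow> real ^ 'n \<Rightarrow> real)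
      \<Rightarrow> real ^ 'n \<Rightarrow> real ^ 'n \<Rightarrow> real ^ 'n \<Rightarrow> real ^ 'n::finite \<Rightarrow> real"
  where "koszul G x \<xi> \<eta> \<zeta> =
    dird (\<lambda>y. G y \<eta> \<zeta>) x \<xi> + dird (\<lambda>y. G y \<xi> \<zeta>) x \<eta> - dird (\<lambda>y. G y \<xi> \<eta>) x \<zeta>"

text \<open>\<open>S\<close> is a free parameter because it is instantiated both by whole chart
  images and, for coordinate changes, by images of overlaps.\<close>

locale chart_metric =
  fixes S :: "(real ^ 'n::finite) set" and G :: "real ^ 'n \<Rightarrow> real ^ 'n \<Rightarrow> real ^ 'n \<Rightarrow> real"
  assumes open_S: "open S" and inner: "x \<in> S \<Longrightarrow> inner_form (G x)"
    and smooth: "smooth_on S (\<lambda>x. G x \<xi> \<eta>)"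
begin

abbreviation "\<Gamma> \<equiv> christoffel G"

lemma bil: "x \<in> S \<Longrightarrow> bilinear (G x)"
  and sym: "x \<in> S \<Longrightarrow> G x v w = G x w v"
  and pos: "x \<in> S \<Longrightarrow> v \<noteq> 0 \<Longrightarrow> G x v v > 0"
  using inner[of x] by (auto simp: inner_form_def)

lemma linear_left: "x \<in> S \<Longrightarrow> linear (\<lambda>v. G x v w)"
  and linear_right: "x \<in> S \<Longrightarrow> linear (G x v)"
  using bil[of x] by (auto simp: bilinear_def)

lemma differentiable: "x \<in> S \<Longrightarrow> (\<lambda>y. G y \<xi> \<eta>) differentiable (at x)"
  using smooth smooth_on_differentiable by blast

lemma bilinear_dird_left: "x \<in> S \<Longrightarrow> bilinear (\<lambda>\<zeta> \<xi>. dird (\<lambda>y. G y \<xi> \<eta>) x \<zeta>)"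
  by (rule bilinear_dird_linear_family[OF open_S]) (auto intro: linear_left differentiable)

lemma bilinear_dird_right: "x \<in> S \<Longrightarrow> bilinear (\<lambda>\<zeta> \<eta>. dird (\<lambda>y. G y \<xi> \<eta>) x \<zeta>)"
  by (rule bilinear_dird_linear_family[OF open_S]) (auto intro: linear_right differentiable)

lemma koszul_add:
  assumes "x \<in> S"
  shows "koszul G x (\<xi> + \<xi>') \<eta> \<zeta> = koszul G x \<xi> \<eta> \<zeta> + koszul G x \<xi>' \<eta> \<zeta>"
    and "koszul G x \<xi> \<eta> (\<zeta> + \<zeta>') = koszul G x \<xi> \<eta> \<zeta> + koszul G x \<xi> \<eta> \<zeta>'"
  by (simp_all add: koszul_def algebra_simps
      bilinear_ladd[OF bilinear_dird_left[OF assms]] bilinear_radd[OF bilinear_dird_left[OF assms]]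
      bilinear_radd[OF bilinear_dird_right[OF assms]])

lemma koszul_scaleR:
  assumes "x \<in> S"
  shows "koszul G x (c *\<^sub>R \<xi>) \<eta> \<zeta> = c * koszul G x \<xi> \<eta> \<zeta>"
    and "koszul G x \<xi> \<eta> (c *\<^sub>R \<zeta>) = c * koszul G x \<xi> \<eta> \<zeta>"
  by (simp_all add: koszul_def algebra_simps
      bilinear_lmul[OF bilinear_dird_left[OF assms]] bilinear_rmul[OF bilinear_dird_left[OF assms]]
      bilinear_rmul[OF bilinear_dird_right[OF assms]])

text \<open>The first two terms are interchanged; the third is a derivative, so symmetry of
  \<open>G\<close> is used on a neighbourhood and not just at \<open>x\<close>.\<close>

lemma koszul_commute: "x \<in> S \<Longrightarrow> koszul G x \<xi> \<eta> \<zeta> = koszul G x \<eta> \<xi> \<zeta>"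
  using dird_cong_open[OF open_S, of x "\<lambda>y. G y \<xi> \<eta>" "\<lambda>y. G y \<eta> \<xi>"] sym
  by (simp add: koszul_def)

lemma koszul_linear: "x \<in> S \<Longrightarrow> linear (\<lambda>\<zeta>. koszul G x \<xi> \<eta> \<zeta> / 2)"
  by (auto intro!: linearI simp: koszul_add koszul_scaleR add_divide_distrib)

lemma smooth_koszul: "smooth_on S (\<lambda>x. koszul G x \<xi> \<eta> \<zeta>)"
  unfolding koszul_def by (intro smooth_on_diff smooth_on_add open_S smooth_on_dird smooth)

text \<open>Two definite descriptions with equivalent predicates. The equation therefore holds at
  every \<open>x\<close> and can be unfolded under binders.\<close>

lemma christoffel_sharp: "\<Gamma> x \<xi> \<eta> = sharp (G x) (\<lambda>\<zeta>. koszul G x \<xi> \<eta> \<zeta> / 2)"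
proof -
  have "2 * G x \<gamma> \<zeta> = koszul G x \<xi> \<eta> \<zeta> \<longleftrightarrow> G x \<gamma> \<zeta> = koszul G x \<xi> \<eta> \<zeta> / 2" for \<gamma> \<zeta> by auto
  then show ?thesis unfolding christoffel_def sharp_def koszul_def by simp
qed

lemma christoffel_works: "x \<in> S \<Longrightarrow> 2 * G x (\<Gamma> x \<xi> \<eta>) \<zeta> = koszul G x \<xi> \<eta> \<zeta>"
  using sharp_works[OF inner koszul_linear, of x x \<xi> \<eta> \<zeta>] by (simp add: christoffel_sharp)

lemma christoffel_eqI:
  "x \<in> S \<Longrightarrow> (\<And>\<zeta>. 2 * G x \<gamma> \<zeta> = koszul G x \<xi> \<eta> \<zeta>) \<Longrightarrow> \<Gamma> x \<xi> \<eta> = \<gamma>"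
  unfolding christoffel_sharp by (intro sharp_eqI inner) (auto simp: field_simps)

lemma christoffel_commute: "x \<in> S \<Longrightarrow> \<Gamma> x \<xi> \<eta> = \<Gamma> x \<eta> \<xi>"
  by (simp add: christoffel_sharp koszul_commute[of x \<xi>])

text \<open>Uniqueness in the Koszul formula carries linearity in the first slot over from
  \<open>koszul\<close>; the second slot follows by symmetry.\<close>

lemma christoffel_bilinear:
  assumes "x \<in> S"
  shows "bilinear (\<Gamma> x)"
proof -
  have *: "linear (\<lambda>\<xi>. \<Gamma> x \<xi> \<eta>)" for \<eta>
  proof (intro linearI christoffel_eqI assms)
    fix \<xi> \<xi>' \<zeta> c
    show "2 * G x (\<Gamma> x \<xi> \<eta> + \<Gamma> x \<xi>' \<eta>) \<zeta> = koszul G x (\<xi> + \<xi>') \<eta> \<zeta>"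
      unfolding koszul_add(1)[OF assms]
      by (simp add: assms linear_add[OF linear_left] flip: christoffel_works)
    show "2 * G x (c *\<^sub>R \<Gamma> x \<xi> \<eta>) \<zeta> = koszul G x (c *\<^sub>R \<xi>) \<eta> \<zeta>"
      unfolding koszul_scaleR(1)[OF assms]
      by (simp add: assms linear_cmul[OF linear_left] flip: christoffel_works)
  qed
  moreover have "linear (\<Gamma> x \<xi>)" for \<xi>
    using *[of \<xi>] unfolding christoffel_commute[OF assms, of _ \<xi>] by simp
  ultimately show ?thesis by (simp add: bilinear_def)
qed

lemma smooth_sharp_component: "smooth_on S (\<lambda>x. sharp (G x) (\<lambda>w. w $ k))"
proof (rule smooth_on_vecI[OF open_S])
  fix i
  have "smooth_on S (\<lambda>x. det (\<chi> a b. if b = i then (axis a 1 :: real ^ 'n) $ k else G x (axis b 1) (axis a 1)) /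
      det (\<chi> a b. G x (axis b 1) (axis a 1)))"
  proof (intro smooth_on_divide smooth_on_det open_S)
    show "smooth_on S (\<lambda>x. (\<chi> a b. if b = i then (axis a 1 :: real ^ 'n) $ k
        else G x (axis b 1) (axis a 1)) $ a $ b)" for a b
      by (cases "b = i") (simp_all add: smooth)
  qed (auto simp: smooth gram_matrix_det inner)
  then show "smooth_on S (\<lambda>x. sharp (G x) (\<lambda>w. w $ k) $ i)"
    by (subst smooth_on_cong[OF open_S]) (auto intro: sharp_component_cramer(1) inner linear_component)
qed

lemma smooth_sharp:
  assumes "\<And>x. x \<in> S \<Longrightarrow> linear (l x)" "\<And>w. smooth_on S (\<lambda>x. l x w)"
  shows "smooth_on S (\<lambda>x. sharp (G x) (l x))"
proof -
  have "smooth_on S (\<lambda>x. \<Sum>i\<in>UNIV. l x (axis i 1) *\<^sub>R sharp (G x) (\<lambda>w. w $ i))"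
    by (intro smooth_on_sum smooth_on_scaleR open_S smooth_sharp_component assms)
  then show ?thesis
    by (subst smooth_on_cong[OF open_S]) (auto intro: sharp_expand inner assms)
qed

lemma christoffel_smooth: "smooth_on S (\<lambda>x. \<Gamma> x \<xi> \<eta>)"
  unfolding christoffel_sharp
proof (rule smooth_sharp)
  show "smooth_on S (\<lambda>x. koszul G x \<xi> \<eta> w / 2)" for w
    by (rule smooth_on_divide) (simp_all add: open_S smooth_koszul)
qed (rule koszul_linear)

lemma christoffel_differentiable: "x \<in> S \<Longrightarrow> (\<lambda>y. \<Gamma> y \<xi> \<eta>) differentiable (at x)"
  using christoffel_smooth smooth_on_differentiable by blast

end

section \<open>The Lorentz endomorphism of a two-form in a chart\<close>

locale chart_magnetic = chart_metric S G
  for S :: "(real ^ 'n::finite) set" and G :: "real ^ 'n \<Rightarrow> real ^ 'n \<Rightarrow> real ^ 'n \<Rightarrow> real" +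
  fixes \<omega> :: "real ^ 'n \<Rightarrow> real ^ 'n \<Rightarrow> real ^ 'n \<Rightarrow> real"
  assumes \<omega>_bilinear: "x \<in> S \<Longrightarrow> bilinear (\<omega> x)"
    and \<omega>_skew: "x \<in> S \<Longrightarrow> \<omega> x v w = - \<omega> x w v"
    and \<omega>_smooth: "smooth_on S (\<lambda>x. \<omega> x \<xi> \<eta>)"
begin

abbreviation "Y \<equiv> lorentz G \<omega>"

lemma lorentz_sharp: "Y x v = sharp (G x) (\<omega> x v)"
  by (simp add: lorentz_def sharp_def)

lemma \<omega>_linear: "x \<in> S \<Longrightarrow> linear (\<omega> x v)"
  using \<omega>_bilinear[of x] by (simp add: bilinear_def)

lemma lorentz_works: "x \<in> S \<Longrightarrow> G x (Y x v) w = \<omega> x v w"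
  unfolding lorentz_sharp by (rule sharp_works[OF inner \<omega>_linear])

lemma lorentz_eqI: "x \<in> S \<Longrightarrow> (\<And>w. G x u w = \<omega> x v w) \<Longrightarrow> Y x v = u"
  unfolding lorentz_sharp by (rule sharp_eqI[OF inner])

lemma lorentz_skew: "x \<in> S \<Longrightarrow> G x (Y x v) w = - G x v (Y x w)"
  using sym[of x v "Y x w"] by (simp add: lorentz_works \<omega>_skew[of x v w])

lemma lorentz_linear: "x \<in> S \<Longrightarrow> linear (Y x)"
  by (intro linearI lorentz_eqI)
    (auto simp: linear_add[OF linear_left] linear_cmul[OF linear_left] lorentz_works
      bilinear_ladd[OF \<omega>_bilinear] bilinear_lmul[OF \<omega>_bilinear])

lemma lorentz_smooth: "smooth_on S (\<lambda>x. Y x v)"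
  unfolding lorentz_sharp by (rule smooth_sharp) (auto intro: \<omega>_linear \<omega>_smooth)

lemma lorentz_differentiable: "x \<in> S \<Longrightarrow> (\<lambda>y. Y y v) differentiable (at x)"
  using lorentz_smooth smooth_on_differentiable by blast

lemma trace_lorentz_square_neg:
  assumes "x \<in> S" "\<omega> x v w \<noteq> 0"
  shows "endo_trace (\<lambda>w. Y x (Y x w)) < 0"
proof (rule trace_skew_square_neg)
  show "inner_form (G x)" "linear (Y x)" using assms by (simp_all add: inner lorentz_linear)
  show "G x (Y x v) w = - G x v (Y x w)" for v w using assms(1) by (rule lorentz_skew)
  show "Y x v \<noteq> 0"
  proof
    assume "Y x v = 0"
    then have "\<omega> x v w = G x 0 w" using lorentz_works[OF assms(1), of v w] by simp
    then show False using assms bilinear_lzero[OF bil] by simp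
  qed
qed

end


section \<open>Invariance under coordinate changes\<close>

text \<open>The formula of \<open>magnetic_Ric\<close> for coordinate expressions, with
  \<open>lorentz\<close> and \<open>Y_tilde\<close> instantiated at base type
  \<open>real ^ 'n\<close>. It involves no chart, so coordinate and conformal changes can be studied
  on open subsets of Euclidean space.\<close>

definition local_magnetic_Ric ::
    "(real ^ 'n \<Rightarrow> real ^ 'n \<Rightarrow> real ^ 'n \<Rightarrow> real)
      \<Rightarrow> (real ^ 'n \<Rightarrow> real ^ 'n \<Rightarrow> real ^ 'n \<Rightarrow> real) \<Rightarrow> real ^ 'n \<Rightarrow> real ^ 'n::finite \<Rightarrow> real"
  where "local_magnetic_Ric G \<omega> x v =
    endo_trace (\<lambda>w. curvature G x w v v)
    - endo_trace (\<lambda>w. cov_deriv_endo G (lorentz G \<omega>) x w v - Y_tilde G \<omega> x v w)"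

context chart_metric
begin

lemma bilinear_dird_christoffel_left:
  "x \<in> S \<Longrightarrow> bilinear (\<lambda>\<zeta> \<xi>. dird (\<lambda>y. \<Gamma> y \<xi> \<eta>) x \<zeta>)"
proof (rule bilinear_dird_linear_family[OF open_S])
  show "linear (\<lambda>\<xi>. \<Gamma> y \<xi> \<eta>)" if "y \<in> S" for y
    using christoffel_bilinear[OF that] by (simp add: bilinear_def)
qed (auto intro: christoffel_differentiable)

text \<open>\<open>endo_trace\<close> reads only the values on basis vectors; its invariance under
  conjugation requires linearity in \<open>w\<close>.\<close>

lemma curvature_linear:
  assumes "x \<in> S"
  shows "linear (\<lambda>w. curvature G x w \<eta> \<zeta>)"
  by (rule linearI)
    (simp_all add: curvature_def Let_def algebra_simps
      bilinear_ladd[OF bilinear_dird_christoffel_left[OF assms]]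
      bilinear_lmul[OF bilinear_dird_christoffel_left[OF assms]]
      bilinear_radd[OF bilinear_dird_christoffel_left[OF assms]]
      bilinear_rmul[OF bilinear_dird_christoffel_left[OF assms]]
      bilinear_ladd[OF christoffel_bilinear[OF assms]] bilinear_lmul[OF christoffel_bilinear[OF assms]]
      bilinear_radd[OF christoffel_bilinear[OF assms]] bilinear_rmul[OF christoffel_bilinear[OF assms]])

end

context chart_magnetic
begin

lemma bilinear_dird_lorentz: "x \<in> S \<Longrightarrow> bilinear (\<lambda>\<zeta> \<eta>. dird (\<lambda>y. Y y \<eta>) x \<zeta>)"
  by (rule bilinear_dird_linear_family[OF open_S _ lorentz_linear lorentz_differentiable])

lemma cov_deriv_lorentz_linear:
  assumes "x \<in> S"
  shows "linear (\<lambda>w. cov_deriv_endo G Y x w v)"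
  by (rule linearI)
    (simp_all add: cov_deriv_endo_def Let_def algebra_simps
      bilinear_ladd[OF bilinear_dird_lorentz[OF assms]] bilinear_lmul[OF bilinear_dird_lorentz[OF assms]]
      bilinear_ladd[OF christoffel_bilinear[OF assms]] bilinear_lmul[OF christoffel_bilinear[OF assms]]
      linear_add[OF lorentz_linear[OF assms]] linear_cmul[OF lorentz_linear[OF assms]])

lemma Y_tilde_linear:
  assumes "x \<in> S"
  shows "linear (Y_tilde G \<omega> x v)"
  by (rule linearI)
    (simp_all add: Y_tilde_def Let_def algebra_simps
      linear_add[OF linear_left[OF assms]] linear_cmul[OF linear_left[OF assms]]
      linear_add[OF lorentz_linear[OF assms]] linear_cmul[OF lorentz_linear[OF assms]])

end

locale chart_change =
  target: chart_magnetic S G \<omega> + source: chart_magnetic S' G' \<omega>'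
  for S S' :: "(real ^ 'n::finite) set" and G G' \<omega> \<omega>' +
  fixes \<tau> :: "real ^ 'n \<Rightarrow> real ^ 'n"
  assumes \<tau>_in: "x \<in> S' \<Longrightarrow> \<tau> x \<in> S" and \<tau>_smooth: "smooth_on S' \<tau>"
    and pull_G: "x \<in> S' \<Longrightarrow> G' x \<xi> \<eta> = G (\<tau> x) (dird \<tau> x \<xi>) (dird \<tau> x \<eta>)"
    and pull_\<omega>: "x \<in> S' \<Longrightarrow> \<omega>' x \<xi> \<eta> = \<omega> (\<tau> x) (dird \<tau> x \<xi>) (dird \<tau> x \<eta>)"
begin

abbreviation "A \<equiv> dird \<tau>"

lemma \<tau>_deriv: "x \<in> S' \<Longrightarrow> (\<tau> has_derivative A x) (at x)"
  by (rule has_derivative_dird[OF smooth_on_differentiable[OF \<tau>_smooth]])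

lemma A_linear: "x \<in> S' \<Longrightarrow> linear (A x)"
  using \<tau>_deriv has_derivative_linear by blast

lemma A_smooth: "smooth_on S' (\<lambda>y. A y \<xi>)"
  by (rule smooth_on_dird[OF \<tau>_smooth])

lemma A_deriv: "x \<in> S' \<Longrightarrow> ((\<lambda>y. A y \<xi>) has_derivative dird (\<lambda>y. A y \<xi>) x) (at x)"
  by (rule has_derivative_dird[OF smooth_on_differentiable[OF A_smooth]])

lemma A_commute: "x \<in> S' \<Longrightarrow> dird (\<lambda>y. A y \<xi>) x \<eta> = dird (\<lambda>y. A y \<eta>) x \<xi>"
  by (rule dird_dird_commute[OF source.open_S _ \<tau>_smooth])

text \<open>Invertibility comes from the metric: a vector killed by \<open>A x\<close> has length 0
  for the pulled-back form \<open>G'\<close>, which is definite.\<close>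

lemma A_inj:
  assumes "x \<in> S'"
  shows "inj (A x)"
proof -
  have "\<xi> = 0" if "A x \<xi> = 0" for \<xi>
    using inner_form_eq_zero[OF source.inner[OF assms], of \<xi>] that
    by (simp add: pull_G assms bilinear_lzero[OF target.bil[OF \<tau>_in]])
  then show ?thesis using linear_injective_0[OF A_linear[OF assms]] by blast
qed

lemma A_surj: "x \<in> S' \<Longrightarrow> surj (A x)"
  using linear_injective_imp_surjective A_linear A_inj by blast

lemma dird_pull_G:
  assumes "x \<in> S'"
  shows "dird (\<lambda>y. G' y \<xi> \<eta>) x \<zeta> = dird (\<lambda>y. G y (A x \<xi>) (A x \<eta>)) (\<tau> x) (A x \<zeta>)
    + G (\<tau> x) (dird (\<lambda>y. A y \<xi>) x \<zeta>) (A x \<eta>) + G (\<tau> x) (A x \<xi>) (dird (\<lambda>y. A y \<eta>) x \<zeta>)"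
proof -
  have "dird (\<lambda>y. G' y \<xi> \<eta>) x = dird (\<lambda>y. G (\<tau> y) (A y \<xi>) (A y \<eta>)) x"
    by (rule dird_cong_open[OF source.open_S assms]) (rule pull_G)
  also have "\<dots> = (\<lambda>\<zeta>. dird (\<lambda>y. G y (A x \<xi>) (A x \<eta>)) (\<tau> x) (A x \<zeta>)
    + G (\<tau> x) (dird (\<lambda>y. A y \<xi>) x \<zeta>) (A x \<eta>) + G (\<tau> x) (A x \<xi>) (dird (\<lambda>y. A y \<eta>) x \<zeta>))"
    by (rule dird_eqI, rule has_derivative_bilinear_family[OF target.open_S \<tau>_in[OF assms] target.bil
          target.differentiable[OF \<tau>_in[OF assms]] \<tau>_deriv[OF assms] A_deriv[OF assms] A_deriv[OF assms]])
  finally show ?thesis by simp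
qed

text \<open>Six terms with second derivatives of \<open>\<tau>\<close> enter the Koszul sum of
  \<open>G'\<close>. By symmetry of those derivatives and of \<open>G\<close>, four cancel in pairs
  and the other two coincide.\<close>

lemma christoffel_pull:
  assumes "x \<in> S'"
  shows "A x (christoffel G' x \<xi> \<eta>) =
    dird (\<lambda>y. A y \<eta>) x \<xi> + christoffel G (\<tau> x) (A x \<xi>) (A x \<eta>)" (is "_ = ?R")
proof -
  note \<tau>x = \<tau>_in[OF assms]
  \<comment> \<open>The candidate is defined as the preimage of the right-hand side; uniqueness in
    the Koszul formula then identifies it.\<close>
  obtain \<gamma> where \<gamma>: "A x \<gamma> = ?R" using A_surj[OF assms] by (metis surjD)
  have "christoffel G' x \<xi> \<eta> = \<gamma>"
  proof (rule source.christoffel_eqI[OF assms])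
    fix \<zeta>
    have "2 * G' x \<gamma> \<zeta> = 2 * G (\<tau> x) (dird (\<lambda>y. A y \<eta>) x \<xi>) (A x \<zeta>)
        + koszul G (\<tau> x) (A x \<xi>) (A x \<eta>) (A x \<zeta>)"
      by (simp add: pull_G assms \<gamma> linear_add[OF target.linear_left[OF \<tau>x]]
          target.christoffel_works[OF \<tau>x])
    also have "\<dots> = koszul G' x \<xi> \<eta> \<zeta>"
      by (simp add: koszul_def dird_pull_G[OF assms] A_commute[OF assms, of \<xi> \<eta>]
          A_commute[OF assms, of \<zeta>] target.sym[OF \<tau>x, of "A x \<xi>"] target.sym[OF \<tau>x, of "A x \<eta>"])
    finally show "2 * G' x \<gamma> \<zeta> = koszul G' x \<xi> \<eta> \<zeta>" .
  qed
  then show ?thesis using \<gamma> by simp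
qed

text \<open>Differentiating \<open>A y\<close> applied to the Christoffel vector leaves a second
  derivative of \<open>\<tau>\<close> evaluated on that vector. The transformation law for the
  iterated Christoffel term produces the same expression, and adding that term cancels it.\<close>

lemma christoffel_deriv_pull:
  assumes "x \<in> S'"
  shows "A x (dird (\<lambda>y. christoffel G' y \<eta> \<zeta>) x \<xi>) + A x (christoffel G' x \<xi> (christoffel G' x \<eta> \<zeta>)) =
    dird (\<lambda>y. dird (\<lambda>z. A z \<zeta>) y \<eta>) x \<xi>
    + dird (\<lambda>y. christoffel G y (A x \<eta>) (A x \<zeta>)) (\<tau> x) (A x \<xi>)
    + christoffel G (\<tau> x) (dird (\<lambda>y. A y \<eta>) x \<xi>) (A x \<zeta>)
    + christoffel G (\<tau> x) (A x \<eta>) (dird (\<lambda>y. A y \<zeta>) x \<xi>)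
    + christoffel G (\<tau> x) (A x \<xi>) (dird (\<lambda>y. A y \<zeta>) x \<eta>)
    + christoffel G (\<tau> x) (A x \<xi>) (christoffel G (\<tau> x) (A x \<eta>) (A x \<zeta>))"
proof -
  note \<tau>x = \<tau>_in[OF assms]
  have "((\<lambda>y. A y (christoffel G' y \<eta> \<zeta>)) has_derivative
      (\<lambda>h. dird (\<lambda>y. A y (christoffel G' x \<eta> \<zeta>)) x h + A x (dird (\<lambda>y. christoffel G' y \<eta> \<zeta>) x h))) (at x)"
    by (rule has_derivative_linear_family[where \<tau> = "\<lambda>y. y", OF source.open_S assms A_linear
          smooth_on_differentiable[OF A_smooth assms] has_derivative_ident
          has_derivative_dird[OF source.christoffel_differentiable[OF assms]]])
  then have L: "dird (\<lambda>y. A y (christoffel G' y \<eta> \<zeta>)) x \<xi> =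
      dird (\<lambda>y. A y (christoffel G' x \<eta> \<zeta>)) x \<xi> + A x (dird (\<lambda>y. christoffel G' y \<eta> \<zeta>) x \<xi>)"
    by (simp only: dird_eqI)
  have "((\<lambda>y. christoffel G (\<tau> y) (A y \<eta>) (A y \<zeta>)) has_derivative
      (\<lambda>h. dird (\<lambda>y. christoffel G y (A x \<eta>) (A x \<zeta>)) (\<tau> x) (A x h)
        + christoffel G (\<tau> x) (dird (\<lambda>y. A y \<eta>) x h) (A x \<zeta>)
        + christoffel G (\<tau> x) (A x \<eta>) (dird (\<lambda>y. A y \<zeta>) x h))) (at x)"
    by (rule has_derivative_bilinear_family[OF target.open_S \<tau>x target.christoffel_bilinear
          target.christoffel_differentiable[OF \<tau>x] \<tau>_deriv[OF assms] A_deriv[OF assms] A_deriv[OF assms]])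
  from has_derivative_add[OF has_derivative_dird[OF smooth_on_differentiable[OF smooth_on_dird[OF A_smooth[of \<zeta>], of \<eta>] assms]] this]
  have R: "dird (\<lambda>y. dird (\<lambda>z. A z \<zeta>) y \<eta> + christoffel G (\<tau> y) (A y \<eta>) (A y \<zeta>)) x \<xi> =
      dird (\<lambda>y. dird (\<lambda>z. A z \<zeta>) y \<eta>) x \<xi> + (dird (\<lambda>y. christoffel G y (A x \<eta>) (A x \<zeta>)) (\<tau> x) (A x \<xi>)
        + christoffel G (\<tau> x) (dird (\<lambda>y. A y \<eta>) x \<xi>) (A x \<zeta>)
        + christoffel G (\<tau> x) (A x \<eta>) (dird (\<lambda>y. A y \<zeta>) x \<xi>))"
    by (simp only: dird_eqI)
  have eq: "dird (\<lambda>y. A y (christoffel G' y \<eta> \<zeta>)) x =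
      dird (\<lambda>y. dird (\<lambda>z. A z \<zeta>) y \<eta> + christoffel G (\<tau> y) (A y \<eta>) (A y \<zeta>)) x"
    by (rule dird_cong_open[OF source.open_S assms]) (rule christoffel_pull)
  have "A x (christoffel G' x \<xi> (christoffel G' x \<eta> \<zeta>)) =
      dird (\<lambda>y. A y (christoffel G' x \<eta> \<zeta>)) x \<xi>
      + (christoffel G (\<tau> x) (A x \<xi>) (dird (\<lambda>y. A y \<zeta>) x \<eta>)
      + christoffel G (\<tau> x) (A x \<xi>) (christoffel G (\<tau> x) (A x \<eta>) (A x \<zeta>)))"
    unfolding christoffel_pull[OF assms, of \<xi>] christoffel_pull[OF assms, of \<eta>]
    by (simp add: bilinear_radd[OF target.christoffel_bilinear[OF \<tau>x]])
  then show ?thesis using L[unfolded eq R] by (simp add: algebra_simps)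
qed

text \<open>Antisymmetrise the preceding formula in \<open>\<xi>\<close> and \<open>\<eta>\<close>:
  the third derivative of \<open>\<tau>\<close> and the Christoffel terms containing second
  derivatives of \<open>\<tau>\<close> are symmetric together and drop out.\<close>

lemma curvature_pull:
  assumes "x \<in> S'"
  shows "A x (curvature G' x \<xi> \<eta> \<zeta>) = curvature G (\<tau> x) (A x \<xi>) (A x \<eta>) (A x \<zeta>)"
proof -
  have "A x (curvature G' x \<xi> \<eta> \<zeta>) =
      (A x (dird (\<lambda>y. christoffel G' y \<eta> \<zeta>) x \<xi>) + A x (christoffel G' x \<xi> (christoffel G' x \<eta> \<zeta>)))
      - (A x (dird (\<lambda>y. christoffel G' y \<xi> \<zeta>) x \<eta>) + A x (christoffel G' x \<eta> (christoffel G' x \<xi> \<zeta>)))"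
    by (simp add: curvature_def Let_def linear_add[OF A_linear[OF assms]] linear_diff[OF A_linear[OF assms]])
  also have "\<dots> = curvature G (\<tau> x) (A x \<xi>) (A x \<eta>) (A x \<zeta>)"
    unfolding christoffel_deriv_pull[OF assms]
    by (simp add: curvature_def Let_def A_commute[OF assms, of \<eta> \<xi>]
        dird_dird_commute[OF source.open_S assms A_smooth, of \<zeta> \<eta> \<xi>])
  finally show ?thesis .
qed

lemma lorentz_pull:
  assumes "x \<in> S'"
  shows "A x (lorentz G' \<omega>' x v) = lorentz G \<omega> (\<tau> x) (A x v)"
proof (rule sym, rule target.lorentz_eqI[OF \<tau>_in[OF assms]])
  fix w
  obtain w' where "w = A x w'" using A_surj[OF assms] by (metis surjD)
  then show "G (\<tau> x) (A x (lorentz G' \<omega>' x v)) w = \<omega> (\<tau> x) (A x v) w"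
    using source.lorentz_works[OF assms, of v w'] by (simp add: pull_G pull_\<omega> assms)
qed

text \<open>The second derivatives of \<open>\<tau>\<close> from differentiating
  \<open>lorentz_pull\<close> cancel against the inhomogeneous parts of the two Christoffel
  terms.\<close>

lemma cov_deriv_pull:
  assumes "x \<in> S'"
  shows "A x (cov_deriv_endo G' (lorentz G' \<omega>') x \<xi> \<eta>) =
    cov_deriv_endo G (lorentz G \<omega>) (\<tau> x) (A x \<xi>) (A x \<eta>)"
proof -
  note \<tau>x = \<tau>_in[OF assms]
  have "((\<lambda>y. A y (lorentz G' \<omega>' y \<eta>)) has_derivative
      (\<lambda>h. dird (\<lambda>y. A y (lorentz G' \<omega>' x \<eta>)) x h + A x (dird (\<lambda>y. lorentz G' \<omega>' y \<eta>) x h))) (at x)"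
    by (rule has_derivative_linear_family[where \<tau> = "\<lambda>y. y", OF source.open_S assms A_linear
          smooth_on_differentiable[OF A_smooth assms] has_derivative_ident
          has_derivative_dird[OF source.lorentz_differentiable[OF assms]]])
  then have L: "dird (\<lambda>y. A y (lorentz G' \<omega>' y \<eta>)) x \<xi> =
      dird (\<lambda>y. A y (lorentz G' \<omega>' x \<eta>)) x \<xi> + A x (dird (\<lambda>y. lorentz G' \<omega>' y \<eta>) x \<xi>)"
    by (simp only: dird_eqI)
  have "((\<lambda>y. lorentz G \<omega> (\<tau> y) (A y \<eta>)) has_derivative
      (\<lambda>h. dird (\<lambda>y. lorentz G \<omega> y (A x \<eta>)) (\<tau> x) (A x h)
        + lorentz G \<omega> (\<tau> x) (dird (\<lambda>y. A y \<eta>) x h))) (at x)"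
    by (rule has_derivative_linear_family[OF target.open_S \<tau>x target.lorentz_linear
          target.lorentz_differentiable[OF \<tau>x] \<tau>_deriv[OF assms] A_deriv[OF assms]])
  then have R: "dird (\<lambda>y. lorentz G \<omega> (\<tau> y) (A y \<eta>)) x \<xi> =
      dird (\<lambda>y. lorentz G \<omega> y (A x \<eta>)) (\<tau> x) (A x \<xi>)
        + lorentz G \<omega> (\<tau> x) (dird (\<lambda>y. A y \<eta>) x \<xi>)"
    by (simp only: dird_eqI)
  have eq: "dird (\<lambda>y. A y (lorentz G' \<omega>' y \<eta>)) x = dird (\<lambda>y. lorentz G \<omega> (\<tau> y) (A y \<eta>)) x"
    by (rule dird_cong_open[OF source.open_S assms]) (rule lorentz_pull)
  show ?thesis
    using L[unfolded eq R]
    by (simp add: cov_deriv_endo_def Let_def linear_add[OF A_linear[OF assms]]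
        linear_diff[OF A_linear[OF assms]] christoffel_pull[OF assms] lorentz_pull[OF assms]
        linear_add[OF target.lorentz_linear[OF \<tau>x]] algebra_simps)
qed

lemma Y_tilde_pull:
  assumes "x \<in> S'"
  shows "A x (Y_tilde G' \<omega>' x v w) = Y_tilde G \<omega> (\<tau> x) (A x v) (A x w)"
  by (simp add: Y_tilde_def Let_def linear_diff[OF A_linear[OF assms]] linear_cmul[OF A_linear[OF assms]]
      lorentz_pull assms pull_G)

text \<open>Curvature, covariant derivative and \<open>Y_tilde\<close> all intertwine with
  \<open>A x\<close>, so the traced endomorphisms are conjugate.\<close>

theorem local_magnetic_Ric_pull:
  assumes "x \<in> S'"
  shows "local_magnetic_Ric G' \<omega>' x v = local_magnetic_Ric G \<omega> (\<tau> x) (A x v)"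
proof -
  note \<tau>x = \<tau>_in[OF assms]
  obtain B where B: "linear B" "B \<circ> A x = id"
    using linear_injective_left_inverse[OF A_linear[OF assms] A_inj[OF assms]] by blast
  then have BA: "B (A x w) = w" for w by (metis comp_apply id_apply)
  have "endo_trace (\<lambda>w. curvature G' x w v v) = endo_trace (\<lambda>w. curvature G (\<tau> x) w (A x v) (A x v))"
    by (rule endo_trace_conj[OF A_linear[OF assms] B(1) BA target.curvature_linear[OF \<tau>x]])
      (rule curvature_pull[OF assms])
  moreover have "endo_trace (\<lambda>w. cov_deriv_endo G' (lorentz G' \<omega>') x w v - Y_tilde G' \<omega>' x v w) =
      endo_trace (\<lambda>w. cov_deriv_endo G (lorentz G \<omega>) (\<tau> x) w (A x v) - Y_tilde G \<omega> (\<tau> x) (A x v) w)"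
    by (rule endo_trace_conj[OF A_linear[OF assms] B(1) BA
          linear_compose_sub[OF target.cov_deriv_lorentz_linear[OF \<tau>x] target.Y_tilde_linear[OF \<tau>x]]])
      (simp add: cov_deriv_pull Y_tilde_pull assms linear_diff[OF A_linear])
  ultimately show ?thesis by (simp add: local_magnetic_Ric_def)
qed

end


section \<open>Conformal change of the metric\<close>

lemma bilinear_dird_bilinear_family:
  fixes T :: "'a::real_normed_vector \<Rightarrow> 'c::real_vector \<Rightarrow> 'd::real_vector \<Rightarrow> 'b::real_normed_vector"
  assumes "open S" "x \<in> S" and bil: "\<And>y. y \<in> S \<Longrightarrow> bilinear (T y)"
    and diff: "\<And>\<xi> \<eta>. (\<lambda>y. T y \<xi> \<eta>) differentiable (at x)"
  shows "bilinear (\<lambda>\<zeta> \<eta>. dird (\<lambda>y. T y \<xi> \<eta>) x \<zeta>)" (is ?right)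
    and "bilinear (\<lambda>\<zeta> \<xi>. dird (\<lambda>y. T y \<xi> \<eta>) x \<zeta>)" (is ?left)
    and "bilinear (\<lambda>\<xi> \<eta>. dird (\<lambda>y. T y \<xi> \<eta>) x \<zeta>)" (is ?both)
proof -
  show r: "bilinear (\<lambda>\<zeta> \<eta>. dird (\<lambda>y. T y \<xi> \<eta>) x \<zeta>)" for \<xi>
    by (rule bilinear_dird_linear_family[OF assms(1,2) _ diff]) (use bil in \<open>simp add: bilinear_def\<close>)
  show l: "bilinear (\<lambda>\<zeta> \<xi>. dird (\<lambda>y. T y \<xi> \<eta>) x \<zeta>)" for \<eta>
    by (rule bilinear_dird_linear_family[OF assms(1,2) _ diff]) (use bil in \<open>simp add: bilinear_def\<close>)
  show ?both using r l by (simp add: bilinear_def)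
qed

lemma endo_trace_sum: "endo_trace L = (\<Sum>j\<in>UNIV. L (axis j 1) $ j)"
  by (simp add: trace_def matrix_def)

lemma dird_mult:
  fixes f g :: "'a::real_normed_vector \<Rightarrow> real"
  assumes "f differentiable (at x)" "g differentiable (at x)"
  shows "dird (\<lambda>y. f y * g y) x h = f x * dird g x h + dird f x h * g x"
  by (subst dird_eqI[OF has_derivative_mult[OF has_derivative_dird has_derivative_dird]]) (use assms in auto)

text \<open>The minimum of f(c, 0) over \<open>C\<close> is the tolerance for uniform continuity.
  The second variable ranges over a non-compact space and is confined to the unit ball, hence
  \<open>min d 1\<close>.\<close>

lemma uniformly_positive_near_zero:
  fixes f :: "'a::metric_space \<times> 'b::euclidean_space \<Rightarrow> real"
  assumes C: "compact C" and f: "continuous_on (C \<times> UNIV) f" and pos: "\<And>c. c \<in> C \<Longrightarrow> f (c, 0) > 0"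
  obtains \<delta> where "\<delta> > 0" "\<And>c t. c \<in> C \<Longrightarrow> norm t < \<delta> \<Longrightarrow> f (c, t) > 0"
proof (cases "C = {}")
  case False
  have "continuous_on C (\<lambda>c. f (c, 0))"
    by (rule continuous_on_compose2[OF f]) (auto intro!: continuous_intros)
  then obtain c0 where c0: "c0 \<in> C" "\<And>c. c \<in> C \<Longrightarrow> f (c0, 0) \<le> f (c, 0)"
    using continuous_attains_inf[OF C False] by blast
  have "uniformly_continuous_on (C \<times> cball 0 1) f"
    by (intro compact_uniformly_continuous continuous_on_subset[OF f] compact_Times C) auto
  then obtain d where d: "d > 0"
    "\<And>z z'. z \<in> C \<times> cball 0 1 \<Longrightarrow> z' \<in> C \<times> cball 0 1 \<Longrightarrow> dist z' z < d \<Longrightarrow> dist (f z') (f z) < f (c0, 0)"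
    using pos[OF c0(1)] unfolding uniformly_continuous_on_def by metis
  show ?thesis
  proof
    show "min d 1 > 0" using d by simp
    fix c and t :: 'b assume ct: "c \<in> C" "norm t < min d 1"
    then have "dist (f (c, t)) (f (c, 0)) < f (c0, 0)"
      by (intro d(2)) (auto simp: dist_Pair_Pair)
    then show "f (c, t) > 0" using c0(2)[OF ct(1)] by (simp add: dist_real_def)
  qed
qed (auto intro: that[of 1])

context chart_metric
begin

text \<open>The Christoffel symbols of $e^{2\phi} G$ are $\Gamma + \sum_i \partial_i\phi\, B_i$.\<close>

definition B :: "'n \<Rightarrow> real ^ 'n \<Rightarrow> real ^ 'n \<Rightarrow> real ^ 'n \<Rightarrow> real ^ 'n"
  where "B i x \<xi> \<eta> = \<xi> $ i *\<^sub>R \<eta> + \<eta> $ i *\<^sub>R \<xi> - G x \<xi> \<eta> *\<^sub>R sharp (G x) (\<lambda>w. w $ i)"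

lemma B_bilinear: "x \<in> S \<Longrightarrow> bilinear (B i x)"
  unfolding bilinear_def B_def
  by (auto intro!: linearI simp: algebra_simps bilinear_ladd[OF bil] bilinear_radd[OF bil]
      bilinear_lmul[OF bil] bilinear_rmul[OF bil])

lemma B_smooth: "smooth_on S (\<lambda>x. B i x \<xi> \<eta>)"
  unfolding B_def
  by (intro smooth_on_diff smooth_on_add smooth_on_scaleR smooth smooth_sharp_component smooth_on_const open_S)

lemma B_differentiable: "x \<in> S \<Longrightarrow> (\<lambda>y. B i y \<xi> \<eta>) differentiable (at x)"
  using B_smooth smooth_on_differentiable by blast

text \<open>
  For $\tilde G = F G$ put $a = \sqrt F$, $p_i = \partial_i F / (2a)$ and
  $m_{ij} = \partial_i\partial_j F / 2 - 2 p_i p_j$, so that $\phi = \frac12\log F$ has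
  $a\,\partial_i\phi = p_i$ and $a^2\,\partial_j\partial_i\phi = m_{ij}$. Then $a\tilde\Gamma$ is
  \<open>scaled_christoffel\<close>, and \<open>scaled_curvature\<close> is $a^2\tilde R(w,u)u$; both are polynomial in
  $a$, $p$ and $m$.
\<close>

definition scaled_christoffel :: "real \<Rightarrow> real ^ 'n \<Rightarrow> real ^ 'n \<Rightarrow> real ^ 'n \<Rightarrow> real ^ 'n \<Rightarrow> real ^ 'n"
  where "scaled_christoffel a p x \<xi> \<eta> = a *\<^sub>R \<Gamma> x \<xi> \<eta> + (\<Sum>i\<in>UNIV. p $ i *\<^sub>R B i x \<xi> \<eta>)"

definition scaled_curvature ::
    "real \<Rightarrow> real ^ 'n \<Rightarrow> real ^ 'n ^ 'n \<Rightarrow> real ^ 'n \<Rightarrow> real ^ 'n \<Rightarrow> real ^ 'n \<Rightarrow> real ^ 'n"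
  where "scaled_curvature a p m x w u =
      a\<^sup>2 *\<^sub>R (dird (\<lambda>y. \<Gamma> y u u) x w - dird (\<lambda>y. \<Gamma> y w u) x u)
    + (\<Sum>i\<in>UNIV. (m $ i \<bullet> w) *\<^sub>R B i x u u - (m $ i \<bullet> u) *\<^sub>R B i x w u)
    + a *\<^sub>R (\<Sum>i\<in>UNIV. p $ i *\<^sub>R (dird (\<lambda>y. B i y u u) x w - dird (\<lambda>y. B i y w u) x u))
    + scaled_christoffel a p x w (scaled_christoffel a p x u u)
    - scaled_christoffel a p x u (scaled_christoffel a p x w u)"

end

context chart_magnetic
begin

text \<open>For the metric F G with F = a^2 this is a^3 times the covariant derivative of its
  Lorentz endomorphism Y/F. The term with \<open>2 * (p \<bullet> w)\<close> comes from
  differentiating 1/F.\<close>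

definition scaled_cov_deriv ::
    "real \<Rightarrow> real ^ 'n \<Rightarrow> real ^ 'n \<Rightarrow> real ^ 'n \<Rightarrow> real ^ 'n \<Rightarrow> real ^ 'n"
  where "scaled_cov_deriv a p x w u =
      a *\<^sub>R dird (\<lambda>y. Y y u) x w - (2 * (p \<bullet> w)) *\<^sub>R Y x u
    + scaled_christoffel a p x w (Y x u) - Y x (scaled_christoffel a p x w u)"

text \<open>This is a^4 times the magnetic Ricci curvature of F G at u/a. \<open>Y_tilde\<close>
  appears for the original metric and without any factor, which is why it survives at a = 0.\<close>

definition scaled_magnetic_Ric ::
    "real \<Rightarrow> real ^ 'n \<Rightarrow> real ^ 'n ^ 'n \<Rightarrow> real ^ 'n \<Rightarrow> real ^ 'n \<Rightarrow> real"
  where "scaled_magnetic_Ric a p m x u =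
      endo_trace (\<lambda>w. scaled_curvature a p m x w u)
    - endo_trace (\<lambda>w. scaled_cov_deriv a p x w u - Y_tilde G \<omega> x u w)"

end

locale conformal_change = chart_magnetic S G \<omega>
  for S :: "(real ^ 'n::finite) set" and G \<omega> +
  fixes F :: "real ^ 'n \<Rightarrow> real"
  assumes F_smooth: "smooth_on S F" and F_pos: "x \<in> S \<Longrightarrow> F x > 0"
begin

abbreviation "FG \<equiv> \<lambda>y \<xi> \<eta>. F y * G y \<xi> \<eta>"

lemma FG_inner: "x \<in> S \<Longrightarrow> inner_form (FG x)"
  using inner[of x] F_pos[of x]
  by (auto simp: inner_form_def bilinear_def linear_iff algebra_simps)

sublocale conf: chart_magnetic S FG \<omega>
proof
  show "smooth_on S (\<lambda>x. F x * G x \<xi> \<eta>)" for \<xi> \<eta>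
    by (rule smooth_on_mult[OF open_S F_smooth smooth])
qed (auto simp: open_S FG_inner \<omega>_bilinear \<omega>_smooth intro: \<omega>_skew)

lemma F_differentiable: "x \<in> S \<Longrightarrow> F differentiable (at x)"
  using F_smooth smooth_on_differentiable by blast

lemma dF_expand: "x \<in> S \<Longrightarrow> dird F x \<xi> = (\<Sum>i\<in>UNIV. dird F x (axis i 1) * \<xi> $ i)"
  using linear_expand[OF linear_dird[OF F_differentiable], of x \<xi>] by (simp add: mult.commute)

text \<open>The partial derivatives of (1/2) log F as functions on \<open>S\<close>. These are what
  gets differentiated; \<open>p\<close> and \<open>m\<close> below are values at one point.\<close>

definition q :: "'n \<Rightarrow> real ^ 'n \<Rightarrow> real"
  where "q i x = dird F x (axis i 1) / (2 * F x)"

lemma koszul_conformal: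
  assumes "x \<in> S"
  shows "koszul FG x \<xi> \<eta> \<zeta> = F x * koszul G x \<xi> \<eta> \<zeta>
    + dird F x \<xi> * G x \<eta> \<zeta> + dird F x \<eta> * G x \<xi> \<zeta> - dird F x \<zeta> * G x \<xi> \<eta>"
  by (simp add: koszul_def dird_mult F_differentiable differentiable assms algebra_simps)

text \<open>Multiplying by \<open>2 * F x\<close> turns \<open>q i x\<close> into a partial
  derivative of \<open>F\<close>, and pairing the sharp vector in \<open>B\<close> with
  \<open>\<zeta>\<close> gives \<open>\<zeta> $ i\<close>. The sum over \<open>i\<close> then
  reproduces the three extra terms of \<open>koszul_conformal\<close>.\<close>

lemma christoffel_conformal:
  assumes "x \<in> S"
  shows "christoffel FG x \<xi> \<eta> = \<Gamma> x \<xi> \<eta> + (\<Sum>i\<in>UNIV. q i x *\<^sub>R B i x \<xi> \<eta>)"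
proof (rule conf.christoffel_eqI[OF assms])
  fix \<zeta>
  note lin = linear_left[OF assms, of \<zeta>]
  have "2 * F x * G x (\<Sum>i\<in>UNIV. q i x *\<^sub>R B i x \<xi> \<eta>) \<zeta> =
      (\<Sum>i\<in>UNIV. (2 * F x * q i x) * G x (B i x \<xi> \<eta>) \<zeta>)"
    by (simp add: linear_sum[OF lin] linear_cmul[OF lin] sum_distrib_left mult_ac)
  also have "\<dots> = (\<Sum>i\<in>UNIV. dird F x (axis i 1) *
      (\<xi> $ i * G x \<eta> \<zeta> + \<eta> $ i * G x \<xi> \<zeta> - G x \<xi> \<eta> * \<zeta> $ i))"
    using F_pos[OF assms]
    by (simp add: q_def B_def linear_add[OF lin] linear_diff[OF lin] linear_cmul[OF lin]
        sharp_works[OF inner[OF assms] linear_component])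
  also have "\<dots> = dird F x \<xi> * G x \<eta> \<zeta> + dird F x \<eta> * G x \<xi> \<zeta> - dird F x \<zeta> * G x \<xi> \<eta>"
    by (simp add: dF_expand[OF assms, of \<xi>] dF_expand[OF assms, of \<eta>] dF_expand[OF assms, of \<zeta>]
        sum_distrib_left sum_distrib_right sum.distrib sum_subtractf algebra_simps)
  finally show "2 * (F x * G x (\<Gamma> x \<xi> \<eta> + (\<Sum>i\<in>UNIV. q i x *\<^sub>R B i x \<xi> \<eta>)) \<zeta>) = koszul FG x \<xi> \<eta> \<zeta>"
    using christoffel_works[OF assms, of \<xi> \<eta> \<zeta>]
    by (simp add: koszul_conformal[OF assms] linear_add[OF lin] algebra_simps)
qed

lemma lorentz_conformal: "x \<in> S \<Longrightarrow> lorentz FG \<omega> x v = (1 / F x) *\<^sub>R Y x v"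
  using F_pos[of x]
  by (intro conf.lorentz_eqI) (auto simp: linear_cmul[OF linear_left] lorentz_works)

lemma q_smooth: "smooth_on S (q i)"
  unfolding q_def using F_pos
  by (intro smooth_on_divide smooth_on_mult smooth_on_const smooth_on_dird F_smooth open_S) force

lemma q_differentiable: "x \<in> S \<Longrightarrow> q i differentiable (at x)"
  using q_smooth smooth_on_differentiable by blast

lemma dird_christoffel_conformal:
  assumes "x \<in> S"
  shows "dird (\<lambda>y. christoffel FG y \<xi> \<eta>) x h = dird (\<lambda>y. \<Gamma> y \<xi> \<eta>) x h
    + (\<Sum>i\<in>UNIV. q i x *\<^sub>R dird (\<lambda>y. B i y \<xi> \<eta>) x h + dird (q i) x h *\<^sub>R B i x \<xi> \<eta>)"
proof -
  have "dird (\<lambda>y. christoffel FG y \<xi> \<eta>) x = dird (\<lambda>y. \<Gamma> y \<xi> \<eta> + (\<Sum>i\<in>UNIV. q i y *\<^sub>R B i y \<xi> \<eta>)) x"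
    by (rule dird_cong_open[OF open_S assms]) (rule christoffel_conformal)
  also have "\<dots> = (\<lambda>h. dird (\<lambda>y. \<Gamma> y \<xi> \<eta>) x h
    + (\<Sum>i\<in>UNIV. q i x *\<^sub>R dird (\<lambda>y. B i y \<xi> \<eta>) x h + dird (q i) x h *\<^sub>R B i x \<xi> \<eta>))"
    by (rule dird_eqI) (intro has_derivative_add has_derivative_sum has_derivative_scaleR has_derivative_dird
        christoffel_differentiable B_differentiable q_differentiable assms)
  finally show ?thesis by simp
qed

section \<open>The conformal metric at one point, in the variables \<open>a\<close>,
  \<open>p\<close>, \<open>m\<close>\<close>

context
  fixes x a p m
  assumes x: "x \<in> S"
  defines "a \<equiv> sqrt (F x)"
    and "p \<equiv> (\<chi> i. dird F x (axis i 1) / (2 * a))"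
    and "m \<equiv> (\<chi> i j. dird (\<lambda>y. dird F y (axis i 1)) x (axis j 1) / 2 - 2 * p $ i * p $ j)"
begin

lemma a: "a > 0" "a\<^sup>2 = F x"
  using F_pos[OF x] by (auto simp: a_def)

lemma q_p: "a * q i x = p $ i"
  using a by (simp add: q_def p_def flip: a(2)) (simp add: power2_eq_square)

lemma dF_p: "dird F x h = 2 * a * (p \<bullet> h)"
  using a(1) by (simp add: dF_expand[OF x, of h] p_def inner_vec_def sum_distrib_left)

text \<open>The quotient rule is where the correction \<open>- 2 * p $ i * p $ j\<close> in
  \<open>m\<close> comes from: it is the term with dF twice over F^2, rewritten by
  \<open>dF_p\<close>.\<close>

lemma dq_m: "a\<^sup>2 * dird (q i) x h = m $ i \<bullet> h"
proof -
  let ?d = "\<lambda>y. dird F y (axis i 1)"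
  have d: "?d differentiable (at x)"
    using smooth_on_differentiable[OF smooth_on_dird[OF F_smooth] x] .
  have "((\<lambda>y. ?d y / (2 * F y)) has_derivative
     (\<lambda>h. (dird ?d x h * (2 * F x) - ?d x * (2 * dird F x h)) / ((2 * F x) * (2 * F x)))) (at x)"
    using F_pos[OF x]
    by (intro has_derivative_divide' has_derivative_mult_right has_derivative_dird d F_differentiable x) auto
  then have "dird (q i) x h = (dird ?d x h * (2 * F x) - ?d x * (2 * dird F x h)) / ((2 * F x) * (2 * F x))"
    unfolding q_def by (simp only: dird_eqI)
  also have "\<dots> = (dird ?d x h * (2 * a\<^sup>2) - (2 * a * p $ i) * (2 * (2 * a * (p \<bullet> h)))) / ((2 * a\<^sup>2) * (2 * a\<^sup>2))"
    using a(1) by (simp add: a(2) dF_p[symmetric]) (simp add: p_def)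
  also have "a\<^sup>2 * \<dots> = dird ?d x h / 2 - 2 * p $ i * (p \<bullet> h)"
    using a(1) by (simp add: power2_eq_square field_simps)
  also have "dird ?d x h = (\<Sum>j\<in>UNIV. dird ?d x (axis j 1) * h $ j)"
    using linear_expand[OF linear_dird[OF d], of h] by (simp add: mult.commute)
  also have "\<dots> / 2 - 2 * p $ i * (p \<bullet> h) = m $ i \<bullet> h"
    by (simp add: m_def inner_vec_def sum_subtractf sum_distrib_left sum_divide_distrib algebra_simps)
  finally show ?thesis .
qed

lemma scaled_christoffel_conformal: "scaled_christoffel a p x \<xi> \<eta> = a *\<^sub>R christoffel FG x \<xi> \<eta>"
  by (simp add: scaled_christoffel_def christoffel_conformal[OF x] scaleR_add_right scaleR_sum_right flip: q_p)

text \<open>The factor a^2 splits as a times a on products of two Christoffel symbols, becomes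
  \<open>a * p\<close> on undifferentiated \<open>q\<close>, and is absorbed into \<open>m\<close>
  on differentiated \<open>q\<close>.\<close>

lemma scaled_curvature_conformal: "scaled_curvature a p m x w u = a\<^sup>2 *\<^sub>R curvature FG x w u u"
proof -
  have D: "a\<^sup>2 *\<^sub>R dird (\<lambda>y. christoffel FG y \<xi> \<eta>) x h = a\<^sup>2 *\<^sub>R dird (\<lambda>y. \<Gamma> y \<xi> \<eta>) x h
    + a *\<^sub>R (\<Sum>i\<in>UNIV. p $ i *\<^sub>R dird (\<lambda>y. B i y \<xi> \<eta>) x h) + (\<Sum>i\<in>UNIV. (m $ i \<bullet> h) *\<^sub>R B i x \<xi> \<eta>)" for \<xi> \<eta> h
    by (simp add: dird_christoffel_conformal[OF x] scaleR_add_right scaleR_sum_right sum.distrib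
        power2_eq_square mult_ac flip: q_p dq_m)
  have "a\<^sup>2 *\<^sub>R curvature FG x w u u =
     a\<^sup>2 *\<^sub>R dird (\<lambda>y. christoffel FG y u u) x w - a\<^sup>2 *\<^sub>R dird (\<lambda>y. christoffel FG y w u) x u
     + (scaled_christoffel a p x w (scaled_christoffel a p x u u)
     - scaled_christoffel a p x u (scaled_christoffel a p x w u))"
    by (simp add: curvature_def Let_def scaled_christoffel_conformal power2_eq_square
        bilinear_rmul[OF conf.christoffel_bilinear[OF x]] algebra_simps)
  then show ?thesis
    unfolding D scaled_curvature_def
    by (simp add: sum_subtractf algebra_simps)
qed

lemma scaled_cov_deriv_conformal:
  "scaled_cov_deriv a p x w u = a ^ 3 *\<^sub>R cov_deriv_endo FG (lorentz FG \<omega>) x w u"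
proof -
  have "dird (\<lambda>y. lorentz FG \<omega> y u) x = dird (\<lambda>y. (1 / F y) *\<^sub>R Y y u) x"
    by (rule dird_cong_open[OF open_S x]) (rule lorentz_conformal)
  also have "\<dots> = (\<lambda>h. (1 / F x) *\<^sub>R dird (\<lambda>y. Y y u) x h + (- dird F x h / (F x)\<^sup>2) *\<^sub>R Y x u)"
  proof (rule dird_eqI, rule has_derivative_scaleR)
    show "((\<lambda>y. 1 / F y) has_derivative (\<lambda>h. - dird F x h / (F x)\<^sup>2)) (at x)"
      using F_pos[OF x] has_derivative_dird[OF F_differentiable[OF x]]
      by (auto intro!: derivative_eq_intros simp: power2_eq_square)
  qed (rule has_derivative_dird[OF lorentz_differentiable[OF x]])
  finally have "a ^ 3 *\<^sub>R dird (\<lambda>y. lorentz FG \<omega> y u) x w =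
     a *\<^sub>R dird (\<lambda>y. Y y u) x w - (2 * (p \<bullet> w)) *\<^sub>R Y x u"
    using a(1) by (simp add: dF_p flip: a(2)) (simp add: algebra_simps power2_eq_square power3_eq_cube power4_eq_xxxx)
  then show ?thesis
    using a(1)
    by (simp add: cov_deriv_endo_def Let_def scaled_cov_deriv_def scaled_christoffel_conformal
        lorentz_conformal[OF x] bilinear_rmul[OF conf.christoffel_bilinear[OF x]]
        linear_cmul[OF lorentz_linear[OF x]] scaleR_add_right scaleR_diff_right flip: a(2))
     (simp add: power2_eq_square power3_eq_cube)
qed

text \<open>Count of powers: curvature has a^2 from scaling and a^2 from being quadratic in the
  vector, the covariant derivative has a^3 and one more from linearity. In \<open>Y_tilde\<close>
  the factors 1/F in the Lorentz endomorphisms give a^4 in both summands.\<close>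

lemma local_magnetic_Ric_conformal:
  "scaled_magnetic_Ric a p m x (a *\<^sub>R v) = a ^ 4 * local_magnetic_Ric FG \<omega> x v"
proof -
  have R: "scaled_curvature a p m x w (a *\<^sub>R v) = a ^ 4 *\<^sub>R curvature FG x w v v" for w
    using bilinear_rmul[OF bilinear_dird_bilinear_family(1)[OF open_S x conf.christoffel_bilinear
          conf.christoffel_differentiable[OF x]]]
      bilinear_rmul[OF bilinear_dird_bilinear_family(2)[OF open_S x conf.christoffel_bilinear
          conf.christoffel_differentiable[OF x]]]
      bilinear_lmul[OF bilinear_dird_bilinear_family(1)[OF open_S x conf.christoffel_bilinear
          conf.christoffel_differentiable[OF x]]]
    by (simp add: scaled_curvature_conformal curvature_def Let_def
        bilinear_rmul[OF conf.christoffel_bilinear[OF x]] bilinear_lmul[OF conf.christoffel_bilinear[OF x]]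
        scaleR_add_right scaleR_diff_right power2_eq_square power4_eq_xxxx mult_ac)
  have N: "scaled_cov_deriv a p x w (a *\<^sub>R v) = a ^ 4 *\<^sub>R cov_deriv_endo FG (lorentz FG \<omega>) x w v" for w
    using bilinear_rmul[OF conf.bilinear_dird_lorentz[OF x]]
    by (simp add: scaled_cov_deriv_conformal cov_deriv_endo_def Let_def
        bilinear_rmul[OF conf.christoffel_bilinear[OF x]]
        linear_cmul[OF conf.lorentz_linear[OF x]]
        scaleR_add_right scaleR_diff_right power3_eq_cube power4_eq_xxxx mult_ac)
  have T: "Y_tilde G \<omega> x (a *\<^sub>R v) w = a ^ 4 *\<^sub>R Y_tilde FG \<omega> x v w" for w
    using a(1)
    by (simp add: Y_tilde_def Let_def lorentz_conformal[OF x] linear_cmul[OF lorentz_linear[OF x]]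
        linear_cmul[OF linear_right[OF x]] scaleR_diff_right flip: a(2))
      (simp add: power2_eq_square power4_eq_xxxx)
  show ?thesis
    unfolding scaled_magnetic_Ric_def local_magnetic_Ric_def R N T endo_trace_sum
    by (simp add: sum_distrib_left right_diff_distrib sum_subtractf)
qed

end

end


section \<open>Positivity for small conformal factors\<close>

lemma continuous_on_dird_bilinear_family:
  fixes T :: "real ^ 'n::finite \<Rightarrow> real ^ 'n \<Rightarrow> real ^ 'n \<Rightarrow> real ^ 'n"
  assumes "open S" and bil: "\<And>y. y \<in> S \<Longrightarrow> bilinear (T y)" and smooth: "\<And>\<xi> \<eta>. smooth_on S (\<lambda>y. T y \<xi> \<eta>)"
    and \<tau>: "continuous_on X \<tau>" "\<tau> ` X \<subseteq> S" and "continuous_on X \<xi>" "continuous_on X \<eta>"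
  shows "continuous_on X (\<lambda>z. dird (\<lambda>y. T y (\<xi> z) (\<eta> z)) (\<tau> z) w)"
    and "continuous_on X (\<lambda>z. dird (\<lambda>y. T y w (\<eta> z)) (\<tau> z) (\<xi> z))"
proof -
  note b = bilinear_dird_bilinear_family[OF assms(1) _ bil smooth_on_differentiable[OF smooth]]
  note c = smooth_on_continuous_on[OF smooth_on_dird[OF smooth]]
  show "continuous_on X (\<lambda>z. dird (\<lambda>y. T y (\<xi> z) (\<eta> z)) (\<tau> z) w)"
    by (rule continuous_on_bilinear_family[where T = "\<lambda>x \<xi> \<eta>. dird (\<lambda>y. T y \<xi> \<eta>) x w", OF b(3) c]) (use assms in auto)
  show "continuous_on X (\<lambda>z. dird (\<lambda>y. T y w (\<eta> z)) (\<tau> z) (\<xi> z))"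
    by (rule continuous_on_bilinear_family[where T = "\<lambda>x \<xi> \<eta>. dird (\<lambda>y. T y w \<eta>) x \<xi>", OF b(1) c]) (use assms in auto)
qed

lemma norm_vec_le_sum: "norm x \<le> (\<Sum>i\<in>UNIV. norm (x $ i))"
  unfolding norm_vec_def by (rule L2_set_le_sum) simp

context chart_magnetic
begin

context
  fixes X :: "'c::topological_space set" and \<tau> :: "'c \<Rightarrow> real ^ 'n"
  assumes \<tau>: "continuous_on X \<tau>" "\<tau> ` X \<subseteq> S"
begin

lemma continuous_on_scaled_christoffel [continuous_intros]:
  assumes "continuous_on X a" "continuous_on X p" "continuous_on X \<xi>" "continuous_on X \<eta>"
  shows "continuous_on X (\<lambda>z. scaled_christoffel (a z) (p z) (\<tau> z) (\<xi> z) (\<eta> z))"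
proof -
  have "continuous_on X (\<lambda>z. \<Gamma> (\<tau> z) (\<xi> z) (\<eta> z))"
    by (rule continuous_on_bilinear_family[OF christoffel_bilinear smooth_on_continuous_on[OF christoffel_smooth] \<tau> assms(3,4)])
  moreover have "continuous_on X (\<lambda>z. B i (\<tau> z) (\<xi> z) (\<eta> z))" for i
    by (rule continuous_on_bilinear_family[OF B_bilinear smooth_on_continuous_on[OF B_smooth] \<tau> assms(3,4)])
  ultimately show ?thesis
    unfolding scaled_christoffel_def by (intro continuous_intros assms)
qed

lemma continuous_on_lorentz [continuous_intros]:
  "continuous_on X \<xi> \<Longrightarrow> continuous_on X (\<lambda>z. Y (\<tau> z) (\<xi> z))"
  by (rule continuous_on_linear_family[OF lorentz_linear smooth_on_continuous_on[OF lorentz_smooth] \<tau>])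

lemma continuous_on_metric [continuous_intros]:
  "continuous_on X \<xi> \<Longrightarrow> continuous_on X \<eta> \<Longrightarrow> continuous_on X (\<lambda>z. G (\<tau> z) (\<xi> z) (\<eta> z))"
  by (rule continuous_on_bilinear_family[OF bil smooth_on_continuous_on[OF smooth] \<tau>])

lemma continuous_on_scaled_magnetic_Ric:
  assumes "continuous_on X a" "continuous_on X p" "continuous_on X m" "continuous_on X u"
  shows "continuous_on X (\<lambda>z. scaled_magnetic_Ric (a z) (p z) (m z) (\<tau> z) (u z))"
proof -
  \<comment> \<open>The traces are written as sums over the standard basis, so \<open>w\<close>
    stays constant while the point and \<open>u\<close> vary.\<close>
  have [continuous_intros]: "continuous_on X (\<lambda>z. dird (\<lambda>y. \<Gamma> y (u z) (u z)) (\<tau> z) w)" for w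
    by (rule continuous_on_dird_bilinear_family(1)[OF open_S christoffel_bilinear christoffel_smooth \<tau> assms(4,4)])
  have [continuous_intros]: "continuous_on X (\<lambda>z. dird (\<lambda>y. \<Gamma> y w (u z)) (\<tau> z) (u z))" for w
    by (rule continuous_on_dird_bilinear_family(2)[OF open_S christoffel_bilinear christoffel_smooth \<tau> assms(4,4)])
  have [continuous_intros]: "continuous_on X (\<lambda>z. dird (\<lambda>y. B i y (u z) (u z)) (\<tau> z) w)" for i w
    by (rule continuous_on_dird_bilinear_family(1)[OF open_S B_bilinear B_smooth \<tau> assms(4,4)])
  have [continuous_intros]: "continuous_on X (\<lambda>z. dird (\<lambda>y. B i y w (u z)) (\<tau> z) (u z))" for i w
    by (rule continuous_on_dird_bilinear_family(2)[OF open_S B_bilinear B_smooth \<tau> assms(4,4)])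
  have [continuous_intros]: "continuous_on X (\<lambda>z. B i (\<tau> z) (\<xi> z) (\<eta> z))"
    if "continuous_on X \<xi>" "continuous_on X \<eta>" for i \<xi> \<eta>
    by (rule continuous_on_bilinear_family[OF B_bilinear smooth_on_continuous_on[OF B_smooth] \<tau> that])
  have [continuous_intros]: "continuous_on X (\<lambda>z. dird (\<lambda>y. Y y (u z)) (\<tau> z) w)" for w
  proof (rule continuous_on_linear_family[where T = "\<lambda>x \<eta>. dird (\<lambda>y. Y y \<eta>) x w", OF _ _ \<tau> assms(4)])
    show "linear (\<lambda>\<eta>. dird (\<lambda>y. Y y \<eta>) x w)" if "x \<in> S" for x
      using bilinear_dird_lorentz[OF that] by (simp add: bilinear_def)
    show "continuous_on S (\<lambda>x. dird (\<lambda>y. Y y \<eta>) x w)" for \<eta>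
      by (rule smooth_on_continuous_on[OF smooth_on_dird[OF lorentz_smooth]])
  qed
  show ?thesis
    unfolding scaled_magnetic_Ric_def endo_trace_sum scaled_curvature_def scaled_cov_deriv_def
      Y_tilde_def Let_def
    by (intro continuous_intros assms)
qed

end

text \<open>The rank-one part w -> g(w,z) z has trace g(z,z), which may be 0. Strict positivity
  comes from the square of the Lorentz endomorphism, so it holds for every \<open>u\<close>.\<close>

lemma endo_trace_Y_tilde_pos:
  assumes "x \<in> S" "\<omega> x v w \<noteq> 0"
  shows "endo_trace (Y_tilde G \<omega> x u) > 0"
proof -
  let ?z = "Y x u"
  have "endo_trace (Y_tilde G \<omega> x u) =
      3 / 4 * (\<Sum>j\<in>UNIV. ?z $ j * G x (axis j 1) ?z) - 1 / 4 * endo_trace (\<lambda>w. Y x (Y x w))"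
    by (simp add: endo_trace_sum Y_tilde_def Let_def sum_subtractf sum_distrib_left mult_ac)
  also have "(\<Sum>j\<in>UNIV. ?z $ j * G x (axis j 1) ?z) = G x ?z ?z"
    using linear_expand[OF linear_left[OF assms(1)], of ?z ?z] by simp
  moreover have "G x ?z ?z \<ge> 0"
    using pos[OF assms(1), of ?z] by (cases "?z = 0") (auto simp: bilinear_lzero[OF bil[OF assms(1)]])
  ultimately show ?thesis using trace_lorentz_square_neg[OF assms] by linarith
qed

lemma scaled_magnetic_Ric_zero:
  "x \<in> S \<Longrightarrow> scaled_magnetic_Ric 0 0 0 x u = endo_trace (Y_tilde G \<omega> x u)"
  by (simp add: scaled_magnetic_Ric_def scaled_curvature_def scaled_cov_deriv_def scaled_christoffel_def
      linear_0[OF lorentz_linear] endo_trace_sum sum_negf)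

text \<open>The threshold precedes \<open>F\<close> in the quantifiers, so it serves all potentials
  and energies at once. The bound on the squared first derivatives says that \<open>p\<close> is
  small, and the last premise says that \<open>v\<close> is a unit vector for F G.\<close>

theorem local_magnetic_Ric_conformal_pos:
  assumes K: "compact K" "K \<subseteq> S" and nonzero: "\<forall>x\<in>K. \<exists>v w. \<omega> x v w \<noteq> 0"
  shows "\<exists>\<delta>>0. \<forall>F x v. smooth_on S F \<longrightarrow> (\<forall>y\<in>S. F y > 0) \<longrightarrow> x \<in> K \<longrightarrow> F x \<le> \<delta> \<longrightarrow>
      (\<forall>i. (dird F x (axis i 1))\<^sup>2 \<le> \<delta> * F x) \<longrightarrow>
      (\<forall>i j. \<bar>dird (\<lambda>y. dird F y (axis i 1)) x (axis j 1)\<bar> \<le> \<delta>) \<longrightarrow>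
      F x * G x v v = 1 \<longrightarrow> local_magnetic_Ric (\<lambda>y \<xi> \<eta>. F y * G y \<xi> \<eta>) \<omega> x v > 0"
proof -
  \<comment> \<open>Directions are taken from the Euclidean unit sphere, which does not vary with
    the point, so that the parameter set is a compact product; the normalisation to G-length 1
    happens inside \<open>f\<close>.\<close>
  define f :: "((real ^ 'n) \<times> (real ^ 'n)) \<times> (real \<times> (real ^ 'n) \<times> (real ^ 'n ^ 'n)) \<Rightarrow> real"
    where "f = (\<lambda>z. scaled_magnetic_Ric (fst (snd z)) (fst (snd (snd z))) (snd (snd (snd z))) (fst (fst z))
      ((1 / sqrt (G (fst (fst z)) (snd (fst z)) (snd (fst z)))) *\<^sub>R snd (fst z)))"
  let ?C = "K \<times> sphere (0 :: real ^ 'n) 1"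
  have "continuous_on (?C \<times> UNIV) f"
    unfolding f_def
  proof (rule continuous_on_scaled_magnetic_Ric)
    have 1: "continuous_on (?C \<times> UNIV) (\<lambda>z. G (fst (fst z)) (snd (fst z)) (snd (fst z)))"
      by (rule continuous_on_metric) (use K(2) in \<open>auto intro!: continuous_intros\<close>)
    have 2: "G x e e > 0" if "x \<in> K" "norm e = 1" for x e
      using pos[of x e] K(2) that by (metis norm_zero subsetD zero_neq_one)
    show "continuous_on (?C \<times> UNIV)
      (\<lambda>z. (1 / sqrt (G (fst (fst z)) (snd (fst z)) (snd (fst z)))) *\<^sub>R snd (fst z))"
      by (intro continuous_intros 1) (auto dest!: 2)
  qed (use K(2) in \<open>auto intro!: continuous_intros\<close>)
  moreover have "f (c, 0) > 0" if "c \<in> ?C" for c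
  proof -
    obtain x e where c: "c = (x, e)" "x \<in> K" using \<open>c \<in> ?C\<close> by blast
    then obtain v w where vw: "\<omega> x v w \<noteq> 0" using nonzero by blast
    have x: "x \<in> S" using c(2) K(2) by blast
    show ?thesis
      using endo_trace_Y_tilde_pos[OF x vw]
      by (simp add: f_def c(1) scaled_magnetic_Ric_zero[OF x] zero_prod_def)
  qed
  ultimately obtain d where d: "d > 0" "\<And>c t. c \<in> ?C \<Longrightarrow> norm t < d \<Longrightarrow> f (c, t) > 0"
    using uniformly_positive_near_zero[of ?C f] K(1) compact_Times[OF K(1) compact_sphere] by metis
  define N where "N = real CARD('n)"
  have N: "N > 0" by (simp add: N_def)
  \<comment> \<open>Below a, |p|, |m| are bounded by r, N r, N^2 r, so the triple stays within
    distance \<open>d\<close> of 0; the factor 2 makes this strict. The bound by 1 gives r^2 <=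
    r.\<close>
  define r where "r = min 1 (d / (2 * (1 + N + N * N)))"
  have pN: "1 + N + N * N > 0" using N by (simp add: add_pos_pos)
  have r: "r > 0" "r \<le> 1" "r * (1 + N + N * N) < d"
  proof -
    show "r > 0" "r \<le> 1" using d(1) pN by (simp_all add: r_def)
    have "r * (1 + N + N * N) \<le> d / (2 * (1 + N + N * N)) * (1 + N + N * N)"
      using pN by (intro mult_right_mono) (auto simp: r_def)
    also have "\<dots> = d / 2" using pN by (simp add: field_simps)
    finally show "r * (1 + N + N * N) < d" using d(1) by linarith
  qed
  show ?thesis
  \<comment> \<open>The threshold is a square because \<open>F x\<close> is a^2 and the squared
    partial derivatives are 4 a^2 p_i^2.\<close>
  proof (intro exI[of _ "r\<^sup>2"] conjI allI impI)
    show "r\<^sup>2 > 0" using r by simp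
    fix F x v
    assume "smooth_on S F" "\<forall>y\<in>S. F y > 0" and xK: "x \<in> K" and F0: "F x \<le> r\<^sup>2"
      and "\<forall>i. (dird F x (axis i 1))\<^sup>2 \<le> r\<^sup>2 * F x"
      and "\<forall>i j. \<bar>dird (\<lambda>y. dird F y (axis i 1)) x (axis j 1)\<bar> \<le> r\<^sup>2"
      and v: "F x * G x v v = 1"
    then have F: "smooth_on S F" "\<And>y. y \<in> S \<Longrightarrow> F y > 0"
      and F1: "\<And>i. (dird F x (axis i 1))\<^sup>2 \<le> r\<^sup>2 * F x"
      and F2: "\<And>i j. \<bar>dird (\<lambda>y. dird F y (axis i 1)) x (axis j 1)\<bar> \<le> r\<^sup>2" by blast+
    have x: "x \<in> S" using xK K by blast
    interpret conformal_change S G \<omega> F by unfold_locales (use F in auto)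
    define a where "a = sqrt (F x)"
    define p where "p = (\<chi> i. dird F x (axis i 1) / (2 * a))"
    define m where "m = (\<chi> i j. dird (\<lambda>y. dird F y (axis i 1)) x (axis j 1) / 2 - 2 * p $ i * p $ j)"
    have a: "a > 0" "a\<^sup>2 = F x" using F(2)[OF x] by (auto simp: a_def)
    define u where "u = a *\<^sub>R v"
    have Gu: "G x u u = 1"
      using v by (simp add: u_def bilinear_lmul[OF bil[OF x]] bilinear_rmul[OF bil[OF x]] power2_eq_square mult_ac flip: a(2))
    then have "u \<noteq> 0" by (auto simp: bilinear_lzero[OF bil[OF x]])
    \<comment> \<open>Undoes the parametrisation of \<open>f\<close>: since \<open>u\<close> has
      G-length 1, renormalising its Euclidean direction gives back \<open>u\<close>.\<close>
    define e where "e = (1 / norm u) *\<^sub>R u"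
    have e: "norm e = 1" "(1 / sqrt (G x e e)) *\<^sub>R e = u"
      using \<open>u \<noteq> 0\<close> Gu
      by (simp_all add: e_def bilinear_lmul[OF bil[OF x]] bilinear_rmul[OF bil[OF x]] real_sqrt_divide)
    have ar: "a \<le> r" using F0 r(1) unfolding a_def by (simp add: real_le_lsqrt)
    have pr: "\<bar>p $ i\<bar> \<le> r / 2" for i
    proof -
      have "\<bar>dird F x (axis i 1)\<bar> \<le> r * a"
      proof (rule power2_le_imp_le)
        show "\<bar>dird F x (axis i 1)\<bar>\<^sup>2 \<le> (r * a)\<^sup>2"
          using F1[of i] by (simp only: power_mult_distrib a(2) power2_abs)
      qed (use r(1) a(1) in simp)
      then have "\<bar>dird F x (axis i 1)\<bar> / (2 * a) \<le> r * a / (2 * a)"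
        using a(1) by (intro divide_right_mono) auto
      then show ?thesis using a(1) by (simp add: p_def abs_divide abs_mult)
    qed
    \<comment> \<open>The two contributions are r^2/2 from the second derivative and 2 (r/2)^2 from
      the product of the \<open>p\<close>.\<close>
    have mr: "\<bar>m $ i $ j\<bar> \<le> r" for i j
    proof -
      have "\<bar>p $ i * p $ j\<bar> \<le> r / 2 * (r / 2)"
        unfolding abs_mult using pr r(1) by (intro mult_mono) auto
      moreover have "m $ i $ j = dird (\<lambda>y. dird F y (axis i 1)) x (axis j 1) / 2 - 2 * (p $ i * p $ j)"
        by (simp add: m_def)
      moreover have "\<bar>dird (\<lambda>y. dird F y (axis i 1)) x (axis j 1)\<bar> \<le> r * r"
        using F2[of i j] by (simp add: power2_eq_square)
      ultimately have "\<bar>m $ i $ j\<bar> \<le> r * r" by (simp add: field_simps)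
      also have "\<dots> \<le> r * 1" using r by (intro mult_left_mono) auto
      finally show ?thesis by simp
    qed
    have "norm p \<le> (\<Sum>i\<in>UNIV. norm (p $ i))" by (rule norm_vec_le_sum)
    also have "\<dots> \<le> (\<Sum>i\<in>(UNIV :: 'n set). r)"
      using pr r(1) by (intro sum_mono) (smt (verit) real_norm_def field_sum_of_halves)
    finally have np: "norm p \<le> N * r" by (simp add: N_def)
    have "norm m \<le> (\<Sum>i\<in>UNIV. norm (m $ i))" by (rule norm_vec_le_sum)
    also have "\<dots> \<le> (\<Sum>i\<in>(UNIV :: 'n set). \<Sum>j\<in>(UNIV :: 'n set). r)"
      using mr by (intro sum_mono order_trans[OF norm_vec_le_sum]) simp
    finally have nm: "norm m \<le> N * N * r" by (simp add: N_def)
    have "norm (a, p, m) \<le> norm a + (norm p + norm m)"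
      by (rule order_trans[OF norm_Pair_le]) (intro add_left_mono norm_Pair_le)
    also have "\<dots> \<le> r * (1 + N + N * N)"
      using ar np nm a(1) by (simp add: algebra_simps)
    finally have "f ((x, e), (a, p, m)) > 0"
      using r(3) xK e(1) by (intro d(2)) auto
    then have "scaled_magnetic_Ric a p m x (a *\<^sub>R v) > 0"
      using e(2) by (simp add: f_def u_def)
    then have "a ^ 4 * local_magnetic_Ric FG \<omega> x v > 0"
      using local_magnetic_Ric_conformal[OF x, of v]
      by (simp add: a_def p_def m_def)
    then show "local_magnetic_Ric FG \<omega> x v > 0"
      using a(1) by (simp add: zero_less_mult_iff)
  qed
qed

end


section \<open>Coordinate representations on a manifold\<close>

text \<open>The action of a transition map on components of tangent vectors at \<open>p\<close>. At
  a point of the chart, \<open>vec_of_coords\<close> and \<open>coords_of_vec\<close> are the cases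
  where one of the charts is \<open>chart_at M p\<close>.\<close>

definition coord_change :: "('m, 'n) chart \<Rightarrow> ('m, 'n) chart \<Rightarrow> 'm \<Rightarrow> real ^ 'n \<Rightarrow> real ^ 'n::finite"
  where "coord_change c d p = dird (cmap d \<circ> cinv c) (cmap c p)"

context
  fixes M :: "('m::{t2_space, second_countable_topology}, 'n::finite) mfd"
  assumes M: "smooth_manifold M"
begin

lemma chart_open: "c \<in> charts M \<Longrightarrow> open (cdom c)" "c \<in> charts M \<Longrightarrow> open (cimg c)"
  and chart_homeo: "c \<in> charts M \<Longrightarrow> homeomorphism (cdom c) (cimg c) (cmap c) (cinv c)"
  and transition_smooth: "c \<in> charts M \<Longrightarrow> d \<in> charts M \<Longrightarrow>
        smooth_on (cmap c ` (cdom c \<inter> cdom d)) (cmap d \<circ> cinv c)"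
  and chart_at: "chart_at M p \<in> charts M" "p \<in> cdom (chart_at M p)"
  using M by (auto simp: smooth_manifold_def)

lemma cinv_cmap: "c \<in> charts M \<Longrightarrow> p \<in> cdom c \<Longrightarrow> cinv c (cmap c p) = p"
  using homeomorphism_apply1[OF chart_homeo] .

lemma open_cmap_image:
  assumes "c \<in> charts M" "open N" "N \<subseteq> cdom c"
  shows "open (cmap c ` N)"
proof -
  have "openin (top_of_set (cdom c)) N"
    using assms by (metis openin_open_eq chart_open(1))
  then have "openin (top_of_set (cimg c)) (cmap c ` N)"
    by (rule homeomorphism_imp_open_map[OF chart_homeo[OF assms(1)]])
  then show ?thesis using openin_open_trans chart_open(2)[OF assms(1)] by blast
qed

lemma open_cinv_image:
  assumes "c \<in> charts M" "open N" "N \<subseteq> cimg c"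
  shows "open (cinv c ` N)"
proof -
  have "openin (top_of_set (cimg c)) N"
    using assms by (metis openin_open_eq chart_open(2))
  then have "openin (top_of_set (cdom c)) (cinv c ` N)"
    by (rule homeomorphism_imp_open_map[OF homeomorphism_symD[OF chart_homeo[OF assms(1)]]])
  then show ?thesis using openin_open_trans chart_open(1)[OF assms(1)] by blast
qed

lemma coord_change_deriv:
  assumes "c \<in> charts M" "d \<in> charts M" "p \<in> cdom c" "p \<in> cdom d"
  shows "(cmap d \<circ> cinv c has_derivative coord_change c d p) (at (cmap c p))"
  unfolding coord_change_def using assms
  by (intro has_derivative_dird smooth_on_differentiable[OF transition_smooth]) auto

lemma coord_change_linear:
  "c \<in> charts M \<Longrightarrow> d \<in> charts M \<Longrightarrow> p \<in> cdom c \<Longrightarrow> p \<in> cdom d \<Longrightarrow> linear (coord_change c d p)"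
  using coord_change_deriv has_derivative_linear by blast

lemma coord_change_comp:
  assumes "c \<in> charts M" "d \<in> charts M" "e \<in> charts M" "p \<in> cdom c" "p \<in> cdom d" "p \<in> cdom e"
  shows "coord_change d e p (coord_change c d p \<xi>) = coord_change c e p \<xi>"
proof -
  let ?N = "cdom c \<inter> cdom d \<inter> cdom e"
  have "(cmap d \<circ> cinv c) (cmap c p) = cmap d p" using assms by (simp add: cinv_cmap)
  then have "((cmap e \<circ> cinv d) \<circ> (cmap d \<circ> cinv c) has_derivative coord_change d e p \<circ> coord_change c d p) (at (cmap c p))"
    using coord_change_deriv[of d e p] assms by (intro diff_chain_at coord_change_deriv) auto
  then have "(cmap e \<circ> cinv c has_derivative coord_change d e p \<circ> coord_change c d p) (at (cmap c p))"
  \<comment> \<open>\<open>cinv\<close> is controlled only over the chart domain, so the two maps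
    are compared on the image of the triple overlap.\<close>
  proof (rule has_derivative_transform_within_open)
    show "open (cmap c ` ?N)"
      using assms by (intro open_cmap_image open_Int chart_open) auto
    show "((cmap e \<circ> cinv d) \<circ> (cmap d \<circ> cinv c)) x = (cmap e \<circ> cinv c) x" if "x \<in> cmap c ` ?N" for x
      using that assms by (auto simp: cinv_cmap)
  qed (use assms in auto)
  then have "coord_change c e p = coord_change d e p \<circ> coord_change c d p"
    unfolding coord_change_def[of c e] by (rule dird_eqI)
  then show ?thesis by simp
qed

lemma coord_change_self:
  assumes "c \<in> charts M" "p \<in> cdom c"
  shows "coord_change c c p = (\<lambda>\<xi>. \<xi>)"
  unfolding coord_change_def
proof (rule dird_eqI, rule has_derivative_transform_within_open[OF has_derivative_ident chart_open(2)[OF assms(1)]])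
  show "x = (cmap c \<circ> cinv c) x" if "x \<in> cimg c" for x
    using that assms by (auto simp: cinv_cmap)
qed (use assms in auto)

lemma vec_of_coords_coord_change:
  "c \<in> charts M \<Longrightarrow> p \<in> cdom c \<Longrightarrow> vec_of_coords M c (cmap c p) \<xi> = coord_change c (chart_at M p) p \<xi>"
  by (simp add: vec_of_coords_def coord_change_def cinv_cmap)

lemma coords_of_vec_coord_change: "coords_of_vec M c p v = coord_change (chart_at M p) c p v"
  by (simp add: coords_of_vec_def coord_change_def)

lemma rep_tensor_coord_change:
  "c \<in> charts M \<Longrightarrow> p \<in> cdom c \<Longrightarrow> rep_tensor M c T (cmap c p) \<xi> \<eta> =
    T p (coord_change c (chart_at M p) p \<xi>) (coord_change c (chart_at M p) p \<eta>)"
  by (simp add: rep_tensor_def vec_of_coords_coord_change cinv_cmap)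

lemma coord_change_inverse:
  "c \<in> charts M \<Longrightarrow> d \<in> charts M \<Longrightarrow> p \<in> cdom c \<Longrightarrow> p \<in> cdom d \<Longrightarrow> coord_change d c p (coord_change c d p \<xi>) = \<xi>"
  by (simp add: coord_change_comp coord_change_self)

lemma rep_tensor_change:
  assumes "c \<in> charts M" "d \<in> charts M" "p \<in> cdom c" "p \<in> cdom d"
  shows "rep_tensor M c T (cmap c p) \<xi> \<eta> =
    rep_tensor M d T (cmap d p) (coord_change c d p \<xi>) (coord_change c d p \<eta>)"
  using assms chart_at[of p] by (simp add: rep_tensor_coord_change coord_change_comp)

lemma rep_tensor_bilinear:
  assumes "c \<in> charts M" "p \<in> cdom c" "bilinear (T p)"
  shows "bilinear (rep_tensor M c T (cmap c p))"
  using coord_change_linear[OF assms(1) chart_at(1) assms(2) chart_at(2)] assms(3)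
  by (auto simp: bilinear_def linear_iff rep_tensor_coord_change[OF assms(1,2)])

lemma chart_magnetic_rep:
  assumes "riemannian_metric M g" "two_form M \<sigma>" "c \<in> charts M"
  shows "chart_magnetic (cimg c) (rep_tensor M c g) (rep_tensor M c \<sigma>)"
proof
  show "open (cimg c)" by (rule chart_open(2)[OF assms(3)])
  have g: "bilinear (g p)" "g p v w = g p w v" "v \<noteq> 0 \<Longrightarrow> g p v v > 0" for p v w
    using assms(1) unfolding riemannian_metric_def smooth_tensor_def by blast+
  have s: "bilinear (\<sigma> p)" "\<sigma> p v w = - \<sigma> p w v" for p v w
    using assms(2) unfolding two_form_def smooth_tensor_def by blast+
  fix x assume "x \<in> cimg c"
  then obtain p where p: "p \<in> cdom c" "x = cmap c p" by blast
  note rep = rep_tensor_coord_change[OF assms(3) p(1)]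
  have nz: "coord_change c (chart_at M p) p \<xi> \<noteq> 0" if "\<xi> \<noteq> 0" for \<xi>
  proof
    assume 0: "coord_change c (chart_at M p) p \<xi> = 0"
    have "\<xi> = coord_change (chart_at M p) c p (coord_change c (chart_at M p) p \<xi>)"
      by (rule coord_change_inverse[symmetric, OF assms(3) chart_at(1) p(1) chart_at(2)])
    also have "\<dots> = 0"
      unfolding 0 by (rule linear_0[OF coord_change_linear[OF chart_at(1) assms(3) chart_at(2) p(1)]])
    finally show False using that by blast
  qed
  show "inner_form (rep_tensor M c g x)"
    unfolding inner_form_def p(2)
  proof (intro conjI allI impI)
    show "bilinear (rep_tensor M c g (cmap c p))" by (rule rep_tensor_bilinear[OF assms(3) p(1) g(1)])
    show "rep_tensor M c g (cmap c p) v w = rep_tensor M c g (cmap c p) w v" for v w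
      unfolding rep by (rule g(2))
    show "rep_tensor M c g (cmap c p) v v > 0" if "v \<noteq> 0" for v
      unfolding rep by (rule g(3)[OF nz[OF that]])
  qed
  show "bilinear (rep_tensor M c \<sigma> x)"
    unfolding p(2) by (rule rep_tensor_bilinear[OF assms(3) p(1) s(1)])
  show "rep_tensor M c \<sigma> x v w = - rep_tensor M c \<sigma> x w v" for v w
    unfolding p(2) rep by (rule s(2))
next
  show "smooth_on (cimg c) (\<lambda>x. rep_tensor M c g x \<xi> \<eta>)" for \<xi> \<eta>
    using assms(1,3) unfolding riemannian_metric_def smooth_tensor_def by blast
  show "smooth_on (cimg c) (\<lambda>x. rep_tensor M c \<sigma> x \<xi> \<eta>)" for \<xi> \<eta>
    using assms(2,3) unfolding two_form_def smooth_tensor_def by blast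
qed

lemma riemannian_inner_form: "riemannian_metric M g \<Longrightarrow> inner_form (g p)"
  by (auto simp: riemannian_metric_def smooth_tensor_def inner_form_def)

text \<open>\<open>nabla_endo\<close> differentiates the representation of the global endomorphism,
  \<open>local_magnetic_Ric\<close> the Lorentz endomorphism of the represented tensors; this
  reconciles them on the whole chart.\<close>

lemma rep_endo_lorentz:
  assumes "riemannian_metric M g" "two_form M \<sigma>" "c \<in> charts M" "x \<in> cimg c"
  shows "rep_endo M c (lorentz g \<sigma>) x \<xi> = lorentz (rep_tensor M c g) (rep_tensor M c \<sigma>) x \<xi>"
proof -
  interpret chart_magnetic "cimg c" "rep_tensor M c g" "rep_tensor M c \<sigma>"
    by (rule chart_magnetic_rep[OF assms(1-3)])
  obtain p where p: "p \<in> cdom c" "x = cmap c p" using assms(4) by blast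
  let ?u = "coord_change c (chart_at M p) p \<xi>"
  have "linear (\<sigma> p ?u)"
    using assms(2) unfolding two_form_def smooth_tensor_def bilinear_def by blast
  then have L: "g p (lorentz g \<sigma> p ?u) w = \<sigma> p ?u w" for w
    using sharp_works[OF riemannian_inner_form[OF assms(1)], of "\<sigma> p ?u"] by (simp add: lorentz_def sharp_def)
  have "lorentz (rep_tensor M c g) (rep_tensor M c \<sigma>) x \<xi> = coord_change (chart_at M p) c p (lorentz g \<sigma> p ?u)"
    by (rule lorentz_eqI[OF assms(4)])
      (simp add: p rep_tensor_coord_change assms(3) coord_change_inverse chart_at L)
  then show ?thesis
    by (simp add: rep_endo_def p cinv_cmap assms(3) coords_of_vec_coord_change vec_of_coords_coord_change)
qed

lemma magnetic_Ric_chart_at: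
  fixes p
  assumes "riemannian_metric M g" "two_form M \<sigma>"
  defines "c \<equiv> chart_at M p"
  shows "magnetic_Ric M g \<sigma> (p, v) = local_magnetic_Ric (rep_tensor M c g) (rep_tensor M c \<sigma>) (cmap c p) v"
proof -
  have c: "c \<in> charts M" "p \<in> cdom c" by (simp_all add: c_def chart_at)
  then have x: "cmap c p \<in> cimg c" by blast
  interpret chart_magnetic "cimg c" "rep_tensor M c g" "rep_tensor M c \<sigma>"
    by (rule chart_magnetic_rep[OF assms(1,2) c(1)])
  \<comment> \<open>Holds at \<open>p\<close> only: at other points of the chart the tangent space
    is represented through another preferred chart, possibly unrelated to \<open>c\<close>.\<close>
  have rep: "rep_tensor M c T (cmap c p) = T p" for T
    using coord_change_self[OF c] by (simp add: fun_eq_iff rep_tensor_coord_change c flip: c_def)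
  have lor: "Y (cmap c p) w = lorentz g \<sigma> p w" for w
    by (simp add: lorentz_def rep)
  have eq: "rep_endo M c (lorentz g \<sigma>) y w = Y y w" if "y \<in> cimg c" for y w
    by (rule rep_endo_lorentz[OF assms(1,2) c(1) that])
  \<comment> \<open>Agreement at \<open>p\<close> would not suffice under the derivative; equality
    on the chart image is what is used.\<close>
  have "dird (\<lambda>y. rep_endo M c (lorentz g \<sigma>) y v) (cmap c p) = dird (\<lambda>y. Y y v) (cmap c p)"
    by (rule dird_cong_open[OF open_S x eq])
  then have "nabla_endo M g (lorentz g \<sigma>) p w v = cov_deriv_endo (rep_tensor M c g) Y (cmap c p) w v" for w
    by (simp add: nabla_endo_def cov_deriv_endo_def Let_def eq x flip: c_def)
  then show ?thesis
    by (simp add: magnetic_Ric_def local_magnetic_Ric_def Ric_def Let_def Y_tilde_def lor rep flip: c_def)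
qed

text \<open>Here \<open>d\<close> is fixed while \<open>p\<close> varies. This makes estimates
  uniform in \<open>p\<close> possible, since the defining chart \<open>chart_at M p\<close> may
  jump from point to point.\<close>

lemma magnetic_Ric_local:
  assumes "riemannian_metric M g" "two_form M \<sigma>" "d \<in> charts M" "p \<in> cdom d"
  shows "magnetic_Ric M g \<sigma> (p, v) =
    local_magnetic_Ric (rep_tensor M d g) (rep_tensor M d \<sigma>) (cmap d p) (coord_change (chart_at M p) d p v)"
proof -
  define c where "c = chart_at M p"
  have c: "c \<in> charts M" "p \<in> cdom c" by (simp_all add: c_def chart_at)
  let ?S' = "cmap c ` (cdom c \<inter> cdom d)"
  interpret chart_magnetic "cimg d" "rep_tensor M d g" "rep_tensor M d \<sigma>"
    by (rule chart_magnetic_rep[OF assms(1-3)])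
  interpret chart_c: chart_magnetic "cimg c" "rep_tensor M c g" "rep_tensor M c \<sigma>"
    by (rule chart_magnetic_rep[OF assms(1,2) c(1)])
  interpret chart_change "cimg d" ?S' "rep_tensor M d g" "rep_tensor M c g" "rep_tensor M d \<sigma>"
    "rep_tensor M c \<sigma>" "cmap d \<circ> cinv c"
  proof
    show "open ?S'" using assms c by (intro open_cmap_image open_Int chart_open) auto
    show "smooth_on ?S' (\<lambda>x. rep_tensor M c g x \<xi> \<eta>)" "smooth_on ?S' (\<lambda>x. rep_tensor M c \<sigma> x \<xi> \<eta>)" for \<xi> \<eta>
      by (rule smooth_on_subset[OF chart_c.smooth] smooth_on_subset[OF chart_c.\<omega>_smooth]; blast)+
    show "smooth_on ?S' (cmap d \<circ> cinv c)" by (rule transition_smooth[OF c(1) assms(3)])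
    fix x assume "x \<in> ?S'"
    then obtain q where q: "q \<in> cdom c" "q \<in> cdom d" "x = cmap c q" by blast
    then have x: "x \<in> cimg c" by blast
    show "inner_form (rep_tensor M c g x)" "bilinear (rep_tensor M c \<sigma> x)"
      by (rule chart_c.inner[OF x], rule chart_c.\<omega>_bilinear[OF x])
    show "rep_tensor M c \<sigma> x v w = - rep_tensor M c \<sigma> x w v" for v w
      by (rule chart_c.\<omega>_skew[OF x])
    show "(cmap d \<circ> cinv c) x \<in> cimg d" using q by (simp add: cinv_cmap c)
    have "dird (cmap d \<circ> cinv c) x = coord_change c d q" "(cmap d \<circ> cinv c) x = cmap d q"
      using q by (simp_all add: coord_change_def cinv_cmap c)
    then have rep: "rep_tensor M c T x \<xi> \<eta> = rep_tensor M d T ((cmap d \<circ> cinv c) x)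
        (dird (cmap d \<circ> cinv c) x \<xi>) (dird (cmap d \<circ> cinv c) x \<eta>)" for T \<xi> \<eta>
      using rep_tensor_change[OF c(1) assms(3) q(1,2)] q(3) by simp
    show "rep_tensor M c g x \<xi> \<eta> = rep_tensor M d g ((cmap d \<circ> cinv c) x)
        (dird (cmap d \<circ> cinv c) x \<xi>) (dird (cmap d \<circ> cinv c) x \<eta>)" for \<xi> \<eta>
      by (rule rep)
    show "rep_tensor M c \<sigma> x \<xi> \<eta> = rep_tensor M d \<sigma> ((cmap d \<circ> cinv c) x)
        (dird (cmap d \<circ> cinv c) x \<xi>) (dird (cmap d \<circ> cinv c) x \<eta>)" for \<xi> \<eta>
      by (rule rep)
  qed
  have "cmap c p \<in> ?S'" using c assms by blast
  from local_magnetic_Ric_pull[OF this, of v] show ?thesis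
    using magnetic_Ric_chart_at[OF assms(1,2), of p v] c
    by (simp add: cinv_cmap coord_change_def flip: c_def)
qed

lemma jacobi_metric_riemannian:
  assumes g: "riemannian_metric M g" and U: "smooth_function M U" and s: "\<And>q. U q < s"
  shows "riemannian_metric M (jacobi_metric g U s)"
  unfolding riemannian_metric_def smooth_tensor_def
proof (intro conjI allI impI ballI)
  fix p v w
  note i = riemannian_inner_form[OF g, of p]
  show "bilinear (jacobi_metric g U s p)"
    using i by (auto simp: inner_form_def jacobi_metric_def bilinear_def linear_iff algebra_simps)
  show "jacobi_metric g U s p v w = jacobi_metric g U s p w v"
    using i by (simp add: inner_form_def jacobi_metric_def)
  show "jacobi_metric g U s p v v > 0" if "v \<noteq> 0"
    using i s[of p] that by (simp add: inner_form_def jacobi_metric_def)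
next
  fix c \<xi> \<eta> assume c: "c \<in> charts M"
  have "smooth_on (cimg c) (U \<circ> cinv c)" using U c by (simp add: smooth_function_def)
  moreover have "smooth_on (cimg c) (\<lambda>x. rep_tensor M c g x \<xi> \<eta>)"
    using g c by (simp add: riemannian_metric_def smooth_tensor_def)
  ultimately have "smooth_on (cimg c) (\<lambda>x. (2 * (s - (U \<circ> cinv c) x)) * rep_tensor M c g x \<xi> \<eta>)"
    by (intro smooth_on_mult smooth_on_diff smooth_on_const chart_open(2)[OF c])
  then show "smooth_on (cimg c) (\<lambda>x. rep_tensor M c (jacobi_metric g U s) x \<xi> \<eta>)"
    by (simp add: rep_tensor_def jacobi_metric_def)
qed

end


section \<open>Potentials with small second derivatives\<close>

text \<open>The second-order Taylor bound has to be nonnegative at its minimiser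
  $x - (\partial_uF(x)/2\epsilon)\,u$.\<close>

lemma derivative_square_le:
  fixes F :: "'a::euclidean_space \<Rightarrow> real"
  assumes "smooth_on S F" "cball x r \<subseteq> S" "norm u = 1" "\<epsilon> > 0"
    and pos: "\<And>y. y \<in> cball x r \<Longrightarrow> F y \<ge> 0"
    and d1: "\<bar>dird F x u\<bar> \<le> 2 * \<epsilon> * r"
    and d2: "\<And>y. y \<in> cball x r \<Longrightarrow> \<bar>dird (\<lambda>y. dird F y u) y u\<bar> \<le> 2 * \<epsilon>"
  shows "(dird F x u)\<^sup>2 \<le> 4 * \<epsilon> * F x"
proof (cases "dird F x u = 0")
  \<comment> \<open>Separated because the Taylor expansion needs an endpoint \<open>t0\<close>
    different from 0. The claim reduces to \<open>F x \<ge> 0\<close>, and \<open>x\<close> lies in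
    the ball because the bound on the derivative forces \<open>r \<ge> 0\<close>.\<close>
  case True
  have "r \<ge> 0" using d1 \<open>\<epsilon> > 0\<close> by (smt (verit) mult_pos_neg)
  then show ?thesis using True pos[of x] \<open>\<epsilon> > 0\<close> by simp
next
  case False
  define t0 where "t0 = - dird F x u / (2 * \<epsilon>)"
  \<comment> \<open>The hypothesis on the first derivative says exactly that the minimiser stays
    inside the ball.\<close>
  have t0: "t0 \<noteq> 0" "\<bar>t0\<bar> \<le> r"
    using False d1 \<open>\<epsilon> > 0\<close> by (auto simp: t0_def abs_mult field_simps)
  \<comment> \<open>The sequence of derivatives along the line in the format of Taylor's theorem;
    entries beyond 2 are never consulted.\<close>
  define D :: "nat \<Rightarrow> real \<Rightarrow> real" where "D n t = (if n = 0 then F (x + t *\<^sub>R u)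
    else if n = 1 then dird F (x + t *\<^sub>R u) u else dird (\<lambda>y. dird F y u) (x + t *\<^sub>R u) u)" for n t
  have inball: "x + t *\<^sub>R u \<in> cball x r" if "\<bar>t\<bar> \<le> r" for t
    using that assms(3) by (simp add: dist_norm)
  have chain: "((\<lambda>t. f (x + t *\<^sub>R u)) has_real_derivative dird f (x + t *\<^sub>R u) u) (at t)"
    if "smooth_on S f" "\<bar>t\<bar> \<le> r" for f :: "'a \<Rightarrow> real" and t
  proof -
    have f: "f differentiable (at (x + t *\<^sub>R u))"
      using smooth_on_differentiable[OF that(1)] inball[OF that(2)] assms(2) by blast
    have "((\<lambda>s. x + s *\<^sub>R u) has_derivative (\<lambda>h. h *\<^sub>R u)) (at t)"
      by (auto intro!: derivative_eq_intros)
    from diff_chain_at[OF this has_derivative_dird[OF f]] show ?thesis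
      by (simp add: has_field_derivative_def o_def linear_cmul[OF linear_dird[OF f]] mult.commute[of _ "dird f (x + t *\<^sub>R u) u"])
  qed
  have "\<forall>m t. m < 2 \<and> - r \<le> t \<and> t \<le> r \<longrightarrow> DERIV (D m) t :> D (Suc m) t"
  proof (intro allI impI)
    fix m :: nat and t assume "m < 2 \<and> - r \<le> t \<and> t \<le> r"
    then have t: "\<bar>t\<bar> \<le> r" and "m = 0 \<or> m = 1" by auto
    then show "DERIV (D m) t :> D (Suc m) t"
      using chain[OF assms(1) t] chain[OF smooth_on_dird[OF assms(1)] t] by (auto simp: D_def[abs_def])
  qed
  then obtain t where t: "if t0 < 0 then t0 < t \<and> t < 0 else 0 < t \<and> t < t0"
    and eq: "D 0 t0 = (\<Sum>m<2. D m 0 / fact m * (t0 - 0) ^ m) + D 2 t / fact 2 * (t0 - 0)\<^sup>2"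
    using Taylor[of 2 D "D 0" "- r" r 0 t0] t0 by (auto simp: abs_le_iff)
  have tr: "\<bar>t\<bar> \<le> r" using t t0 by (auto split: if_splits)
  have "0 \<le> F (x + t0 *\<^sub>R u)" by (rule pos[OF inball[OF t0(2)]])
  also have "\<dots> = F x + dird F x u * t0 + D 2 t / 2 * t0\<^sup>2"
    using eq by (simp add: D_def numeral_2_eq_2)
  also have "\<dots> \<le> F x + dird F x u * t0 + \<epsilon> * t0\<^sup>2"
    using d2[OF inball[OF tr]] by (intro add_left_mono mult_right_mono) (auto simp: D_def)
  also have "\<dots> = F x - (dird F x u)\<^sup>2 / (4 * \<epsilon>)"
    using \<open>\<epsilon> > 0\<close> by (simp add: t0_def power2_eq_square field_simps)
  finally show ?thesis using \<open>\<epsilon> > 0\<close> by (simp add: field_simps)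
qed

lemma C2_ball_mono:
  assumes "\<epsilon> \<le> \<epsilon>'"
  shows "C2_ball M f c K \<epsilon> \<subseteq> C2_ball M f c K \<epsilon>'"
proof -
  have "a < \<epsilon>'" if "a < \<epsilon>" for a using that assms by simp
  then show ?thesis unfolding C2_ball_def Let_def by blast
qed

text \<open>Positivity is obtained on \<open>N\<close>, but the C^2 bound is imposed on the larger
  \<open>K\<close>, which contains the coordinate balls of radius \<open>r\<close> around points of
  \<open>N\<close> that \<open>derivative_square_le\<close> requires.\<close>

lemma local_em_Ric_pos:
  fixes M :: "('m::{t2_space, second_countable_topology}, 'n::finite) mfd"
  assumes M: "smooth_manifold M" and \<sigma>: "two_form M \<sigma>" and g: "riemannian_metric M g"
    and nonzero: "\<And>p. \<exists>v w. \<sigma> p v w \<noteq> 0"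
  shows "\<exists>c N K \<epsilon>. c \<in> charts M \<and> open N \<and> p \<in> N \<and> N \<subseteq> K \<and> compact K \<and> K \<subseteq> cdom c \<and> \<epsilon> > 0 \<and>
    (\<forall>U s q v. U \<in> C2_ball M (\<lambda>_. 0) c K \<epsilon> \<longrightarrow> smooth_function M U \<longrightarrow> (\<forall>q. U q < s) \<longrightarrow>
      q \<in> N \<longrightarrow> s - U q \<le> \<epsilon> \<longrightarrow> v \<noteq> 0 \<longrightarrow> em_Ric M g \<sigma> U s (q, v) > 0)"
proof -
  define c where "c = chart_at M p"
  have c: "c \<in> charts M" "p \<in> cdom c" by (simp_all add: c_def chart_at[OF M])
  note open_S = chart_open(2)[OF M c(1)]
  interpret chart_magnetic "cimg c" "rep_tensor M c g" "rep_tensor M c \<sigma>"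
    by (rule chart_magnetic_rep[OF M g \<sigma> c(1)])
  define x0 where "x0 = cmap c p"
  obtain R where R: "R > 0" "cball x0 R \<subseteq> cimg c"
    using open_S c(2) unfolding open_contains_cball x0_def by blast
  \<comment> \<open>Half the available radius, so that balls of radius \<open>r\<close> around
    points of \<open>ball x0 r\<close> remain in the chart image.\<close>
  define r where "r = R / 2"
  have r: "r > 0" "cball x0 (2 * r) \<subseteq> cimg c" using R by (auto simp: r_def)
  have sub: "cball x0 r \<subseteq> cimg c" using r by auto
  have rep_nonzero: "\<forall>x\<in>cball x0 r. \<exists>v w. rep_tensor M c \<sigma> x v w \<noteq> 0"
  proof
    fix x assume x: "x \<in> cball x0 r"
    obtain q where q: "q \<in> cdom c" "x = cmap c q" using x sub by blast
    obtain v w where vw: "\<sigma> q v w \<noteq> 0" using nonzero by blast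
    have "rep_tensor M c \<sigma> x (coord_change (chart_at M q) c q v) (coord_change (chart_at M q) c q w) = \<sigma> q v w"
      unfolding q(2) rep_tensor_coord_change[OF M c(1) q(1)]
      using coord_change_inverse[OF M chart_at(1)[OF M] c(1) chart_at(2)[OF M] q(1)] by simp
    then show "\<exists>v w. rep_tensor M c \<sigma> x v w \<noteq> 0" using vw by metis
  qed
  obtain \<delta> where \<delta>: "\<delta> > 0" and "\<forall>F x v. smooth_on (cimg c) F \<longrightarrow> (\<forall>y\<in>cimg c. F y > 0) \<longrightarrow>
      x \<in> cball x0 r \<longrightarrow> F x \<le> \<delta> \<longrightarrow> (\<forall>i. (dird F x (axis i 1))\<^sup>2 \<le> \<delta> * F x) \<longrightarrow>
      (\<forall>i j. \<bar>dird (\<lambda>y. dird F y (axis i 1)) x (axis j 1)\<bar> \<le> \<delta>) \<longrightarrow>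
      F x * rep_tensor M c g x v v = 1 \<longrightarrow>
      local_magnetic_Ric (\<lambda>y \<xi> \<eta>. F y * rep_tensor M c g y \<xi> \<eta>) (rep_tensor M c \<sigma>) x v > 0"
    using local_magnetic_Ric_conformal_pos[OF compact_cball sub rep_nonzero]
    by (elim exE conjE)
  note local_pos = this(2)[rule_format]
  \<comment> \<open>F = 2 (s - U) doubles all bounds: F and its second derivatives are at most
    \<delta>/4, its first derivatives at most (\<delta>/4) r. This meets the requirements of
    \<open>derivative_square_le\<close> with constant \<delta>/4.\<close>
  define \<epsilon> where "\<epsilon> = \<delta> / 8 * min 1 r"
  have \<epsilon>: "\<epsilon> > 0" "\<epsilon> \<le> \<delta> / 8" "\<epsilon> \<le> \<delta> / 8 * r"
    using \<delta> r(1) unfolding \<epsilon>_def by (auto intro: mult_left_le)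
  define N where "N = cinv c ` ball x0 r"
  define K where "K = cinv c ` cball x0 (2 * r)"
  note homeo = chart_homeo[OF M c(1)]
  have cinv_in: "cinv c y \<in> cdom c" "cmap c (cinv c y) = y" if "y \<in> cimg c" for y
    using that homeo by (auto simp: homeomorphism_def)
  have ball_sub: "ball x0 r \<subseteq> cball x0 (2 * r)" using r(1) by auto
  have "em_Ric M g \<sigma> U s (q, v) > 0"
    if U: "U \<in> C2_ball M (\<lambda>_. 0) c K \<epsilon>" "smooth_function M U" and s: "\<And>q. U q < s"
      and q: "q \<in> N" "s - U q \<le> \<epsilon>" and v: "v \<noteq> 0" for U s q v
  proof -
    define H where "H = U \<circ> cinv c"
    define F where "F y = 2 * (s - H y)" for y
    have H: "smooth_on (cimg c) H" using U(2) c by (simp add: H_def smooth_function_def)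
    have F: "smooth_on (cimg c) F"
      unfolding F_def by (intro smooth_on_mult smooth_on_diff smooth_on_const H open_S)
    have Fpos: "F y > 0" for y using s by (simp add: F_def H_def)
    \<comment> \<open>\<open>C2_ball\<close> quantifies over coordinates of points of
      \<open>K\<close>; these are exactly the closed ball from which \<open>K\<close> was
      made.\<close>
    have "cmap c ` K = (\<lambda>y. y) ` cball x0 (2 * r)"
      unfolding K_def image_image by (rule image_cong[OF refl cinv_in(2)]) (use r(2) in blast)
    then have HC: "\<bar>dird H y (axis i 1)\<bar> < \<epsilon>" "\<bar>dird (\<lambda>y. dird H y (axis i 1)) y (axis j 1)\<bar> < \<epsilon>"
      if "y \<in> cball x0 (2 * r)" for y i j
      using U(1) that by (auto simp: C2_ball_def Let_def H_def o_def)
    have dF: "dird F y h = -2 * dird H y h" if "y \<in> cimg c" for y h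
    proof -
      have "(F has_derivative (\<lambda>h. 2 * (0 - dird H y h))) (at y)"
        unfolding F_def[abs_def]
        by (intro has_derivative_mult_right has_derivative_diff has_derivative_const has_derivative_dird
            smooth_on_differentiable[OF H that])
      then show ?thesis by (simp add: dird_eqI)
    qed
    have ddF: "dird (\<lambda>y. dird F y h) y k = -2 * dird (\<lambda>y. dird H y h) y k" if "y \<in> cimg c" for y h k
    proof -
      have "dird (\<lambda>y. dird F y h) y = dird (\<lambda>y. -2 * dird H y h) y"
        by (rule dird_cong_open[OF open_S that dF])
      also have "\<dots> = (\<lambda>k. -2 * dird (\<lambda>y. dird H y h) y k)"
        by (rule dird_eqI) (intro has_derivative_mult_right has_derivative_dird
            smooth_on_differentiable[OF smooth_on_dird[OF H] that])
      finally show ?thesis by simp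
    qed
    obtain x where x: "x \<in> ball x0 r" "q = cinv c x" using q(1) by (auto simp: N_def)
    have xc: "x \<in> cimg c" using x(1) sub by auto
    have xq: "q \<in> cdom c" "cmap c q = x" using cinv_in[OF xc] x(2) by auto
    have near: "cball x r \<subseteq> cball x0 (2 * r)"
    proof
      show "y \<in> cball x0 (2 * r)" if "y \<in> cball x r" for y
        using x(1) that dist_triangle[of x0 y x] by simp
    qed
    have x2: "x \<in> cball x0 (2 * r)" using x(1) ball_sub by blast
    have F1: "(dird F x (axis i 1))\<^sup>2 \<le> \<delta> * F x" for i
    proof -
      \<comment> \<open>The constant \<delta>/4 is chosen so that the factor 4 in
        \<open>derivative_square_le\<close> yields \<open>\<delta> * F x\<close>.\<close>
      have "(dird F x (axis i 1))\<^sup>2 \<le> 4 * (\<delta> / 4) * F x"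
      proof (rule derivative_square_le[OF F])
        show "cball x r \<subseteq> cimg c" using near r(2) by blast
        show "\<bar>dird F x (axis i 1)\<bar> \<le> 2 * (\<delta> / 4) * r"
          using HC(1)[OF x2, of i] \<epsilon>(3) dF[OF xc] by (simp add: abs_mult)
        fix y assume "y \<in> cball x r"
        then have y: "y \<in> cball x0 (2 * r)" using near by blast
        show "\<bar>dird (\<lambda>y. dird F y (axis i 1)) y (axis i 1)\<bar> \<le> 2 * (\<delta> / 4)"
          using HC(2)[OF y, of i i] \<epsilon>(2) ddF[of y] r(2) y by (auto simp: abs_mult subset_iff)
      qed (use \<delta> Fpos in \<open>auto intro: less_imp_le\<close>)
      then show ?thesis by simp
    qed
    have F2: "\<bar>dird (\<lambda>y. dird F y (axis i 1)) x (axis j 1)\<bar> \<le> \<delta>" for i j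
      using HC(2)[OF x2, of i j] \<epsilon>(2) \<delta> ddF[OF xc] by (simp add: abs_mult)
    have Fx: "F x = 2 * (s - U q)" by (simp add: F_def H_def x(2))
    define J where "J = jacobi_metric g U s"
    have J: "riemannian_metric M J"
      unfolding J_def by (rule jacobi_metric_riemannian[OF M g U(2) s])
    have repJ: "rep_tensor M c J = (\<lambda>y \<xi> \<eta>. F y * rep_tensor M c g y \<xi> \<eta>)"
      by (simp add: fun_eq_iff J_def rep_tensor_def jacobi_metric_def F_def H_def)
    have Jpos: "J q v v > 0" using J v by (simp add: riemannian_metric_def)
    define v' where "v' = (1 / sqrt (J q v v)) *\<^sub>R v"
    have Jv': "J q v' v' = 1"
      using Jpos riemannian_inner_form[OF M J, of q]
      by (simp add: v'_def inner_form_def bilinear_lmul bilinear_rmul)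
    let ?w = "coord_change (chart_at M q) c q v'"
    have "rep_tensor M c J x ?w ?w = 1"
      using rep_tensor_coord_change[OF M c(1) xq(1), of J ?w ?w]
        coord_change_inverse[OF M chart_at(1)[OF M] c(1) chart_at(2)[OF M] xq(1)] Jv' xq(2) by simp
    then have unit: "F x * rep_tensor M c g x ?w ?w = 1" by (simp add: repJ)
    have "local_magnetic_Ric (\<lambda>y \<xi> \<eta>. F y * rep_tensor M c g y \<xi> \<eta>) (rep_tensor M c \<sigma>) x ?w > 0"
    proof (rule local_pos[OF F Fpos _ _ F1 F2 unit])
      show "x \<in> cball x0 r" using x(1) by simp
      show "F x \<le> \<delta>" using q(2) \<epsilon>(2) \<delta> by (simp add: Fx)
    qed
    moreover have "em_Ric M g \<sigma> U s (q, v) = magnetic_Ric M J \<sigma> (q, v')"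
      by (simp add: em_Ric_def normalize_vec_def J_def v'_def)
    ultimately show ?thesis
      by (simp add: magnetic_Ric_local[OF M J \<sigma> c(1) xq(1)] repJ xq(2))
  qed
  moreover have "open N"
    unfolding N_def using sub by (intro open_cinv_image[OF M c(1)]) auto
  moreover have "compact K"
    unfolding K_def
    by (intro compact_continuous_image continuous_on_subset[OF homeomorphism_cont2[OF homeo]] r(2)) simp
  moreover have "p \<in> N"
    unfolding N_def using r(1) cinv_cmap[OF M c] by (auto simp: x0_def image_iff intro!: bexI[of _ "cmap c p"])
  moreover have "N \<subseteq> K" unfolding N_def K_def using ball_sub by blast
  moreover have "K \<subseteq> cdom c" unfolding K_def using cinv_in(1) r(2) by blast
  ultimately show ?thesis using c(1) \<epsilon>(1) by blast
qed

theorem theorem1p3: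
  fixes M :: "('m::{t2_space, second_countable_topology}, 'n::finite) mfd"
    and \<sigma> :: "('m, 'n) tensor02"
  assumes "closed_manifold M"
    and "CARD('n) \<ge> 2"
    and "closed_two_form M \<sigma>"
    and nowhere_vanishing: "\<And>p. \<exists>v w. \<sigma> p v w \<noteq> 0"
  shows "\<forall>g. riemannian_metric M g \<longrightarrow>
    (\<exists>V. C2_neighborhood M (\<lambda>_. 0) V \<and>
      (\<forall>U\<in>V. smooth_function M U \<longrightarrow> nu_Ric M g \<sigma> U > ereal (max_value U)))"
proof (intro allI impI)
  fix g assume g: "riemannian_metric M g"
  have M: "smooth_manifold M" "compact (UNIV :: 'm set)" and \<sigma>: "two_form M \<sigma>"
    using assms(1,3) by (auto simp: closed_manifold_def closed_two_form_def)
  obtain c N K \<epsilon> where loc: "\<And>p. c p \<in> charts M" "\<And>p. open (N p)" "\<And>p. p \<in> N p" "\<And>p. N p \<subseteq> K p"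
      "\<And>p. compact (K p)" "\<And>p. K p \<subseteq> cdom (c p)" "\<And>p. \<epsilon> p > 0"
    and pos: "\<And>p U s q v. U \<in> C2_ball M (\<lambda>_. 0) (c p) (K p) (\<epsilon> p) \<Longrightarrow> smooth_function M U \<Longrightarrow> (\<And>q. U q < s) \<Longrightarrow>
      q \<in> N p \<Longrightarrow> s - U q \<le> \<epsilon> p \<Longrightarrow> v \<noteq> 0 \<Longrightarrow> em_Ric M g \<sigma> U s (q, v) > 0"
    using local_em_Ric_pos[OF M(1) \<sigma> g nowhere_vanishing] by metis
  obtain P where P: "finite P" "UNIV \<subseteq> (\<Union>p\<in>P. N p)"
    using compactE_image[OF M(2), of UNIV N] loc(2,3) by (metis UNIV_I UN_iff subsetI)
  then have "P \<noteq> {}" by auto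
  \<comment> \<open>A third, because \<open>s - U q\<close> is split into
    \<open>s - max_value U\<close>, \<open>max_value U\<close> and \<open>- U q\<close>, each at
    most \<open>\<epsilon>0\<close>.\<close>
  define \<epsilon>0 where "\<epsilon>0 = Min (\<epsilon> ` P) / 3"
  have \<epsilon>0: "\<epsilon>0 > 0" "\<And>p. p \<in> P \<Longrightarrow> 3 * \<epsilon>0 \<le> \<epsilon> p"
    using P(1) \<open>P \<noteq> {}\<close> loc(7) by (auto simp: \<epsilon>0_def)
  \<comment> \<open>A finite intersection of subbasic sets around 0, hence open; one radius
    \<open>\<epsilon>0\<close> serves all members of the cover.\<close>
  define V where "V = (\<Inter>p\<in>P. C2_ball M (\<lambda>_. 0) (c p) (K p) \<epsilon>0)"
  have zero: "Ck_function M 2 (\<lambda>_. 0)" by (simp add: Ck_function_def o_def)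
  have "openin (C2_topology M) V"
    unfolding V_def
  proof (rule openin_INT2)
    fix p assume "p \<in> P"
    show "openin (C2_topology M) (C2_ball M (\<lambda>_. 0) (c p) (K p) \<epsilon>0)"
      unfolding C2_topology_def
      by (rule topology_generated_by_Basis) (use zero loc \<epsilon>0(1) in blast)
  qed (use P(1) \<open>P \<noteq> {}\<close> in auto)
  moreover have "(\<lambda>_. 0) \<in> V"
    using zero \<epsilon>0(1) by (auto simp: V_def C2_ball_def Let_def)
  ultimately have "C2_neighborhood M (\<lambda>_. 0) V"
    unfolding C2_neighborhood_def using openin_subset by blast
  moreover have "nu_Ric M g \<sigma> U > ereal (max_value U)" if U: "U \<in> V" "smooth_function M U" for U
  proof -
    have small: "\<bar>U q\<bar> < \<epsilon>0" for q
    proof -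
      obtain p where p: "p \<in> P" "q \<in> N p" using P(2) by blast
      have "U \<in> C2_ball M (\<lambda>_. 0) (c p) (K p) \<epsilon>0" using U(1) p(1) by (simp add: V_def)
      moreover have "q \<in> K p" using p(2) loc(4) by blast
      ultimately have "\<bar>(U \<circ> cinv (c p)) (cmap (c p) q)\<bar> < \<epsilon>0"
        by (auto simp: C2_ball_def Let_def)
      moreover have "q \<in> cdom (c p)" using \<open>q \<in> K p\<close> loc(6) by blast
      ultimately show ?thesis by (simp add: cinv_cmap[OF M(1) loc(1)])
    qed
    let ?e = "max_value U"
    \<comment> \<open>\<open>max_value\<close> is a conditional supremum, so boundedness must be
      known before it dominates the values of \<open>U\<close>.\<close>
    have "bdd_above (range U)" using small by (intro bdd_aboveI2[of _ _ \<epsilon>0]) (meson abs_less_iff less_imp_le)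
    then have upper: "U q \<le> ?e" for q unfolding max_value_def by (simp add: cSUP_upper)
    have "?e \<le> \<epsilon>0"
      unfolding max_value_def by (intro cSUP_least) (use small in \<open>auto simp: abs_less_iff intro: less_imp_le\<close>)
    have em: "em_Ric M g \<sigma> U s z > 0" if s: "?e < s" "s < ?e + \<epsilon>0" and z: "z \<in> energy_level g U s" for s z
    proof -
      obtain q v where qv: "z = (q, v)" by fastforce
      obtain p where p: "p \<in> P" "q \<in> N p" using P(2) by blast
      have lt: "U q < s" for q using upper s(1) by (rule le_less_trans)
      \<comment> \<open>On this energy level the kinetic energy is \<open>s - U q\<close>, which is
        positive because \<open>s\<close> exceeds the maximum.\<close>
      have "v \<noteq> 0"
        using z lt[of q] riemannian_inner_form[OF M(1) g, of q]
        by (auto simp: qv energy_level_def inner_form_def bilinear_lzero)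
      moreover have "U \<in> C2_ball M (\<lambda>_. 0) (c p) (K p) (\<epsilon> p)"
        using U(1) p(1) \<epsilon>0(2)[OF p(1)] \<epsilon>0(1) C2_ball_mono[of \<epsilon>0 "\<epsilon> p" M "\<lambda>_. 0" "c p" "K p"]
        by (auto simp: V_def)
      moreover have "s - U q \<le> \<epsilon> p"
        using small[of q] s(2) \<open>?e \<le> \<epsilon>0\<close> \<epsilon>0(2)[OF p(1)] by linarith
      ultimately show ?thesis unfolding qv using pos U(2) lt p(2) by blast
    qed
    let ?K = "{k. k > ?e \<and> (\<forall>s. ?e < s \<and> s < k \<longrightarrow> (\<forall>z\<in>energy_level g U s. em_Ric M g \<sigma> U s z > 0))}"
    have K: "?e + \<epsilon>0 \<in> ?K" using em \<epsilon>0(1) by simp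
    then have "ereal (?e + \<epsilon>0) \<le> (SUP k\<in>?K. ereal k)" by (rule SUP_upper)
    moreover have "ereal ?e < ereal (?e + \<epsilon>0)" using \<epsilon>0(1) by simp
    \<comment> \<open>The witness \<open>?e + \<epsilon>0\<close> shows that the set is nonempty, so
      the supremum branch of \<open>nu_Ric\<close> applies.\<close>
    moreover have "nu_Ric M g \<sigma> U = (SUP k\<in>?K. ereal k)"
      using K unfolding nu_Ric_def Let_def by (smt (verit) empty_iff)
    ultimately show ?thesis by (metis less_le_trans)
  qed
  ultimately show "\<exists>V. C2_neighborhood M (\<lambda>_. 0) V \<and>
      (\<forall>U\<in>V. smooth_function M U \<longrightarrow> nu_Ric M g \<sigma> U > ereal (max_value U))" by blast
qed

end
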